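(* Let $l\geq 3$ be an odd number and $q$ a primitive $l$-th root of unity. The kernel of the (projective) $\mathrm{SL}(2,\mathbb{Z})$-representation on the Higman ideal of the small quantum group $U_qsl(2)$ is a congruence subgroup of $\mathrm{SL}(2,\mathbb{Z})$.
   Context: Put $[n]=\frac{q^n-q^{-n}}{q-q^{-1}}$. $H=U_qsl(2)$ is the $l^3$-dimensional complex Hopf algebra generated by $E,F,K$ with $E^l=F^l=0$, $K^l=1$, $KE=q^2EK$, $KF=q^{-2}FK$, $[E,F]=\frac{K-K^{-1}}{q-q^{-1}}$, $\Delta(E)=1\otimes E+E\otimes K$, $\Delta(F)=K^{-1}\otimes F+F\otimes 1$, $\Delta(K)=K\otimes K$, $\epsilon(E)=\epsilon(F)=0$, $\epsilon(K)=1$, $S(E)=-EK^{-1}$, $S(F)=-KF$, $S(K)=K^{-1}$. It is a factorizable ribbon Hopf algebra with $R=\frac{1}{l}\sum_{0\leq m,i,j\leq l-1}\frac{(q-q^{-1})^m}{[m]!}q^{\frac{m(m-1)}{2}+2m(i-j)-2ij}E^mK^i\otimes F^mK^j$ and ribbon element $\theta$ (convention: $\theta$ central, $\Delta(\theta)=(R_{21}R)^{-1}(\theta\otimes\theta)$, $\epsilon(\theta)=1$, $S(\theta)=\theta$). Its integral is $\Lambda=\zeta F^{l-1}E^{l-1}\sum_{j=0}^{l-1}K^j$ with $\zeta=\frac{\sqrt l}{([l-1]!)^2}$. Let $\mathrm{qCh}(H)=\{\beta\in H^*:\beta(xy)=\beta(S^2(y)x)\}$ and let $Z(H)$ be the center.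 The Drinfeld map $\chi(\beta)=(\beta\otimes\mathrm{id})(R_{21}R)$ is an isomorphism $\mathrm{qCh}(H)\to Z(H)$; the Radford map is $\phi(\beta)=(\beta\otimes\mathrm{id})\Delta(\Lambda)$. The projective representation of $\mathrm{SL}(2,\mathbb{Z})$ on $Z(H)$ is given by $s=\begin{pmatrix}0&-1\\1&0\end{pmatrix}\mapsto S_{LM}$, $t=\begin{pmatrix}1&1\\0&1\end{pmatrix}\mapsto T_{LM}$, with $S_{LM}(a)=\phi(\chi^{-1}(a))$ and $T_{LM}(a)=\kappa\,S_{LM}^{-1}(\theta^{-1}S_{LM}(a))$, $\kappa$ a nonzero constant. The Higman ideal $\mathrm{Hig}(H)\subseteq Z(H)$ is the image of $\tau:H\to H$, $\tau(x)=\sum S(\Lambda_{(2)})\,x\,\Lambda_{(1)}G^{-1}$, with balancing element $G=K$; it is invariant under $S_{LM}$ and $T_{LM}$. The kernel of a projective representation is the set of group elements acting by scalars. A congruence subgroup is one containing $\Gamma(N)$ for some $N\ge1$. *)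

theory Defs
  imports "HOL-Analysis.Analysis" "HOL-Algebra.Group"
begin

section \<open>Complex vector spaces and algebras\<close>

class scaleC =
  fixes scaleC :: "complex \<Rightarrow> 'a \<Rightarrow> 'a" (infixr "*\<^sub>C" 75)

class complex_vector = scaleC + ab_group_add +
  assumes scaleC_add_right: "c *\<^sub>C (x + y) = c *\<^sub>C x + c *\<^sub>C y"
    and scaleC_add_left: "(c + d) *\<^sub>C x = c *\<^sub>C x + d *\<^sub>C x"
    and scaleC_scaleC: "c *\<^sub>C d *\<^sub>C x = (c * d) *\<^sub>C x"
    and scaleC_one: "1 *\<^sub>C x = x"

class complex_algebra_1 = complex_vector + ring_1 +
  assumes mult_scaleC_left: "c *\<^sub>C x * y = c *\<^sub>C (x * y)"
    and mult_scaleC_right: "x * c *\<^sub>C y = c *\<^sub>C (x * y)"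

instantiation complex :: complex_algebra_1
begin

definition scaleC_complex :: "complex \<Rightarrow> complex \<Rightarrow> complex"
  where "scaleC_complex c x = c * x"

instance
  by standard (simp_all add: scaleC_complex_def algebra_simps)

end

global_interpretation cvs: vector_space "scaleC :: complex \<Rightarrow> 'a \<Rightarrow> 'a :: complex_vector"
  by standard (rule scaleC_add_right scaleC_add_left scaleC_scaleC scaleC_one)+

abbreviation clinear :: "('a::complex_vector \<Rightarrow> 'b::complex_vector) \<Rightarrow> bool"
  where "clinear \<equiv> Vector_Spaces.linear scaleC scaleC"

lemma clinear_iff:
  "clinear f \<longleftrightarrow> (\<forall>x y. f (x + y) = f x + f y) \<and> (\<forall>c x. f (c *\<^sub>C x) = c *\<^sub>C f x)"
  by (simp add: Vector_Spaces.linear_iff cvs.vector_space_axioms)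

definition cbilinear :: "('a::complex_vector \<Rightarrow> 'b::complex_vector \<Rightarrow> 'c::complex_vector) \<Rightarrow> bool"
  where "cbilinear f \<longleftrightarrow> (\<forall>a. clinear (f a)) \<and> (\<forall>b. clinear (\<lambda>a. f a b))"

lemma cbilinear_iff:
  "cbilinear f \<longleftrightarrow>
     (\<forall>x x' y. f (x + x') y = f x y + f x' y) \<and> (\<forall>x y y'. f x (y + y') = f x y + f x y') \<and>
     (\<forall>c x y. f (c *\<^sub>C x) y = c *\<^sub>C f x y) \<and> (\<forall>c x y. f x (c *\<^sub>C y) = c *\<^sub>C f x y)"
  unfolding cbilinear_def clinear_iff by blast

lemma clinear_separates:
  fixes w :: "'a::complex_vector"
  assumes "w \<noteq> 0"
  obtains g :: "'a \<Rightarrow> complex" where "clinear g" "g w \<noteq> 0"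
proof -
  define B where "B = cvs.extend_basis {w}"
  have ind: "cvs.independent {w}" using assms by simp
  have B: "cvs.independent B" "cvs.span B = UNIV" "w \<in> B"
    using cvs.independent_extend_basis[OF ind] cvs.span_extend_basis[OF ind]
      cvs.extend_basis_superset[OF ind] by (auto simp: B_def)
  have "Vector_Spaces.linear scaleC (*) (\<lambda>v. cvs.representation B v w)"
    by (rule cvs.linear_representation[OF B(1,2)])
  moreover have "(scaleC :: complex \<Rightarrow> complex \<Rightarrow> complex) = (*)"
    by (simp add: fun_eq_iff scaleC_complex_def)
  ultimately have "clinear (\<lambda>v. cvs.representation B v w)" by simp
  moreover have "cvs.representation B w w \<noteq> 0"
    using cvs.representation_basis[OF B(1,3)] by simp
  ultimately show thesis using that by blast
qed

definition calg_hom :: "('a::complex_algebra_1 \<Rightarrow> 'b::complex_algebra_1) \<Rightarrow> bool"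
  where "calg_hom f \<longleftrightarrow> clinear f \<and> f 1 = 1 \<and> (\<forall>x y. f (x * y) = f x * f y)"

inductive_set subalgebra_generated :: "'a::complex_algebra_1 set \<Rightarrow> 'a set" for X where
  base: "x \<in> X \<Longrightarrow> x \<in> subalgebra_generated X"
| one: "1 \<in> subalgebra_generated X"
| scale: "x \<in> subalgebra_generated X \<Longrightarrow> c *\<^sub>C x \<in> subalgebra_generated X"
| add: "x \<in> subalgebra_generated X \<Longrightarrow> y \<in> subalgebra_generated X \<Longrightarrow> x + y \<in> subalgebra_generated X"
| mult: "x \<in> subalgebra_generated X \<Longrightarrow> y \<in> subalgebra_generated X \<Longrightarrow> x * y \<in> subalgebra_generated X"

definition mutually_inverse :: "'a::monoid_mult \<Rightarrow> 'a \<Rightarrow> bool"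
  where "mutually_inverse x y \<longleftrightarrow> x * y = 1 \<and> y * x = 1"

definition unit_inv :: "'a::monoid_mult \<Rightarrow> 'a"
  where "unit_inv x = (THE y. mutually_inverse x y)"

section \<open>Tensor products\<close>

text \<open>A formal sum of pairs is a list of pairs. Two formal sums are identified when every bilinear
  form takes the same value on them; over a field this is the usual tensor product, see
  \<open>tensor_lift_tens\<close> and \<open>tensor_lift_unique\<close> for the universal property.\<close>

definition formal_sum :: "('a \<Rightarrow> 'b \<Rightarrow> 'c::comm_monoid_add) \<Rightarrow> ('a \<times> 'b) list \<Rightarrow> 'c"
  where "formal_sum f xs = (\<Sum>(a, b)\<leftarrow>xs. f a b)"

lemma formal_sum_simps [simp]:
  "formal_sum f [] = 0"
  "formal_sum f ((a, b) # xs) = f a b + formal_sum f xs"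
  "formal_sum f (xs @ ys) = formal_sum f xs + formal_sum f ys"
  by (simp_all add: formal_sum_def)

definition tensor_eq ::
  "('a::complex_vector \<times> 'b::complex_vector) list \<Rightarrow> ('a \<times> 'b) list \<Rightarrow> bool"
  where "tensor_eq xs ys \<longleftrightarrow>
    (\<forall>f :: 'a \<Rightarrow> 'b \<Rightarrow> complex. cbilinear f \<longrightarrow> formal_sum f xs = formal_sum f ys)"

quotient_type (overloaded) ('a, 'b) tensor =
  "('a::complex_vector \<times> 'b::complex_vector) list" / tensor_eq
  by (rule equivpI) (auto simp: tensor_eq_def reflp_def symp_def transp_def)

lift_definition tens :: "'a::complex_vector \<Rightarrow> 'b::complex_vector \<Rightarrow> ('a, 'b) tensor"
    (infixr "\<^bold>\<otimes>" 72)
  is "\<lambda>a b. [(a, b)]" .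

lemma clinear_formal_sum:
  assumes "clinear g"
  shows "g (formal_sum f xs) = formal_sum (\<lambda>a b. g (f a b)) xs"
proof -
  from assms interpret g: Vector_Spaces.linear scaleC scaleC g .
  show ?thesis by (induction xs) (auto simp: g.zero g.add)
qed

lemma formal_sum_scale:
  assumes "cbilinear f"
  shows "formal_sum f (map (\<lambda>(a, b). (c *\<^sub>C a, b)) xs) = c *\<^sub>C formal_sum f xs"
  using assms by (induction xs) (auto simp: cbilinear_iff scaleC_add_right)

lemma tensor_eq_formal_sum:
  fixes f :: "'a::complex_vector \<Rightarrow> 'b::complex_vector \<Rightarrow> 'c::complex_vector"
  assumes "tensor_eq xs ys" "cbilinear f"
  shows "formal_sum f xs = formal_sum f ys"
proof (rule ccontr)
  assume "formal_sum f xs \<noteq> formal_sum f ys"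
  then have "formal_sum f xs - formal_sum f ys \<noteq> 0" by simp
  then obtain g :: "'c \<Rightarrow> complex"
    where g: "clinear g" "g (formal_sum f xs - formal_sum f ys) \<noteq> 0"
    by (rule clinear_separates)
  have "cbilinear (\<lambda>a b. g (f a b))"
    using assms(2) g(1) by (simp add: cbilinear_iff clinear_iff)
  then have "g (formal_sum f xs) = g (formal_sum f ys)"
    using assms(1) by (simp add: clinear_formal_sum[OF g(1)] tensor_eq_def)
  then show False using g Vector_Spaces.linear.axioms(3)[OF g(1)] by (simp add: module_hom.diff)
qed

instantiation tensor :: (complex_vector, complex_vector) complex_vector
begin

lift_definition zero_tensor :: "('a, 'b) tensor" is "[]" .

lift_definition plus_tensor :: "('a, 'b) tensor \<Rightarrow> ('a, 'b) tensor \<Rightarrow> ('a, 'b) tensor"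
  is "(@)" by (simp add: tensor_eq_def)

lift_definition scaleC_tensor :: "complex \<Rightarrow> ('a, 'b) tensor \<Rightarrow> ('a, 'b) tensor"
  is "\<lambda>c. map (\<lambda>(a, b). (c *\<^sub>C a, b))"
by (auto simp: tensor_eq_def formal_sum_scale)

definition uminus_tensor :: "('a, 'b) tensor \<Rightarrow> ('a, 'b) tensor"
  where "uminus_tensor t = (- 1) *\<^sub>C t"

definition minus_tensor :: "('a, 'b) tensor \<Rightarrow> ('a, 'b) tensor \<Rightarrow> ('a, 'b) tensor"
  where "minus_tensor t u = t + - u"

instance
proof
  fix t u v :: "('a, 'b) tensor" and c d :: complex
  show "t + u + v = t + (u + v)" "t + u = u + t" "0 + t = t"
    by (transfer, simp add: tensor_eq_def add.commute)+
  show "c *\<^sub>C (t + u) = c *\<^sub>C t + c *\<^sub>C u"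
    by (transfer, simp add: tensor_eq_def)
  show "(c + d) *\<^sub>C t = c *\<^sub>C t + d *\<^sub>C t"
    by transfer (unfold tensor_eq_def formal_sum_simps, intro allI impI,
        (subst formal_sum_scale, assumption)+, rule scaleC_add_left)
  show "c *\<^sub>C d *\<^sub>C t = (c * d) *\<^sub>C t"
    by transfer (unfold tensor_eq_def, intro allI impI,
        (subst formal_sum_scale, assumption)+, rule scaleC_scaleC)
  show "1 *\<^sub>C t = t"
    by transfer (simp add: tensor_eq_def scaleC_one)
  show "- t + t = 0" unfolding uminus_tensor_def
    by transfer (unfold tensor_eq_def formal_sum_simps, intro allI impI,
        subst formal_sum_scale, assumption, simp)
  show "t - u = t + - u" by (rule minus_tensor_def)
qed

end

lemma cbilinear_tens: "cbilinear (\<^bold>\<otimes>)"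
  unfolding cbilinear_iff
  by (intro conjI allI; transfer) (auto simp: tensor_eq_def cbilinear_iff)

text \<open>The value is the junk \<open>0\<close> unless the map to be lifted is bilinear.\<close>

lift_definition tensor_lift ::
  "('a::complex_vector \<Rightarrow> 'b::complex_vector \<Rightarrow> 'c::complex_vector) \<Rightarrow> ('a, 'b) tensor \<Rightarrow> 'c"
  is "\<lambda>f xs. if cbilinear f then formal_sum f xs else 0"
  by (simp add: tensor_eq_formal_sum)

lemma tensor_lift_tens: "cbilinear f \<Longrightarrow> tensor_lift f (a \<^bold>\<otimes> b) = f a b"
  by transfer simp

lemma clinear_tensor_lift: "clinear (tensor_lift f)"
  unfolding clinear_iff
  by (intro conjI allI; transfer) (simp_all add: formal_sum_scale)

lemma tensor_induct [case_names zero add]: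
  assumes "P 0" "\<And>a b t. P t \<Longrightarrow> P (a \<^bold>\<otimes> b + t)"
  shows "P t"
proof (induction t rule: tensor.abs_induct)
  case (1 xs)
  show ?case
  proof (induction xs)
    case Nil
    then show ?case using assms(1) by (simp add: zero_tensor_def)
  next
    case (Cons x xs)
    obtain a b where x: "x = (a, b)" by fastforce
    have "abs_tensor (x # xs) = a \<^bold>\<otimes> b + abs_tensor xs"
      by (simp add: x tens.abs_eq plus_tensor.abs_eq)
    then show ?case using assms(2)[OF Cons] by simp
  qed
qed

lemma tensor_lift_unique:
  assumes "clinear g" "cbilinear f" "\<And>a b. g (a \<^bold>\<otimes> b) = f a b"
  shows "g = tensor_lift f"
proof
  fix t
  have "g 0 = 0" "tensor_lift f 0 = 0"
    using assms(1) clinear_tensor_lift[of f]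
    by (metis add_cancel_right_right clinear_iff)+
  then show "g t = tensor_lift f t"
    using assms clinear_tensor_lift[of f]
    by (induction t rule: tensor_induct) (simp_all add: clinear_iff tensor_lift_tens)
qed

lemma tens_add_left: "(a + a') \<^bold>\<otimes> b = a \<^bold>\<otimes> b + a' \<^bold>\<otimes> b"
  and tens_add_right: "a \<^bold>\<otimes> (b + b') = a \<^bold>\<otimes> b + a \<^bold>\<otimes> b'"
  and tens_scaleC_left: "(c *\<^sub>C a) \<^bold>\<otimes> b = c *\<^sub>C (a \<^bold>\<otimes> b)"
  and tens_scaleC_right: "a \<^bold>\<otimes> (c *\<^sub>C b) = c *\<^sub>C (a \<^bold>\<otimes> b)"
  using cbilinear_tens[unfolded cbilinear_iff] by blast+

lemma tensor_lift_add: "tensor_lift f (t + u) = tensor_lift f t + tensor_lift f u"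
  and tensor_lift_scaleC: "tensor_lift f (c *\<^sub>C t) = c *\<^sub>C tensor_lift f t"
  using clinear_tensor_lift[of f] unfolding clinear_iff by blast+

lemma tensor_lift_zero: "tensor_lift f 0 = 0"
  using tensor_lift_scaleC[of f 0 0] by simp

definition tensor_mult_pure ::
  "'a::complex_algebra_1 \<Rightarrow> 'b::complex_algebra_1 \<Rightarrow> ('a, 'b) tensor \<Rightarrow> ('a, 'b) tensor"
  where "tensor_mult_pure a b = tensor_lift (\<lambda>c d. (a * c) \<^bold>\<otimes> (b * d))"

lemma tensor_mult_pure_simps:
  "tensor_mult_pure a b 0 = 0"
  "tensor_mult_pure a b (t + u) = tensor_mult_pure a b t + tensor_mult_pure a b u"
  "tensor_mult_pure a b (k *\<^sub>C t) = k *\<^sub>C tensor_mult_pure a b t"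
  "tensor_mult_pure a b (c \<^bold>\<otimes> d) = (a * c) \<^bold>\<otimes> (b * d)"
proof -
  have "cbilinear (\<lambda>c d. (a * c) \<^bold>\<otimes> (b * d))"
    by (simp add: cbilinear_iff distrib_left mult_scaleC_right tens_add_left tens_add_right
        tens_scaleC_left tens_scaleC_right)
  then show "tensor_mult_pure a b (c \<^bold>\<otimes> d) = (a * c) \<^bold>\<otimes> (b * d)"
    unfolding tensor_mult_pure_def by (rule tensor_lift_tens)
qed (simp_all only: tensor_mult_pure_def tensor_lift_zero tensor_lift_add tensor_lift_scaleC)

lemma cbilinear_tensor_mult_pure: "cbilinear (\<lambda>a b. tensor_mult_pure a b u)"
  unfolding cbilinear_iff
proof (intro conjI allI)
  fix a a' :: 'a and b b' :: 'b and c
  show "tensor_mult_pure (a + a') b u = tensor_mult_pure a b u + tensor_mult_pure a' b u"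
    by (induction u rule: tensor_induct)
      (simp_all add: tensor_mult_pure_simps distrib_right tens_add_left)
  show "tensor_mult_pure a (b + b') u = tensor_mult_pure a b u + tensor_mult_pure a b' u"
    by (induction u rule: tensor_induct)
      (simp_all add: tensor_mult_pure_simps distrib_right tens_add_right)
  show "tensor_mult_pure (c *\<^sub>C a) b u = c *\<^sub>C tensor_mult_pure a b u"
    by (induction u rule: tensor_induct)
      (simp_all add: tensor_mult_pure_simps mult_scaleC_left tens_scaleC_left scaleC_add_right)
  show "tensor_mult_pure a (c *\<^sub>C b) u = c *\<^sub>C tensor_mult_pure a b u"
    by (induction u rule: tensor_induct)
      (simp_all add: tensor_mult_pure_simps mult_scaleC_left tens_scaleC_right scaleC_add_right)
qed

instantiation tensor :: (complex_algebra_1, complex_algebra_1) complex_algebra_1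
begin

definition one_tensor :: "('a, 'b) tensor"
  where "one_tensor = 1 \<^bold>\<otimes> 1"

definition times_tensor :: "('a, 'b) tensor \<Rightarrow> ('a, 'b) tensor \<Rightarrow> ('a, 'b) tensor"
  where "times_tensor t u = tensor_lift (\<lambda>a b. tensor_mult_pure a b u) t"

lemma tens_times: "((a :: 'a) \<^bold>\<otimes> (b :: 'b)) * t = tensor_mult_pure a b t"
  unfolding times_tensor_def by (rule tensor_lift_tens[OF cbilinear_tensor_mult_pure])

lemma tens_times_tens: "((a :: 'a) \<^bold>\<otimes> (b :: 'b)) * (c \<^bold>\<otimes> d) = (a * c) \<^bold>\<otimes> (b * d)"
  by (simp only: tens_times tensor_mult_pure_simps)

lemma tensor_times_bilinear:
  fixes t u v :: "('a, 'b) tensor"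
  shows "(t + u) * v = t * v + u * v" "t * (u + v) = t * u + t * v"
    "(c *\<^sub>C t) * u = c *\<^sub>C (t * u)" "t * (c *\<^sub>C u) = c *\<^sub>C (t * u)"
    "0 * t = 0" "t * 0 = 0"
proof -
  show left: "(t + u) * v = t * v + u * v" "(c *\<^sub>C t) * u = c *\<^sub>C (t * u)" "0 * t = 0"
    for t u v :: "('a, 'b) tensor"
    by (simp_all only: times_tensor_def tensor_lift_add tensor_lift_scaleC tensor_lift_zero)
  show "t * (u + v) = t * u + t * v"
    by (induction t rule: tensor_induct)
      (simp_all add: left tens_times tensor_mult_pure_simps algebra_simps)
  show "t * (c *\<^sub>C u) = c *\<^sub>C (t * u)"
    by (induction t rule: tensor_induct)
      (simp_all add: left tens_times tensor_mult_pure_simps scaleC_add_right)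
  show "t * 0 = 0"
    by (induction t rule: tensor_induct) (simp_all add: left tens_times tensor_mult_pure_simps)
qed

instance
proof
  fix t u v :: "('a, 'b) tensor" and c :: complex
  show "(t + u) * v = t * v + u * v" "t * (u + v) = t * u + t * v"
    "c *\<^sub>C t * u = c *\<^sub>C (t * u)" "t * c *\<^sub>C u = c *\<^sub>C (t * u)"
    by (rule tensor_times_bilinear)+
  show "1 * t = t" "t * 1 = t" unfolding one_tensor_def
    by (induction t rule: tensor_induct; simp add: tensor_times_bilinear tens_times_tens)+
  have "(a \<^bold>\<otimes> b) * (a' \<^bold>\<otimes> b') * v = (a \<^bold>\<otimes> b) * ((a' \<^bold>\<otimes> b') * v)" for a a' b b'
    by (induction v rule: tensor_induct)
      (simp_all add: tensor_times_bilinear tens_times_tens mult.assoc)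
  then have "(a \<^bold>\<otimes> b) * u * v = (a \<^bold>\<otimes> b) * (u * v)" for a b
    by (induction u rule: tensor_induct) (simp_all add: tensor_times_bilinear)
  then show "t * u * v = t * (u * v)"
    by (induction t rule: tensor_induct) (simp_all add: tensor_times_bilinear)
  obtain g :: "'a \<Rightarrow> complex" where g: "clinear g" "g 1 \<noteq> 0"
    by (rule clinear_separates[of "1 :: 'a"]) auto
  obtain h :: "'b \<Rightarrow> complex" where h: "clinear h" "h 1 \<noteq> 0"
    by (rule clinear_separates[of "1 :: 'b"]) auto
  have "cbilinear (\<lambda>a b. g a * h b)"
    using g(1) h(1) by (simp add: cbilinear_iff clinear_iff scaleC_complex_def algebra_simps)
  then have "tensor_lift (\<lambda>a b. g a * h b) (1 :: ('a, 'b) tensor) \<noteq> 0"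
    using g h by (simp add: one_tensor_def tensor_lift_tens)
  then show "(0 :: ('a, 'b) tensor) \<noteq> 1"
    by (metis tensor_lift_zero)
qed

end

definition tensor_map ::
  "('a::complex_vector \<Rightarrow> 'c::complex_vector) \<Rightarrow> ('b::complex_vector \<Rightarrow> 'd::complex_vector) \<Rightarrow>
   ('a, 'b) tensor \<Rightarrow> ('c, 'd) tensor"
  where "tensor_map f g = tensor_lift (\<lambda>a b. f a \<^bold>\<otimes> g b)"

definition tensor_swap ::
  "('a::complex_vector, 'b::complex_vector) tensor \<Rightarrow> ('b, 'a) tensor"
  where "tensor_swap = tensor_lift (\<lambda>a b. b \<^bold>\<otimes> a)"

definition tensor_assoc ::
  "(('a::complex_vector, 'b::complex_vector) tensor, 'c::complex_vector) tensor \<Rightarrow>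
   ('a, ('b, 'c) tensor) tensor"
  where "tensor_assoc = tensor_lift (\<lambda>t c. tensor_lift (\<lambda>a b. a \<^bold>\<otimes> (b \<^bold>\<otimes> c)) t)"

text \<open>\<open>tensor_slice \<beta>\<close> is \<open>\<beta> \<otimes> id\<close>, with \<open>\<complex> \<otimes> H\<close> identified with \<open>H\<close>.\<close>

definition tensor_slice ::
  "('a::complex_vector \<Rightarrow> complex) \<Rightarrow> ('a, 'b::complex_vector) tensor \<Rightarrow> 'b"
  where "tensor_slice \<beta> = tensor_lift (\<lambda>a b. \<beta> a *\<^sub>C b)"

section \<open>The small quantum group\<close>

locale hopf_algebra =
  fixes \<Delta> :: "'a::complex_algebra_1 \<Rightarrow> ('a, 'a) tensor"
    and \<epsilon> :: "'a \<Rightarrow> complex"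
    and S :: "'a \<Rightarrow> 'a"
  assumes comult_hom: "calg_hom \<Delta>"
    and counit_hom: "calg_hom \<epsilon>"
    and coassoc: "tensor_assoc (tensor_map \<Delta> id (\<Delta> x)) = tensor_map id \<Delta> (\<Delta> x)"
    and counit_left: "tensor_slice \<epsilon> (\<Delta> x) = x"
    and counit_right: "tensor_lift (\<lambda>a b. \<epsilon> b *\<^sub>C a) (\<Delta> x) = x"
    and antipode_linear: "clinear S"
    and antipode_left: "tensor_lift (\<lambda>a b. S a * b) (\<Delta> x) = \<epsilon> x *\<^sub>C 1"
    and antipode_right: "tensor_lift (\<lambda>a b. a * S b) (\<Delta> x) = \<epsilon> x *\<^sub>C 1"

definition primitive_root_of_unity :: "nat \<Rightarrow> complex \<Rightarrow> bool"
  where "primitive_root_of_unity l q \<longleftrightarrow> q ^ l = 1 \<and> (\<forall>k. 0 < k \<and> k < l \<longrightarrow> q ^ k \<noteq> 1)"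

definition qint :: "complex \<Rightarrow> int \<Rightarrow> complex"
  where "qint q n = (q powi n - q powi (- n)) / (q - inverse q)"

definition qfact :: "complex \<Rightarrow> nat \<Rightarrow> complex"
  where "qfact q n = (\<Prod>k = 1..n. qint q (int k))"

text \<open>The relations, generation by \<open>E, F, K\<close> and the dimension \<open>l\<^sup>3\<close> determine the algebra
  up to isomorphism; the values on generators then determine the Hopf structure.\<close>

locale small_quantum_sl2 = hopf_algebra \<Delta> \<epsilon> S
  for \<Delta> :: "'a::complex_algebra_1 \<Rightarrow> ('a, 'a) tensor" and \<epsilon> and S +
  fixes l :: nat and q :: complex and E F K :: 'a
  assumes E_pow: "E ^ l = 0" and F_pow: "F ^ l = 0" and K_pow: "K ^ l = 1"
    and KE: "K * E = q\<^sup>2 *\<^sub>C (E * K)"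
    and KF: "K * F = (q powi (- 2)) *\<^sub>C (F * K)"
    and EF: "E * F - F * E = (1 / (q - inverse q)) *\<^sub>C (K - unit_inv K)"
    and generated: "subalgebra_generated {E, F, K} = UNIV"
    and dimension: "cvs.dim (UNIV :: 'a set) = l ^ 3"
    and comult_E: "\<Delta> E = 1 \<^bold>\<otimes> E + E \<^bold>\<otimes> K"
    and comult_F: "\<Delta> F = unit_inv K \<^bold>\<otimes> F + F \<^bold>\<otimes> 1"
    and comult_K: "\<Delta> K = K \<^bold>\<otimes> K"
    and counit_E: "\<epsilon> E = 0" and counit_F: "\<epsilon> F = 0" and counit_K: "\<epsilon> K = 1"
    and antipode_E: "S E = - (E * unit_inv K)"
    and antipode_F: "S F = - (K * F)"
    and antipode_K: "S K = unit_inv K"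

definition R_matrix :: "nat \<Rightarrow> complex \<Rightarrow> 'a::complex_algebra_1 \<Rightarrow> 'a \<Rightarrow> 'a \<Rightarrow> ('a, 'a) tensor"
  where "R_matrix l q E F K =
    (1 / of_nat l) *\<^sub>C (\<Sum>m<l. \<Sum>i<l. \<Sum>j<l.
      ((q - inverse q) ^ m / qfact q m *
        q powi (int m * (int m - 1) div 2 + 2 * int m * (int i - int j) - 2 * int i * int j))
      *\<^sub>C ((E ^ m * K ^ i) \<^bold>\<otimes> (F ^ m * K ^ j)))"

definition monodromy :: "('a::complex_algebra_1, 'a) tensor \<Rightarrow> ('a, 'a) tensor"
  where "monodromy R = tensor_swap R * R"

definition hopf_center :: "'a::complex_algebra_1 set"
  where "hopf_center = {z. \<forall>x. z * x = x * z}"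

definition ribbon_element ::
  "('a::complex_algebra_1 \<Rightarrow> ('a, 'a) tensor) \<Rightarrow> ('a \<Rightarrow> complex) \<Rightarrow> ('a \<Rightarrow> 'a) \<Rightarrow>
   ('a, 'a) tensor \<Rightarrow> 'a \<Rightarrow> bool"
  where "ribbon_element \<Delta> \<epsilon> S R \<theta> \<longleftrightarrow>
    \<theta> \<in> hopf_center \<and> (\<exists>y. mutually_inverse \<theta> y) \<and>
    (\<exists>X. mutually_inverse (monodromy R) X \<and> \<Delta> \<theta> = X * (\<theta> \<^bold>\<otimes> \<theta>)) \<and>
    \<epsilon> \<theta> = 1 \<and> S \<theta> = \<theta>"

definition integral_elem :: "nat \<Rightarrow> complex \<Rightarrow> 'a::complex_algebra_1 \<Rightarrow> 'a \<Rightarrow> 'a \<Rightarrow> 'a"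
  where "integral_elem l q E F K =
    (complex_of_real (sqrt (real l)) / (qfact q (l - 1))\<^sup>2) *\<^sub>C
      (F ^ (l - 1) * E ^ (l - 1) * (\<Sum>j<l. K ^ j))"

section \<open>The Lyubashenko-Majid operators and the Higman ideal\<close>

definition qcharacters :: "('a::complex_algebra_1 \<Rightarrow> 'a) \<Rightarrow> ('a \<Rightarrow> complex) set"
  where "qcharacters S = {\<beta>. clinear \<beta> \<and> (\<forall>x y. \<beta> (x * y) = \<beta> (S (S y) * x))}"

definition drinfeld_map ::
  "('a::complex_algebra_1, 'a) tensor \<Rightarrow> ('a \<Rightarrow> complex) \<Rightarrow> 'a"
  where "drinfeld_map R \<beta> = tensor_slice \<beta> (monodromy R)"

definition radford_map ::
  "('a::complex_algebra_1 \<Rightarrow> ('a, 'a) tensor) \<Rightarrow> 'a \<Rightarrow> ('a \<Rightarrow> complex) \<Rightarrow> 'a"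
  where "radford_map \<Delta> \<Lambda> \<beta> = tensor_slice \<beta> (\<Delta> \<Lambda>)"

definition S_LM ::
  "('a::complex_algebra_1 \<Rightarrow> ('a, 'a) tensor) \<Rightarrow> ('a \<Rightarrow> 'a) \<Rightarrow> ('a, 'a) tensor \<Rightarrow> 'a \<Rightarrow> 'a \<Rightarrow> 'a"
  where "S_LM \<Delta> S R \<Lambda> a =
    radford_map \<Delta> \<Lambda> (inv_into (qcharacters S) (drinfeld_map R) a)"

definition T_LM ::
  "('a::complex_algebra_1 \<Rightarrow> ('a, 'a) tensor) \<Rightarrow> ('a \<Rightarrow> 'a) \<Rightarrow> ('a, 'a) tensor \<Rightarrow> 'a \<Rightarrow>
   'a \<Rightarrow> complex \<Rightarrow> 'a \<Rightarrow> 'a"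
  where "T_LM \<Delta> S R \<Lambda> \<theta> \<kappa> a =
    \<kappa> *\<^sub>C inv_into hopf_center (S_LM \<Delta> S R \<Lambda>) (unit_inv \<theta> * S_LM \<Delta> S R \<Lambda> a)"

definition higman_trace ::
  "('a::complex_algebra_1 \<Rightarrow> ('a, 'a) tensor) \<Rightarrow> ('a \<Rightarrow> 'a) \<Rightarrow> 'a \<Rightarrow> 'a \<Rightarrow> 'a \<Rightarrow> 'a"
  where "higman_trace \<Delta> S \<Lambda> G x = tensor_lift (\<lambda>a b. S b * x * a * unit_inv G) (\<Delta> \<Lambda>)"

definition higman_ideal ::
  "('a::complex_algebra_1 \<Rightarrow> ('a, 'a) tensor) \<Rightarrow> ('a \<Rightarrow> 'a) \<Rightarrow> 'a \<Rightarrow> 'a \<Rightarrow> 'a set"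
  where "higman_ideal \<Delta> S \<Lambda> G = range (higman_trace \<Delta> S \<Lambda> G)"

section \<open>The modular group and projective representations\<close>

definition SL2Z :: "(int^2^2) monoid"
  where "SL2Z = \<lparr>carrier = {A. det A = 1}, mult = (**), one = mat 1\<rparr>"

definition mat_s :: "int^2^2"
  where "mat_s = vector [vector [0, - 1], vector [1, 0]]"

definition mat_t :: "int^2^2"
  where "mat_t = vector [vector [1, 1], vector [0, 1]]"

definition principal_congruence_subgroup :: "nat \<Rightarrow> (int^2^2) set"
  where "principal_congruence_subgroup N =
    {A \<in> carrier SL2Z. \<forall>i j. A $ i $ j mod int N = (mat 1 :: int^2^2) $ i $ j mod int N}"

definition congruence_subgroup :: "(int^2^2) set \<Rightarrow> bool"
  where "congruence_subgroup \<Gamma> \<longleftrightarrow>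
    subgroup \<Gamma> SL2Z \<and> (\<exists>N\<ge>1. principal_congruence_subgroup N \<subseteq> \<Gamma>)"

definition linear_automorphism_on :: "'a::complex_vector set \<Rightarrow> ('a \<Rightarrow> 'a) \<Rightarrow> bool"
  where "linear_automorphism_on V f \<longleftrightarrow> bij_betw f V V \<and>
    (\<forall>x\<in>V. \<forall>y\<in>V. f (x + y) = f x + f y) \<and> (\<forall>c. \<forall>x\<in>V. f (c *\<^sub>C x) = c *\<^sub>C f x)"

definition projective_representation ::
  "('g, 'm) monoid_scheme \<Rightarrow> 'a::complex_vector set \<Rightarrow> ('g \<Rightarrow> 'a \<Rightarrow> 'a) \<Rightarrow> bool"
  where "projective_representation G V \<rho> \<longleftrightarrow>
    cvs.subspace V \<and> (\<forall>g\<in>carrier G. linear_automorphism_on V (\<rho> g)) \<and>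
    (\<forall>g\<in>carrier G. \<forall>h\<in>carrier G. \<exists>c. c \<noteq> 0 \<and>
      (\<forall>x\<in>V. \<rho> (g \<otimes>\<^bsub>G\<^esub> h) x = c *\<^sub>C \<rho> g (\<rho> h x)))"

definition projective_kernel ::
  "('g, 'm) monoid_scheme \<Rightarrow> 'a::complex_vector set \<Rightarrow> ('g \<Rightarrow> 'a \<Rightarrow> 'a) \<Rightarrow> 'g set"
  where "projective_kernel G V \<rho> = {g \<in> carrier G. \<exists>c. \<forall>x\<in>V. \<rho> g x = c *\<^sub>C x}"

text \<open>As \<open>mat_s\<close> and \<open>mat_t\<close> generate \<open>SL2Z\<close>, such a \<open>\<rho>\<close> is unique up to a nonzero scalar
  for each group element, and its projective kernel depends only on \<open>V\<close> and the two operators.\<close>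

definition modular_representation ::
  "'a::complex_vector set \<Rightarrow> ('a \<Rightarrow> 'a) \<Rightarrow> ('a \<Rightarrow> 'a) \<Rightarrow> (int^2^2 \<Rightarrow> 'a \<Rightarrow> 'a) \<Rightarrow> bool"
  where "modular_representation V s t \<rho> \<longleftrightarrow> projective_representation SL2Z V \<rho> \<and>
    (\<forall>x\<in>V. \<rho> mat_s x = s x) \<and> (\<forall>x\<in>V. \<rho> mat_t x = t x)"

end

theory Submission
  imports Defs "HOL-Computational_Algebra.Polynomial"
begin

text \<open>
  On the Higman ideal the two operators become the Weil representation of \<open>SL(2, \<int>/l)\<close> on even
  functions on \<open>\<int>/l\<close>. Cut out the weight spaces of \<open>K\<close> by idempotents \<open>pr w\<close> and let \<open>C\<close> be the
  Casimir element, with eigenvalues \<open>ch w = q\<^sup>2\<^sup>w + q\<^sup>-\<^sup>2\<^sup>w\<close>. The products \<open>F\<^sup>m E\<^sup>m pr w\<close> and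
  \<open>E\<^sup>m F\<^sup>m pr w\<close> are products of \<open>m\<close> consecutive factors \<open>C - ch v\<close>, all \<open>l\<close> such factors multiply to
  \<open>0\<close>, and the products \<open>ec k\<close> of all factors but the \<open>k\<close>-th one span the Higman ideal. If \<open>mu j\<close> is
  the quantum trace on the baby Verma module with Casimir eigenvalue \<open>ch j\<close>, then the Radford map
  sends \<open>mu j\<close> to a multiple of \<open>ec j\<close> and the Drinfeld map sends it to a multiple of
  \<open>\<Sum>k. q\<^sup>4\<^sup>j\<^sup>k ec k\<close>, so \<open>S_LM\<close> is a finite Fourier transform. Comparing the action of
  \<open>R\<^sub>2\<^sub>1 R \<Delta> \<theta> = \<theta> \<otimes> \<theta>\<close> on highest weight vectors shows that \<open>\<theta>\<close> acts on \<open>ec k\<close> by a multiple of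
  \<open>q powi (- 2 * k\<^sup>2)\<close>, so \<open>T_LM\<close> is multiplication by a Gaussian in the basis of the Verma traces. Both operators
  normalize the Heisenberg group of \<open>\<int>/l\<close>, and by Schur's lemma a matrix congruent to \<open>1\<close> modulo \<open>l\<close>
  acts by a scalar.
\<close>

section \<open>Sums over residues modulo an odd root of unity\<close>

text \<open>Quantifying over all \<open>\<rho>\<close> requires both existence and control of every
  choice. Both rest on operators attached to single group elements: such an operator is fixed up to
  a scalar by its conjugation of the Heisenberg operators, so products agree projectively and only
  generation of SL(2,Z) by two matrices enters. The harder task is to reach that picture.
  \<open>T_LM\<close> contains an inverse of \<open>S_LM\<close> on the whole center, so the
  Drinfeld and Radford maps must be injective beyond the Higman ideal. This is read off from two PBW
  bases, whose independence is forced by the dimension \<open>l^3\<close>. The Drinfeld images of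
  the Verma traces are found by a recursion: their Newton coefficients at level \<open>m\<close>
  come from those at level \<open>m + 1\<close> with \<open>j\<close> moved by half a step, and
  Fourier sums of products of factors \<open>ch k - ch v\<close> obey the same recursion. The ribbon
  element is reached through its eigenvalues on the \<open>ec k\<close>, an even function with a
  quadratic functional equation that determines it up to a constant. Halving modulo \<open>l\<close>
  occurs throughout; oddness of \<open>l\<close> permits it.\<close>

lemma bij_betw_add_mod:
  fixes n a :: int
  assumes "n > 0"
  shows "bij_betw (\<lambda>w. (w + a) mod n) {0..<n} {0..<n}"
  by (rule bij_betwI[where g = "\<lambda>w. (w - a) mod n"]) (use assms in \<open>auto simp: mod_simps\<close>)

locale root_of_unity =
  fixes l :: nat and q :: complex
  assumes l_ge: "3 \<le> l" and l_odd: "odd l" and q_root: "primitive_root_of_unity l q"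
begin

abbreviation qp :: "int \<Rightarrow> complex" where "qp k \<equiv> q powi k"

abbreviation residues :: "int set" where "residues \<equiv> {0..<int l}"

text \<open>Modulo \<open>l\<close> this is -1/2, since \<open>2 * r + 1 = l\<close>. It turns
  half-integral shifts in exponents of \<open>q\<close> into integers.\<close>

definition r :: int where "r = (int l - 1) div 2"

lemma l_eq: "int l = 2 * r + 1"
  unfolding r_def using l_odd by (auto elim!: oddE)

lemma q_pow_l: "q ^ l = 1"
  using q_root by (simp add: primitive_root_of_unity_def)

lemma q_nz [simp]: "q \<noteq> 0"
  using q_pow_l l_ge by (auto simp: power_0_left split: if_splits)

lemma qp_add: "qp (a + b) = qp a * qp b"
  by (simp add: power_int_add)

lemma qp_diff: "qp (a - b) = qp a / qp b"
  by (simp add: power_int_diff)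

lemma qp_minus: "qp (- a) = inverse (qp a)"
  by (simp add: power_int_minus)

lemma qp_mult_int: "qp (int l * t) = 1"
  by (simp add: power_int_mult q_pow_l)

lemma qp_cong: "int l dvd a - b \<Longrightarrow> qp a = qp b"
proof -
  assume "int l dvd a - b"
  then obtain t where "a = b + int l * t" by (metis dvdE add_diff_cancel_left' diff_add_cancel add.commute)
  then show ?thesis by (simp add: qp_add qp_mult_int)
qed

lemma qp_eq_1_iff: "qp a = 1 \<longleftrightarrow> int l dvd a"
proof
  assume 1: "qp a = 1"
  define b where "b = nat (a mod int l)"
  have b: "int b = a mod int l" "b < l" using l_ge by (auto simp: b_def nat_less_iff)
  have "qp (int b) = qp a" by (rule qp_cong) (simp add: b(1) mod_eq_dvd_iff[symmetric])
  then have "q ^ b = 1" using 1 by simp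
  then have "b = 0" using q_root b(2) by (auto simp: primitive_root_of_unity_def)
  then show "int l dvd a" using b(1) by (simp add: dvd_eq_mod_eq_0)
qed (use qp_cong[of a 0] in simp)

lemma qp_eq_iff: "qp a = qp b \<longleftrightarrow> int l dvd a - b"
  using qp_eq_1_iff[of "a - b"] by (simp add: qp_diff)

lemma dvd_2_mult: "int l dvd 2 * a \<longleftrightarrow> int l dvd a"
proof -
  have "coprime (int l) 2" using l_odd by simp
  then show ?thesis by (simp add: coprime_dvd_mult_right_iff)
qed

lemma dvd_4_mult: "int l dvd 4 * a \<longleftrightarrow> int l dvd a"
  using dvd_2_mult[of "2 * a"] dvd_2_mult[of a] by simp

lemma dvd_2_mult_diff: "int l dvd 2 * a - 2 * b \<longleftrightarrow> int l dvd a - b"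
  using dvd_2_mult[of "a - b"] by simp

lemma dvd_4_mult_diff: "int l dvd 4 * a - 4 * b \<longleftrightarrow> int l dvd a - b"
  using dvd_4_mult[of "a - b"] by simp

text \<open>Functions on Z/l are kept as periodic functions on the integers, so that exponents of
  \<open>q\<close> and negative arguments need no coercions.\<close>

definition periodic :: "(int \<Rightarrow> 'b) \<Rightarrow> bool"
  where "periodic f \<longleftrightarrow> (\<forall>a b. int l dvd a - b \<longrightarrow> f a = f b)"

lemma periodicD: "periodic f \<Longrightarrow> int l dvd a - b \<Longrightarrow> f a = f b"
  by (simp add: periodic_def)

lemma periodic_mod: "periodic f \<Longrightarrow> f (a mod int l) = f a"
  by (rule periodicD) (auto simp: mod_eq_dvd_iff[symmetric])

lemma l_pos: "0 < int l" using l_ge by simp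

lemma sum_residues_shift:
  fixes f :: "int \<Rightarrow> 'b::comm_monoid_add"
  assumes "periodic f"
  shows "(\<Sum>w\<in>residues. f (w + a)) = (\<Sum>w\<in>residues. f w)"
proof -
  have "(\<Sum>w\<in>residues. f (w + a)) = (\<Sum>w\<in>residues. f ((w + a) mod int l))"
    by (simp add: periodic_mod[OF assms])
  also have "\<dots> = (\<Sum>w\<in>residues. f w)"
    by (rule sum.reindex_bij_betw[OF bij_betw_add_mod[OF l_pos]])
  finally show ?thesis .
qed

lemma sum_residues_reflect:
  fixes f :: "int \<Rightarrow> 'b::comm_monoid_add"
  assumes "periodic f"
  shows "(\<Sum>w\<in>residues. f (a - w)) = (\<Sum>w\<in>residues. f w)"
proof -
  have "bij_betw (\<lambda>w. (a - w) mod int l) residues residues"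
    by (rule bij_betwI[where g = "\<lambda>w. (a - w) mod int l"])
      (use l_ge in \<open>auto simp: mod_simps\<close>)
  then have "(\<Sum>w\<in>residues. f ((a - w) mod int l)) = (\<Sum>w\<in>residues. f w)"
    by (rule sum.reindex_bij_betw)
  then show ?thesis by (simp add: periodic_mod[OF assms])
qed

lemma sum_residues_lessThan:
  "(\<Sum>w\<in>residues. f w) = (\<Sum>i<l. f (int i))"
  by (rule sum.reindex_bij_witness[where i = int and j = nat]) auto

lemma sum_qp: "(\<Sum>w\<in>residues. qp (a * w)) = (if int l dvd a then of_nat l else 0)"
proof (cases "int l dvd a")
  case True
  then have "qp (a * w) = 1" for w by (simp add: qp_eq_1_iff)
  then show ?thesis using True by simp
next
  case False
  have "(\<Sum>w\<in>residues. qp (a * w)) = (\<Sum>i<l. qp a ^ i)"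
    by (simp add: sum_residues_lessThan power_int_mult)
  also have "\<dots> = 0"
  proof -
    have "qp a ^ l = qp (a * int l)" by (simp only: power_int_mult power_int_of_nat)
    then have "qp a ^ l = 1" by (simp add: qp_eq_1_iff)
    moreover have "qp a \<noteq> 1" using False by (simp add: qp_eq_1_iff)
    ultimately show ?thesis by (simp add: geometric_sum)
  qed
  finally show ?thesis using False by simp
qed

lemma sum_residues_delta:
  fixes f :: "int \<Rightarrow> 'b::comm_monoid_add"
  assumes "periodic f"
  shows "(\<Sum>w\<in>residues. if int l dvd w - a then f w else 0) = f a"
proof -
  have "int l dvd w - a \<longleftrightarrow> w = a mod int l" if "w \<in> residues" for w
    using that by (metis atLeastLessThan_iff mod_eq_dvd_iff mod_pos_pos_trivial)
  then have "(\<Sum>w\<in>residues. if int l dvd w - a then f w else 0)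
    = (\<Sum>w\<in>residues. if w = a mod int l then f w else 0)"
    by (intro sum.cong) auto
  also have "\<dots> = f (a mod int l)" using l_pos by simp
  finally show ?thesis by (simp add: periodic_mod[OF assms])
qed

lemma periodic_qp: "periodic (\<lambda>w. qp (a * w + b))"
  unfolding periodic_def
proof (intro allI impI)
  fix x y assume "int l dvd x - y"
  then have "int l dvd a * (x - y)" by simp
  then show "qp (a * x + b) = qp (a * y + b)" by (intro qp_cong) (simp add: algebra_simps)
qed

text \<open>The pairing with exponent \<open>4 * i * k\<close> is nondegenerate because 4 is
  invertible modulo the odd \<open>l\<close>. This 4 is the one produced by the double braiding of
  two weights.\<close>

lemma fourier_inversion:
  fixes f :: "int \<Rightarrow> complex"
  assumes f: "periodic f"
  shows "(\<Sum>k\<in>residues. qp (4 * i * k) * (\<Sum>j\<in>residues. qp (- (4 * j * k)) * f j)) = of_nat l * f i"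
proof -
  have "(\<Sum>k\<in>residues. qp (4 * i * k) * (\<Sum>j\<in>residues. qp (- (4 * j * k)) * f j))
      = (\<Sum>j\<in>residues. \<Sum>k\<in>residues. qp (4 * (i - j) * k) * f j)"
  proof -
    have "qp (4 * i * k) * (qp (- (4 * j * k)) * f j) = qp (4 * (i - j) * k) * f j" for j k
      by (simp only: mult.assoc[symmetric] qp_add[symmetric]) (simp add: algebra_simps)
    then show ?thesis unfolding sum_distrib_left by (subst sum.swap) (simp only:)
  qed
  also have "\<dots> = (\<Sum>j\<in>residues. if int l dvd j - i then of_nat l * f j else 0)"
    by (intro sum.cong refl)
      (simp add: sum_distrib_right[symmetric] sum_qp dvd_4_mult dvd_4_mult_diff dvd_diff_commute)
  also have "\<dots> = of_nat l * f i"
    by (rule sum_residues_delta) (use f in \<open>auto simp: periodic_def\<close>)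
  finally show ?thesis .
qed

end

section \<open>The modular group\<close>

text \<open>Euclid's algorithm on the first column, in terms of matrix entries: the rules are left
  multiplication by the two generators.\<close>

lemma int_matrix_induct:
  fixes Q :: "int \<Rightarrow> int \<Rightarrow> int \<Rightarrow> int \<Rightarrow> bool"
  assumes det: "a * d - b * c = 1" and one: "Q 1 0 0 1"
    and S: "\<And>a b c d. a * d - b * c = 1 \<Longrightarrow> Q a b c d \<Longrightarrow> Q (- c) (- d) a b"
    and T: "\<And>a b c d. a * d - b * c = 1 \<Longrightarrow> Q a b c d \<Longrightarrow> Q (a + c) (b + d) c d"
  shows "Q a b c d"
proof -
  \<comment> \<open>Subtracting the second row from the first is the word s^3 t s t s, which equals
    t^-1.\<close>
  have T': "Q (a - c) (b - d) c d" if "a * d - b * c = 1" "Q a b c d" for a b c d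
  proof -
    have "Q (- c) (- d) a b" using S[OF that] .
    from T[OF _ this] have "Q (a - c) (b - d) a b" using that(1) by (simp add: algebra_simps)
    from S[OF _ this] have "Q (- a) (- b) (a - c) (b - d)" using that(1) by (simp add: algebra_simps)
    from T[OF _ this] have "Q (- c) (- d) (a - c) (b - d)" using that(1) by (simp add: algebra_simps)
    from S[OF _ this] have "Q (c - a) (d - b) (- c) (- d)" using that(1) by (simp add: algebra_simps)
    from S[OF _ this] have "Q c d (c - a) (d - b)" using that(1) by (simp add: algebra_simps)
    from S[OF _ this] show ?thesis using that(1) by (simp add: algebra_simps)
  qed
  have Tk: "Q (a + k * c) (b + k * d) c d" if "a * d - b * c = 1" "Q a b c d" for a b c d k
  proof (induction k rule: int_induct[where k = 0])
    case base
    then show ?case using that by simp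
  next
    case (step1 i)
    have "(a + i * c) * d - (b + i * d) * c = 1" using that(1) by (simp add: algebra_simps)
    from T[OF this step1(2)] show ?case by (simp add: algebra_simps)
  next
    case (step2 i)
    have "(a + i * c) * d - (b + i * d) * c = 1" using that(1) by (simp add: algebra_simps)
    from T'[OF this step2(2)] show ?case by (simp add: algebra_simps)
  qed
  show ?thesis using det
  proof (induction "nat \<bar>c\<bar>" arbitrary: a b c d rule: less_induct)
    case less
    show ?case
    proof (cases "c = 0")
      case True
      then have "a * d = 1" using less.prems by simp
      then consider "a = 1" "d = 1" | "a = - 1" "d = - 1" using zmult_eq_1_iff by auto
      then show ?thesis
      proof cases
        case 1
        then show ?thesis using Tk[OF _ one, of b] True by simp
      next
        case 2
        have "Q 1 (- b) 0 1" using Tk[OF _ one, of "- b"] by simp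
        from S[OF _ this] have "Q 0 (- 1) 1 (- b)" by simp
        from S[OF _ this] show ?thesis using 2 True by simp
      qed
    next
      case False
      \<comment> \<open>Removing \<open>k\<close> copies of the second row replaces \<open>a\<close>
        by \<open>a mod c\<close>. Left multiplication by s then moves this smaller entry to the
        lower left corner, where the induction measure sees it.\<close>
      define k where "k = a div c"
      define a' b' where "a' = a - k * c" and "b' = b - k * d"
      have a': "a' = a mod c" by (simp add: a'_def k_def minus_div_mult_eq_mod)
      have det: "a' * d - b' * c = 1"
        using less.prems by (simp add: a'_def b'_def algebra_simps)
      have "\<bar>a'\<bar> < \<bar>c\<bar>" unfolding a' using False by (rule abs_mod_less)
      then have "nat \<bar>a'\<bar> < nat \<bar>c\<bar>" by simp
      from less.hyps[OF this, of "- c" b' "- d"] have "Q (- c) (- d) a' b'"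
        using det by (simp add: algebra_simps)
      from S[OF _ this] have "Q (- a') (- b') (- c) (- d)" using det by (simp add: algebra_simps)
      from S[OF _ this] have "Q c d (- a') (- b')" using det by (simp add: algebra_simps)
      from S[OF _ this] have "Q a' b' c d" using det by (simp add: algebra_simps)
      from Tk[OF det this, of k] show ?thesis by (simp add: a'_def b'_def)
    qed
  qed
qed

lemma matrix2_eq_iff:
  fixes A B :: "'b^2^2"
  shows "A = B \<longleftrightarrow> A $ 1 $ 1 = B $ 1 $ 1 \<and> A $ 1 $ 2 = B $ 1 $ 2 \<and> A $ 2 $ 1 = B $ 2 $ 1 \<and> A $ 2 $ 2 = B $ 2 $ 2"
  by (auto simp: vec_eq_iff forall_2)

lemma matrix2_mult_nth:
  fixes A B :: "int^2^2"
  shows "(A ** B) $ i $ j = A $ i $ 1 * B $ 1 $ j + A $ i $ 2 * B $ 2 $ j"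
  by (simp add: matrix_matrix_mult_def sum_2)

lemma SL2Z_iff: "A \<in> carrier SL2Z \<longleftrightarrow> A $ 1 $ 1 * A $ 2 $ 2 - A $ 1 $ 2 * A $ 2 $ 1 = 1"
  by (simp add: SL2Z_def det_2)

lemma SL2Z_simps [simp]: "A \<otimes>\<^bsub>SL2Z\<^esub> B = A ** B" "\<one>\<^bsub>SL2Z\<^esub> = mat 1"
  by (simp_all add: SL2Z_def)

lemma mat_s_nth [simp]: "mat_s $ 1 $ 1 = 0" "mat_s $ 1 $ 2 = - 1" "mat_s $ 2 $ 1 = 1" "mat_s $ 2 $ 2 = 0"
  by (simp_all add: mat_s_def)

lemma mat_t_nth [simp]: "mat_t $ 1 $ 1 = 1" "mat_t $ 1 $ 2 = 1" "mat_t $ 2 $ 1 = 0" "mat_t $ 2 $ 2 = 1"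
  by (simp_all add: mat_t_def)

lemma mat_1_nth [simp]:
  "(mat 1 :: int^2^2) $ 1 $ 1 = 1" "(mat 1 :: int^2^2) $ 1 $ 2 = 0"
  "(mat 1 :: int^2^2) $ 2 $ 1 = 0" "(mat 1 :: int^2^2) $ 2 $ 2 = 1"
  by (simp_all add: mat_def)

lemma SL2Z_gens: "mat_s \<in> carrier SL2Z" "mat_t \<in> carrier SL2Z" "mat 1 \<in> carrier SL2Z"
  by (simp_all add: SL2Z_iff)

lemma SL2Z_mult: "A \<in> carrier SL2Z \<Longrightarrow> B \<in> carrier SL2Z \<Longrightarrow> A ** B \<in> carrier SL2Z"
  by (simp add: SL2Z_def det_mul)

lemma group_SL2Z: "group SL2Z"
proof (rule groupI)
  fix A assume A: "A \<in> carrier SL2Z"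
  define B :: "int^2^2" where "B = vector [vector [A $ 2 $ 2, - A $ 1 $ 2], vector [- A $ 2 $ 1, A $ 1 $ 1]]"
  have "B \<in> carrier SL2Z" "B ** A = mat 1"
    using A by (simp_all add: SL2Z_iff B_def matrix2_eq_iff matrix2_mult_nth algebra_simps)
  then show "\<exists>B\<in>carrier SL2Z. B \<otimes>\<^bsub>SL2Z\<^esub> A = \<one>\<^bsub>SL2Z\<^esub>" by auto
qed (auto simp: SL2Z_gens SL2Z_mult matrix_mul_assoc)

lemma SL2Z_induct [consumes 1, case_names one s t]:
  assumes A: "A \<in> carrier SL2Z" and one: "P (mat 1)"
    and s: "\<And>A. A \<in> carrier SL2Z \<Longrightarrow> P A \<Longrightarrow> P (mat_s ** A)"
    and t: "\<And>A. A \<in> carrier SL2Z \<Longrightarrow> P A \<Longrightarrow> P (mat_t ** A)"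
  shows "P A"
proof -
  define M :: "int \<Rightarrow> int \<Rightarrow> int \<Rightarrow> int \<Rightarrow> int^2^2"
    where "M a b c d = vector [vector [a, b], vector [c, d]]" for a b c d
  have "P (M (A $ 1 $ 1) (A $ 1 $ 2) (A $ 2 $ 1) (A $ 2 $ 2))"
  proof (rule int_matrix_induct[where Q = "\<lambda>a b c d. P (M a b c d)"])
    show "A $ 1 $ 1 * A $ 2 $ 2 - A $ 1 $ 2 * A $ 2 $ 1 = 1" using A by (simp add: SL2Z_iff)
    have "M 1 0 0 1 = mat 1" by (simp add: M_def matrix2_eq_iff)
    then show "P (M 1 0 0 1)" using one by simp
  next
    fix a b c d :: int assume h: "a * d - b * c = 1" "P (M a b c d)"
    have M: "M a b c d \<in> carrier SL2Z" using h(1) by (simp add: SL2Z_iff M_def)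
    have "M (- c) (- d) a b = mat_s ** M a b c d" "M (a + c) (b + d) c d = mat_t ** M a b c d"
      by (simp_all add: M_def matrix2_eq_iff matrix2_mult_nth)
    then show "P (M (- c) (- d) a b)" "P (M (a + c) (b + d) c d)"
      using s[OF M h(2)] t[OF M h(2)] by simp_all
  qed
  moreover have "M (A $ 1 $ 1) (A $ 1 $ 2) (A $ 2 $ 1) (A $ 2 $ 2) = A"
    by (simp add: M_def matrix2_eq_iff)
  ultimately show ?thesis by simp
qed

section \<open>The Weil representation modulo an odd number\<close>

context root_of_unity
begin

definition even_periodic :: "(int \<Rightarrow> complex) \<Rightarrow> bool"
  where "even_periodic f \<longleftrightarrow> periodic f \<and> (\<forall>j. f (- j) = f j)"

text \<open>A Weyl operator with symmetric phase \<open>2 * a * b\<close>: composing the operators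
  for \<open>(a, b)\<close> and \<open>(a', b')\<close> gives the one for the sum times
  \<open>qp (2 * (a * b' - a' * b))\<close>. This cocycle is a determinant, so matrices of
  determinant 1 act on the labels without extra phases.\<close>

definition heis :: "int \<Rightarrow> int \<Rightarrow> (int \<Rightarrow> complex) \<Rightarrow> int \<Rightarrow> complex"
  where "heis a b f x = qp (4 * b * x + 2 * a * b) * f (x + a)"

definition fourier :: "(int \<Rightarrow> complex) \<Rightarrow> int \<Rightarrow> complex"
  where "fourier f k = (\<Sum>j\<in>residues. qp (- (4 * j * k)) * f j)"

definition gauss_mult :: "(int \<Rightarrow> complex) \<Rightarrow> int \<Rightarrow> complex"
  where "gauss_mult f x = qp (2 * x\<^sup>2) * f x"

text \<open>The Heisenberg group is acted on through \<open>g \<mapsto> (g\<^sup>T)\<inverse>\<close>, which fixes \<open>mat_s\<close>.\<close>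

definition intertwines :: "int^2^2 \<Rightarrow> ((int \<Rightarrow> complex) \<Rightarrow> int \<Rightarrow> complex) \<Rightarrow> bool"
  where "intertwines g U \<longleftrightarrow>
    bij_betw U {f. periodic f} {f. periodic f} \<and> bij_betw U {f. even_periodic f} {f. even_periodic f} \<and>
    (\<forall>f h. periodic f \<longrightarrow> periodic h \<longrightarrow> U (\<lambda>x. f x + h x) = (\<lambda>x. U f x + U h x)) \<and>
    (\<forall>c f. periodic f \<longrightarrow> U (\<lambda>x. c * f x) = (\<lambda>x. c * U f x)) \<and>
    (\<forall>f a b. periodic f \<longrightarrow>
       U (heis a b f) = heis (g $ 2 $ 2 * a - g $ 2 $ 1 * b) (g $ 1 $ 1 * b - g $ 1 $ 2 * a) (U f))"

lemma periodicI: "(\<And>a b. int l dvd a - b \<Longrightarrow> f a = f b) \<Longrightarrow> periodic f"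
  by (simp add: periodic_def)

lemma periodic_add: "periodic f \<Longrightarrow> periodic h \<Longrightarrow> periodic (\<lambda>x. f x + h x :: complex)"
  by (intro periodicI arg_cong2[where f = "(+)"]; erule (1) periodicD)

lemma periodic_cmult: "periodic f \<Longrightarrow> periodic (\<lambda>x. c * f x :: complex)"
  by (intro periodicI arg_cong2[where f = "(*)"] refl; erule (1) periodicD)

lemma even_periodic_add: "even_periodic f \<Longrightarrow> even_periodic h \<Longrightarrow> even_periodic (\<lambda>x. f x + h x)"
  and even_periodic_cmult: "even_periodic f \<Longrightarrow> even_periodic (\<lambda>x. c * f x)"
  by (simp_all add: even_periodic_def periodic_add periodic_cmult)

lemma even_periodicD: "even_periodic f \<Longrightarrow> periodic f"
  by (simp add: even_periodic_def)

lemma periodic_mult: "periodic f \<Longrightarrow> periodic h \<Longrightarrow> periodic (\<lambda>x. f x * h x :: complex)"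
  by (intro periodicI arg_cong2[where f = "(*)"]; erule (1) periodicD)

lemma periodic_const: "periodic (\<lambda>_. c)"
  by (simp add: periodic_def)

lemma periodic_shift: "periodic f \<Longrightarrow> periodic (\<lambda>x. f (x + a))"
  by (simp add: periodic_def)

lemma periodic_neg: "periodic f \<Longrightarrow> periodic (\<lambda>x. f (- x))"
  unfolding periodic_def by (metis dvd_diff_commute minus_diff_minus dvd_minus_iff)

lemma periodic_sum: "(\<And>j. j \<in> X \<Longrightarrow> periodic (f j)) \<Longrightarrow> periodic (\<lambda>x. \<Sum>j\<in>X. f j x :: complex)"
  unfolding periodic_def by (auto intro!: sum.cong)

lemma periodic_heis: "periodic f \<Longrightarrow> periodic (heis a b f)"
  unfolding heis_def by (intro periodic_mult periodic_qp periodic_shift)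

lemma periodic_fourier: "periodic (fourier f)"
proof -
  have "periodic (\<lambda>k. qp (- (4 * j) * k + 0) * f j)" for j
    by (intro periodic_mult periodic_qp) (simp add: periodic_def)
  then show ?thesis unfolding fourier_def by (intro periodic_sum) simp
qed

lemma periodic_gauss: "periodic (\<lambda>x. qp (c * x\<^sup>2))"
  unfolding periodic_def
proof (intro allI impI)
  fix a b assume "int l dvd a - b"
  then have "int l dvd c * (a + b) * (a - b)" by simp
  then show "qp (c * a\<^sup>2) = qp (c * b\<^sup>2)"
    by (intro qp_cong) (simp add: algebra_simps power2_eq_square)
qed

text \<open>This is what makes matrices congruent to 1 modulo \<open>l\<close> act trivially on the
  Heisenberg operators.\<close>

lemma heis_cong:
  assumes "periodic f" "int l dvd a - a'" "int l dvd b - b'"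
  shows "heis a b f = heis a' b' f"
proof
  fix x
  obtain s t where "a = a' + int l * s" "b = b' + int l * t"
    using assms(2,3) by (metis dvdE add_diff_cancel_left' diff_add_cancel add.commute)
  then have "4 * b * x + 2 * a * b - (4 * b' * x + 2 * a' * b')
      = int l * (4 * t * x + 2 * s * b' + 2 * a' * t + 2 * s * int l * t)"
    by (simp add: algebra_simps)
  then have "qp (4 * b * x + 2 * a * b) = qp (4 * b' * x + 2 * a' * b')"
    by (intro qp_cong) simp
  moreover have "f (x + a) = f (x + a')" using assms by (intro periodicD) auto
  ultimately show "heis a b f x = heis a' b' f x" by (simp add: heis_def)
qed

lemma fourier_neg:
  assumes "periodic f"
  shows "fourier (\<lambda>x. f (- x)) k = fourier f (- k)"
proof -
  have "fourier (\<lambda>x. f (- x)) k = (\<Sum>j\<in>residues. qp (- (4 * (0 - j) * (- k))) * f (0 - j))"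
    unfolding fourier_def by (simp add: algebra_simps)
  also have "\<dots> = fourier f (- k)"
    unfolding fourier_def
  proof (rule sum_residues_reflect)
    have "periodic (\<lambda>w. qp (4 * k * w + 0) * f w)" by (intro periodic_mult periodic_qp assms)
    then show "periodic (\<lambda>w. qp (- (4 * w * - k)) * f w)" by (simp add: algebra_simps)
  qed
  finally show ?thesis .
qed

lemma fourier_fourier:
  assumes "periodic f"
  shows "fourier (fourier f) k = of_nat l * f (- k)"
  using fourier_inversion[OF assms, of "- k"]
  by (simp add: fourier_def algebra_simps)

lemma even_fourier: "even_periodic f \<Longrightarrow> even_periodic (fourier f)"
  using fourier_neg[of f] by (simp add: even_periodic_def periodic_fourier)

lemma l_nz [simp]: "l \<noteq> 0"
  using l_ge by simp

lemma intertwines_fourier: "intertwines mat_s fourier"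
  unfolding intertwines_def
proof (intro conjI allI impI)
  \<comment> \<open>Applying \<open>fourier\<close> twice gives \<open>l\<close> times the
    reflection; reflecting and dividing by \<open>l\<close> therefore gives the inverse.\<close>
  define G where "G f x = inverse (of_nat l) * fourier f (- x)" for f x
  have per: "periodic (G f)" for f
    unfolding G_def by (intro periodic_cmult periodic_neg periodic_fourier)
  have GF: "G (fourier f) = f" if "periodic f" for f
    using fourier_fourier[OF that] by (simp add: G_def fun_eq_iff)
  have FG: "fourier (G f) = f" if "periodic f" for f
  proof
    fix k
    have "fourier (G f) k = inverse (of_nat l) * fourier (\<lambda>x. fourier f (- x)) k"
      unfolding fourier_def[of "G f"] G_def 
      unfolding fourier_def[of "\<lambda>x. fourier f (- x)"] sum_distrib_left by (simp add: mult.left_commute)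
    then show "fourier (G f) k = f k"
      by (simp add: fourier_neg periodic_fourier fourier_fourier that)
  qed
  show "bij_betw fourier {f. periodic f} {f. periodic f}"
    by (rule bij_betwI[where g = G]) (auto simp: per periodic_fourier GF FG)
  show "bij_betw fourier {f. even_periodic f} {f. even_periodic f}"
  proof (rule bij_betwI[where g = G])
    show "G \<in> {f. even_periodic f} \<rightarrow> {f. even_periodic f}"
      using even_fourier per by (auto simp: even_periodic_def) (simp add: G_def even_periodic_def)
  qed (auto simp: even_fourier even_periodicD GF FG)
next
  fix f h :: "int \<Rightarrow> complex" and c
  show "fourier (\<lambda>x. f x + h x) = (\<lambda>x. fourier f x + fourier h x)"
    by (simp add: fourier_def fun_eq_iff distrib_left sum.distrib)
  show "fourier (\<lambda>x. c * f x) = (\<lambda>x. c * fourier f x)"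
    by (simp add: fourier_def fun_eq_iff sum_distrib_left mult.left_commute)
next
  fix f :: "int \<Rightarrow> complex" and a b :: int assume f: "periodic f"
  show "fourier (heis a b f) = heis (mat_s $ 2 $ 2 * a - mat_s $ 2 $ 1 * b)
    (mat_s $ 1 $ 1 * b - mat_s $ 1 $ 2 * a) (fourier f)"
  proof
    fix k
    \<comment> \<open>Both shifts are put into one product \<open>(j - a) * (k - b)\<close>. Moving
      the summation variable by \<open>a\<close> removes the first, and expanding the product yields
      the phase of the transformed label.\<close>
    define g where "g j = qp (- (4 * (j - a) * (k - b)) + 2 * a * b) * f j" for j
    have "periodic (\<lambda>j. qp ((- (4 * (k - b))) * j + (4 * a * (k - b) + 2 * a * b)) * f j)"
      by (intro periodic_mult periodic_qp f)
    then have g: "periodic g" by (simp add: g_def[abs_def] algebra_simps)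
    have "fourier (heis a b f) k = (\<Sum>j\<in>residues. g (j + a))"
      unfolding fourier_def heis_def g_def
      by (intro sum.cong refl, simp only: mult.assoc[symmetric] qp_add[symmetric]) (simp add: algebra_simps)
    also have "\<dots> = (\<Sum>j\<in>residues. g j)" by (rule sum_residues_shift[OF g])
    also have "\<dots> = heis (- b) a (fourier f) k"
    proof -
      have "g j = qp (4 * a * k + 2 * (- b) * a) * (qp (- (4 * j * (k - b))) * f j)" for j
        unfolding g_def by (simp only: mult.assoc[symmetric] qp_add[symmetric]) (simp add: algebra_simps)
      then show ?thesis by (simp add: heis_def fourier_def sum_distrib_left)
    qed
    finally show "fourier (heis a b f) k = heis (mat_s $ 2 $ 2 * a - mat_s $ 2 $ 1 * b)
      (mat_s $ 1 $ 1 * b - mat_s $ 1 $ 2 * a) (fourier f) k" by simp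
  qed
qed

text \<open>Completing the square: \<open>2 * (x + a)^2 - 2 * x^2 = 4 * a * x + 2 * a^2\<close>, so
  a quadratic phase turns a translation by \<open>a\<close> into the same translation with an
  additional linear phase.\<close>

lemma intertwines_gauss: "intertwines mat_t gauss_mult"
  unfolding intertwines_def
proof (intro conjI allI impI)
  define G :: "(int \<Rightarrow> complex) \<Rightarrow> int \<Rightarrow> complex" where "G f x = qp (- 2 * x\<^sup>2) * f x" for f x
  have inv: "G (gauss_mult f) = f" "gauss_mult (G f) = f" for f
    by (simp_all add: G_def gauss_mult_def fun_eq_iff mult.assoc[symmetric] qp_add[symmetric])
  have per: "periodic (gauss_mult f)" "periodic (G f)" if "periodic f" for f
    unfolding gauss_mult_def[abs_def] G_def by (intro periodic_mult periodic_gauss that)+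
  show "bij_betw gauss_mult {f. periodic f} {f. periodic f}"
    by (rule bij_betwI[where g = G]) (auto simp: per inv)
  show "bij_betw gauss_mult {f. even_periodic f} {f. even_periodic f}"
    by (rule bij_betwI[where g = G]) (auto simp: per inv even_periodic_def gauss_mult_def G_def)
next
  fix f :: "int \<Rightarrow> complex" and a b :: int
  have "qp (2 * x\<^sup>2) * qp (4 * b * x + 2 * a * b)
    = qp (4 * (b - a) * x + 2 * a * (b - a)) * qp (2 * (x + a)\<^sup>2)" for x
    by (simp only: qp_add[symmetric]) (simp add: algebra_simps power2_eq_square)
  then show "gauss_mult (heis a b f) = heis (mat_t $ 2 $ 2 * a - mat_t $ 2 $ 1 * b)
    (mat_t $ 1 $ 1 * b - mat_t $ 1 $ 2 * a) (gauss_mult f)"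
    by (simp add: gauss_mult_def heis_def fun_eq_iff mult.assoc[symmetric])
qed (simp_all add: gauss_mult_def fun_eq_iff algebra_simps)

lemma intertwines_comp:
  assumes "intertwines g U" "intertwines h W"
  shows "intertwines (g ** h) (\<lambda>f. U (W f))"
proof -
  have W: "periodic (W f)" if "periodic f" for f
    using assms(2) that unfolding intertwines_def bij_betw_def by auto
  show ?thesis
    unfolding intertwines_def
  proof (intro conjI allI impI)
    show "bij_betw (\<lambda>f. U (W f)) {f. periodic f} {f. periodic f}"
      "bij_betw (\<lambda>f. U (W f)) {f. even_periodic f} {f. even_periodic f}"
      using assms bij_betw_trans[of W _ _ U] by (auto simp: intertwines_def comp_def)
  next
    fix f :: "int \<Rightarrow> complex" and a b assume f: "periodic f"
    show "U (W (heis a b f)) = heis ((g ** h) $ 2 $ 2 * a - (g ** h) $ 2 $ 1 * b)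
      ((g ** h) $ 1 $ 1 * b - (g ** h) $ 1 $ 2 * a) (U (W f))"
      using assms f W by (simp add: intertwines_def matrix2_mult_nth algebra_simps)
  qed (use assms W in \<open>simp_all add: intertwines_def\<close>)
qed

lemma intertwines_id: "intertwines (mat 1) (\<lambda>f. f)"
  unfolding intertwines_def by (simp add: bij_betw_def inj_on_def)

lemma intertwines_scale:
  assumes "intertwines g U" "c \<noteq> 0"
  shows "intertwines g (\<lambda>f x. c * U f x)"
proof -
  have "intertwines (mat 1) (\<lambda>f x. c * f x)"
    unfolding intertwines_def
  proof (intro conjI)
    show "bij_betw (\<lambda>f x. c * f x) {f. periodic f} {f. periodic f}"
      "bij_betw (\<lambda>f x. c * f x) {f. even_periodic f} {f. even_periodic f}"
      using assms(2)
      by (intro bij_betwI[where g = "\<lambda>f x. inverse c * f x"];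
          auto simp: periodic_cmult even_periodic_cmult fun_eq_iff)+
  qed (auto simp: heis_def fun_eq_iff algebra_simps)
  from intertwines_comp[OF this assms(1)] show ?thesis by (simp add: matrix_mul_lid)
qed

lemma intertwines_exists: "g \<in> carrier SL2Z \<Longrightarrow> \<exists>U. intertwines g U"
  by (induction rule: SL2Z_induct)
    (use intertwines_id intertwines_comp[OF intertwines_fourier] intertwines_comp[OF intertwines_gauss] in blast)+

lemma intertwines_sum:
  assumes U: "intertwines g U" and "finite X" "\<And>j. j \<in> X \<Longrightarrow> periodic (f j)"
  shows "U (\<lambda>x. \<Sum>j\<in>X. f j x) = (\<lambda>x. \<Sum>j\<in>X. U (f j) x)"
  using assms(2,3)
proof (induction X rule: finite_induct)
  case empty
  have "U (\<lambda>x. 0 * 0) = (\<lambda>x. 0 * U (\<lambda>_. 0) x)"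
    using U periodic_const[of 0] unfolding intertwines_def by blast
  then show ?case by simp
next
  case (insert j X)
  have "U (\<lambda>x. f j x + (\<Sum>j\<in>X. f j x)) = (\<lambda>x. U (f j) x + U (\<lambda>x. \<Sum>j\<in>X. f j x) x)"
    using U insert.prems periodic_sum[of X f] unfolding intertwines_def by auto
  then show ?case using insert by simp
qed

text \<open>A function commuting with all \<open>heis 0 b\<close> is concentrated at \<open>0\<close>, so the delta function
  is an eigenvector; its translates span.\<close>

lemma intertwines_unique:
  assumes U: "intertwines g U" and W: "intertwines g W"
  shows "\<exists>c. c \<noteq> 0 \<and> (\<forall>f. periodic f \<longrightarrow> W f = (\<lambda>x. c * U f x))"
proof -
  have perW: "periodic (W f)" and perU: "periodic (U f)" if "periodic f" for f
    using U W that unfolding intertwines_def bij_betw_def by auto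
  have linear: "Y (\<lambda>x. c * f x) = (\<lambda>x. c * Y f x)" if "intertwines g Y" "periodic f" for Y c f
    using that unfolding intertwines_def by blast
  have injU: "inj_on U {f. periodic f}" and injW: "inj_on W {f. periodic f}"
    using U W by (auto simp: intertwines_def bij_betw_def)
  have heisU: "U (heis a b f) = heis (g $ 2 $ 2 * a - g $ 2 $ 1 * b) (g $ 1 $ 1 * b - g $ 1 $ 2 * a) (U f)"
    and heisW: "W (heis a b f) = heis (g $ 2 $ 2 * a - g $ 2 $ 1 * b) (g $ 1 $ 1 * b - g $ 1 $ 2 * a) (W f)"
    if "periodic f" for a b f using U W that unfolding intertwines_def by blast+
  define D :: "int \<Rightarrow> complex" where "D x = (if int l dvd x then 1 else 0)" for x
  have D: "periodic D"
  proof (rule periodicI)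
    fix a b assume "int l dvd a - b"
    then have "int l dvd a \<longleftrightarrow> int l dvd b" using dvd_add_right_iff[of "int l" "a - b" b] by simp
    then show "D a = D b" by (simp add: D_def)
  qed
  \<comment> \<open>Here \<open>h\<close> becomes the preimage of \<open>W D\<close> under
    \<open>U\<close>. The two conjugation rules cancel in the quotient of \<open>W\<close> by
    \<open>U\<close>, so \<open>h\<close> inherits the invariance of \<open>D\<close> under every
    \<open>heis 0 b\<close>.\<close>
  have "W D \<in> U ` {f. periodic f}" using U perW[OF D] by (simp add: intertwines_def bij_betw_def)
  then obtain h where h: "periodic h" "W D = U h" by auto
  define c where "c = h 0"
  have "heis 0 b h = h" for b
  proof -
    have "heis 0 b D = D" by (auto simp: heis_def D_def fun_eq_iff qp_eq_1_iff)
    have "U (heis 0 b h) = W (heis 0 b D)" by (simp only: heisU[OF h(1)] heisW[OF D] h(2))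
    also have "\<dots> = U h" using \<open>heis 0 b D = D\<close> h(2) by simp
    finally have "U (heis 0 b h) = U h" .
    then show ?thesis using inj_onD[OF injU] h(1) periodic_heis[OF h(1)] by simp
  qed
  \<comment> \<open>\<open>b = 1\<close> suffices: \<open>qp (4 * x) = 1\<close> only at multiples
    \<open>x\<close> of the odd number \<open>l\<close>.\<close>
  then have "heis 0 1 h x = h x" for x by simp
  then have hx: "qp (4 * x) * h x = h x" for x by (simp add: heis_def)
  have "h x = 0" if "\<not> int l dvd x" for x
    using that hx[of x] qp_eq_1_iff[of "4 * x"] by (simp add: dvd_4_mult)
  moreover have "h x = c" if "int l dvd x" for x
    unfolding c_def using that periodicD[OF h(1), of x 0] by simp
  ultimately have hD: "h = (\<lambda>x. c * D x)" by (auto simp: D_def fun_eq_iff)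
  have WD: "W D = (\<lambda>x. c * U D x)"
    by (rule trans[OF h(2)], subst hD, rule linear[OF U D])
  have shift: "W (heis a 0 D) = (\<lambda>x. c * U (heis a 0 D) x)" for a
  proof -
    have "heis u v (\<lambda>x. c * U D x) = (\<lambda>x. c * heis u v (U D) x)" for u v
      by (rule ext) (simp only: heis_def mult.left_commute)
    then show ?thesis by (simp only: heisU[OF D] heisW[OF D] WD)
  qed
  have main: "W f = (\<lambda>x. c * U f x)" if f: "periodic f" for f
  proof -
    have eq: "f = (\<lambda>x. \<Sum>j\<in>residues. f j * heis (- j) 0 D x)"
    proof
      fix x
      have "(\<Sum>j\<in>residues. f j * heis (- j) 0 D x) = (\<Sum>j\<in>residues. if int l dvd j - x then f j else 0)"
        by (intro sum.cong refl) (auto simp: heis_def D_def dvd_diff_commute)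
      then show "f x = (\<Sum>j\<in>residues. f j * heis (- j) 0 D x)"
        by (simp add: sum_residues_delta[OF f])
    qed
    have per: "periodic (heis (- j) 0 D)" "periodic (\<lambda>x. f j * heis (- j) 0 D x)" for j
      by (intro periodic_cmult periodic_heis D)+
    have exp: "Y f = (\<lambda>x. \<Sum>j\<in>residues. f j * Y (heis (- j) 0 D) x)" if "intertwines g Y" for Y
      by (subst eq, subst intertwines_sum[OF that]) (simp_all add: per linear[OF that])
    show ?thesis
      by (simp add: exp[OF W] exp[OF U] shift sum_distrib_left mult.left_commute)
  qed
  moreover have "c \<noteq> 0"
  proof
    assume "c = 0"
    then have "W D = (\<lambda>_. 0)" using WD by simp
    moreover have "W (\<lambda>_. 0) = (\<lambda>_. 0)" using main[OF periodic_const[of 0]] \<open>c = 0\<close> by simp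
    ultimately have "D = (\<lambda>_. 0)" using W D
      periodic_const[of 0] unfolding intertwines_def bij_betw_def inj_on_def by (metis mem_Collect_eq)
    then show False by (metis D_def dvd_0_right zero_neq_one)
  qed
  ultimately show ?thesis by blast
qed

end

section \<open>Kernels of projective representations\<close>

lemma projective_kernel_subgroup:
  assumes G: "group G" and \<rho>: "projective_representation G V \<rho>"
  shows "subgroup (projective_kernel G V \<rho>) G"
    and "\<exists>e. e \<noteq> 0 \<and> (\<forall>x\<in>V. \<rho> \<one>\<^bsub>G\<^esub> x = e *\<^sub>C x)"
proof -
  interpret G: group G by (rule G)
  have mem: "\<rho> g x \<in> V" if "g \<in> carrier G" "x \<in> V" for g x
    using \<rho> that unfolding projective_representation_def linear_automorphism_on_def bij_betw_def by blast
  have scale: "\<rho> g (c *\<^sub>C x) = c *\<^sub>C \<rho> g x" if "g \<in> carrier G" "x \<in> V" for g c x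
    using \<rho> that unfolding projective_representation_def linear_automorphism_on_def by blast
  have prod: "\<exists>c. c \<noteq> 0 \<and> (\<forall>x\<in>V. \<rho> (g \<otimes>\<^bsub>G\<^esub> h) x = c *\<^sub>C \<rho> g (\<rho> h x))"
    if "g \<in> carrier G" "h \<in> carrier G" for g h
    using \<rho> that unfolding projective_representation_def by blast
  show one: "\<exists>e. e \<noteq> 0 \<and> (\<forall>x\<in>V. \<rho> \<one>\<^bsub>G\<^esub> x = e *\<^sub>C x)"
  proof -
    \<comment> \<open>The operator of the identity is idempotent up to \<open>k\<close> and
      surjective on \<open>V\<close>; hence it is the scalar \<open>inverse k\<close>.\<close>
    obtain k where k: "k \<noteq> 0" "\<And>x. x \<in> V \<Longrightarrow> \<rho> \<one>\<^bsub>G\<^esub> x = k *\<^sub>C \<rho> \<one>\<^bsub>G\<^esub> (\<rho> \<one>\<^bsub>G\<^esub> x)"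
      using prod[of "\<one>\<^bsub>G\<^esub>" "\<one>\<^bsub>G\<^esub>"] by auto
    have "\<rho> \<one>\<^bsub>G\<^esub> y = inverse k *\<^sub>C y" if y: "y \<in> V" for y
    proof -
      have "V = \<rho> \<one>\<^bsub>G\<^esub> ` V"
        using \<rho> unfolding projective_representation_def linear_automorphism_on_def bij_betw_def by blast
      then obtain x where x: "x \<in> V" "y = \<rho> \<one>\<^bsub>G\<^esub> x" using y by blast
      then have "y = k *\<^sub>C \<rho> \<one>\<^bsub>G\<^esub> y" using k(2) by simp
      then have "inverse k *\<^sub>C y = (inverse k * k) *\<^sub>C \<rho> \<one>\<^bsub>G\<^esub> y" by (metis scaleC_scaleC)
      then show ?thesis using k(1) by (simp add: scaleC_one)
    qed
    then show ?thesis using k(1) by (intro exI[of _ "inverse k"]) auto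
  qed
  show "subgroup (projective_kernel G V \<rho>) G"
  proof (rule G.subgroupI)
    show "projective_kernel G V \<rho> \<subseteq> carrier G" by (auto simp: projective_kernel_def)
    have "\<one>\<^bsub>G\<^esub> \<in> projective_kernel G V \<rho>" using one by (auto simp: projective_kernel_def)
    then show "projective_kernel G V \<rho> \<noteq> {}" by blast
  next
    fix g assume "g \<in> projective_kernel G V \<rho>"
    then obtain c where g: "g \<in> carrier G" "\<And>x. x \<in> V \<Longrightarrow> \<rho> g x = c *\<^sub>C x"
      by (auto simp: projective_kernel_def)
    let ?i = "inv\<^bsub>G\<^esub> g"
    obtain k where k: "k \<noteq> 0" "\<And>x. x \<in> V \<Longrightarrow> \<rho> (?i \<otimes>\<^bsub>G\<^esub> g) x = k *\<^sub>C \<rho> ?i (\<rho> g x)"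
      using prod[of ?i g] g(1) by auto
    obtain e where e: "e \<noteq> 0" "\<And>x. x \<in> V \<Longrightarrow> \<rho> \<one>\<^bsub>G\<^esub> x = e *\<^sub>C x" using one by blast
    have *: "e *\<^sub>C x = (k * c) *\<^sub>C \<rho> ?i x" if "x \<in> V" for x
      using k(2)[OF that] e(2)[OF that] g that scale[of ?i x c] by (simp add: scaleC_scaleC)
    have "\<exists>c. \<forall>x\<in>V. \<rho> ?i x = c *\<^sub>C x"
    \<comment> \<open>A zero scalar at an automorphism means that \<open>V\<close> is zero, and
      there every operator is scalar.\<close>
    proof (cases "c = 0")
      case True
      then have "x = 0" if "x \<in> V" for x using *[OF that] e(1) by simp
      then have "\<forall>x\<in>V. \<rho> ?i x = 0 *\<^sub>C x" using mem[of ?i] g(1) by auto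
      then show ?thesis by blast
    next
      case False
      have "\<rho> ?i x = (inverse (k * c) * e) *\<^sub>C x" if "x \<in> V" for x
      proof -
        have "(inverse (k * c) * e) *\<^sub>C x = (inverse (k * c) * (k * c)) *\<^sub>C \<rho> ?i x"
          using *[OF that] by (metis scaleC_scaleC)
        moreover have "inverse (k * c) * (k * c) = 1" using False k(1) by (simp add: field_simps)
        ultimately show ?thesis by (simp only: scaleC_one)
      qed
      then show ?thesis by blast
    qed
    then show "?i \<in> projective_kernel G V \<rho>" using g(1) by (simp add: projective_kernel_def)
  next
    fix g h assume "g \<in> projective_kernel G V \<rho>" "h \<in> projective_kernel G V \<rho>"
    then obtain c d where gh: "g \<in> carrier G" "h \<in> carrier G"
      "\<And>x. x \<in> V \<Longrightarrow> \<rho> g x = c *\<^sub>C x" "\<And>x. x \<in> V \<Longrightarrow> \<rho> h x = d *\<^sub>C x"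
      by (auto simp: projective_kernel_def)
    obtain k where "\<And>x. x \<in> V \<Longrightarrow> \<rho> (g \<otimes>\<^bsub>G\<^esub> h) x = k *\<^sub>C \<rho> g (\<rho> h x)"
      using prod[of g h] gh by auto
    then have "\<rho> (g \<otimes>\<^bsub>G\<^esub> h) x = (k * d * c) *\<^sub>C x" if "x \<in> V" for x
      using that gh by (simp add: scale scaleC_scaleC)
    then show "g \<otimes>\<^bsub>G\<^esub> h \<in> projective_kernel G V \<rho>" using gh by (auto simp: projective_kernel_def)
  qed
qed

context root_of_unity
begin

text \<open>Existence: choose an intertwiner for each matrix; \<open>intertwines_unique\<close>
  makes the choice projectively multiplicative. Conversely, along words in the generators every
  \<open>\<rho>\<close> is given by some intertwiner, and for a matrix congruent to 1 modulo
  \<open>l\<close> that operator intertwines the identity matrix and is scalar by uniqueness. The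
  map \<open>J\<close> provides even functions as coordinates on \<open>V\<close>.\<close>

lemma weil_congruence:
  fixes V :: "'a::complex_vector set" and J :: "(int \<Rightarrow> complex) \<Rightarrow> 'a"
  assumes J: "bij_betw J {f. even_periodic f} V"
    and J_add: "\<And>f h. even_periodic f \<Longrightarrow> even_periodic h \<Longrightarrow> J (\<lambda>x. f x + h x) = J f + J h"
    and J_scale: "\<And>c f. even_periodic f \<Longrightarrow> J (\<lambda>x. c * f x) = c *\<^sub>C J f"
    and s: "\<And>f. even_periodic f \<Longrightarrow> s (J f) = J (\<lambda>x. c * fourier f x)" and c: "c \<noteq> 0"
    and t: "\<And>f. even_periodic f \<Longrightarrow> t (J f) = J (\<lambda>x. d * gauss_mult f x)" and d: "d \<noteq> 0"
  shows "(\<exists>\<rho>. modular_representation V s t \<rho>) \<and>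
    (\<forall>\<rho>. modular_representation V s t \<rho> \<longrightarrow> congruence_subgroup (projective_kernel SL2Z V \<rho>))"
proof (intro conjI allI impI)
  have V: "V = J ` {f. even_periodic f}" and Jinj: "inj_on J {f. even_periodic f}"
    using J by (auto simp: bij_betw_def)
  have ev0: "even_periodic (\<lambda>_. 0)" by (simp add: even_periodic_def periodic_def)
  have subspace: "cvs.subspace V"
    unfolding cvs.subspace_def
  proof (intro conjI ballI allI)
    show "0 \<in> V" using J_scale[OF ev0, of 0] ev0 unfolding V by force
    fix x y assume "x \<in> V" "y \<in> V"
    then show "x + y \<in> V" unfolding V using J_add even_periodic_add by force
  next
    fix k x assume "x \<in> V"
    then obtain f where "even_periodic f" "x = J f" by (auto simp: V)
    then show "k *\<^sub>C x \<in> V" unfolding V using J_scale[of f k] even_periodic_cmult[of f k]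
      by (intro image_eqI[of _ _ "\<lambda>x. k * f x"]) auto
  qed
  define Ji where "Ji = inv_into {f. even_periodic f} J"
  have Ji: "Ji (J f) = f" if "even_periodic f" for f
    unfolding Ji_def using Jinj that by (simp add: inv_into_f_f)
  let ?Us = "\<lambda>f x. c * fourier f x" and ?Ut = "\<lambda>f x. d * gauss_mult f x"
  have Us: "intertwines mat_s ?Us" and Ut: "intertwines mat_t ?Ut"
    using intertwines_scale[OF intertwines_fourier c] intertwines_scale[OF intertwines_gauss d] .
  \<comment> \<open>At the two generators the choice must return exactly the prescribed operators;
    elsewhere any intertwiner serves.\<close>
  define U where "U g = (if g = mat_s then ?Us else if g = mat_t then ?Ut else SOME U. intertwines g U)" for g
  have U: "intertwines g (U g)" if "g \<in> carrier SL2Z" for g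
    using Us Ut someI_ex[OF intertwines_exists[OF that]] by (simp add: U_def)
  have evU: "even_periodic (W f)" if "intertwines g W" "even_periodic f" for g W f
    using that unfolding intertwines_def bij_betw_def by auto
  define \<rho> where "\<rho> g x = J (U g (Ji x))" for g x
  have \<rho>J: "\<rho> g (J f) = J (U g f)" if "even_periodic f" for g f
    using that by (simp add: \<rho>_def Ji)
  have "modular_representation V s t \<rho>"
    unfolding modular_representation_def projective_representation_def
  proof (intro conjI ballI)
    show "cvs.subspace V" by (rule subspace)
  next
    fix g assume g: "g \<in> carrier SL2Z"
    have "bij_betw Ji V {f. even_periodic f}" unfolding Ji_def by (rule bij_betw_inv_into[OF J])
    moreover have "bij_betw (U g) {f. even_periodic f} {f. even_periodic f}"
      using U[OF g] by (simp add: intertwines_def)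
    ultimately have "bij_betw (J \<circ> (U g \<circ> Ji)) V V" using J by (meson bij_betw_trans)
    then have bij: "bij_betw (\<rho> g) V V" by (simp add: \<rho>_def[abs_def] comp_def)
    show "linear_automorphism_on V (\<rho> g)"
      unfolding linear_automorphism_on_def
    proof (intro conjI bij ballI allI)
      fix x y assume "x \<in> V" "y \<in> V"
      then obtain f h where fh: "even_periodic f" "x = J f" "even_periodic h" "y = J h" by (auto simp: V)
      have "U g (\<lambda>x. f x + h x) = (\<lambda>x. U g f x + U g h x)"
        using U[OF g] fh even_periodicD unfolding intertwines_def by blast
      then show "\<rho> g (x + y) = \<rho> g x + \<rho> g y"
        using fh by (simp add: \<rho>J J_add[symmetric] even_periodic_add evU[OF U[OF g]])
    next
      fix k x assume "x \<in> V"
      then obtain f where f: "even_periodic f" "x = J f" by (auto simp: V)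
      have "U g (\<lambda>x. k * f x) = (\<lambda>x. k * U g f x)"
        using U[OF g] f even_periodicD unfolding intertwines_def by blast
      then show "\<rho> g (k *\<^sub>C x) = k *\<^sub>C \<rho> g x"
        using f by (simp add: \<rho>J J_scale[symmetric] even_periodic_cmult evU[OF U[OF g]])
    qed
  next
    fix g h assume gh: "g \<in> carrier SL2Z" "h \<in> carrier SL2Z"
    obtain k where k: "k \<noteq> 0" "\<And>f. periodic f \<Longrightarrow> U (g ** h) f = (\<lambda>x. k * U g (U h f) x)"
      using intertwines_unique[OF intertwines_comp[OF U[OF gh(1)] U[OF gh(2)]] U[OF SL2Z_mult[OF gh]]] by blast
    have "\<rho> (g ** h) x = k *\<^sub>C \<rho> g (\<rho> h x)" if "x \<in> V" for x
      using that k(2) by (auto simp: V \<rho>J J_scale[symmetric] even_periodicD evU[OF U] gh)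
    then show "\<exists>k. k \<noteq> 0 \<and> (\<forall>x\<in>V. \<rho> (g \<otimes>\<^bsub>SL2Z\<^esub> h) x = k *\<^sub>C \<rho> g (\<rho> h x))"
      using k(1) by auto
  next
    fix x assume "x \<in> V"
    then obtain f where f: "even_periodic f" "x = J f" by (auto simp: V)
    show "\<rho> mat_s x = s x" using f by (simp add: \<rho>J U_def s)
    have "mat_t \<noteq> mat_s" by (simp add: matrix2_eq_iff)
    then show "\<rho> mat_t x = t x" using f by (simp add: \<rho>J U_def t)
  qed
  then show "\<exists>\<rho>. modular_representation V s t \<rho>" by blast
next
  fix \<rho> assume mod: "modular_representation V s t \<rho>"
  then have \<rho>: "projective_representation SL2Z V \<rho>" by (simp add: modular_representation_def)
  have V: "V = J ` {f. even_periodic f}" using J by (auto simp: bij_betw_def)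
  have evU: "even_periodic (W f)" if "intertwines g W" "even_periodic f" for g W f
    using that unfolding intertwines_def bij_betw_def by auto
  have \<rho>st: "\<rho> mat_s (J f) = J (\<lambda>x. c * fourier f x)" "\<rho> mat_t (J f) = J (\<lambda>x. d * gauss_mult f x)"
    if "even_periodic f" for f
    using mod that by (auto simp: modular_representation_def V s t)
  have prod: "\<exists>k. k \<noteq> 0 \<and> (\<forall>x\<in>V. \<rho> (g ** h) x = k *\<^sub>C \<rho> g (\<rho> h x))"
    if "g \<in> carrier SL2Z" "h \<in> carrier SL2Z" for g h
    using \<rho> that unfolding projective_representation_def SL2Z_simps by blast
  note sub = projective_kernel_subgroup[OF group_SL2Z \<rho>]
  have step: "\<exists>W'. intertwines (g ** A) W' \<and> (\<forall>f. even_periodic f \<longrightarrow> \<rho> (g ** A) (J f) = J (W' f))"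
    if g: "g \<in> carrier SL2Z" "intertwines g U" "\<And>f. even_periodic f \<Longrightarrow> \<rho> g (J f) = J (U f)"
      and A: "A \<in> carrier SL2Z" "intertwines A W" "\<And>f. even_periodic f \<Longrightarrow> \<rho> A (J f) = J (W f)"
    for g U A W
  proof -
    obtain k where k: "k \<noteq> 0" "\<And>x. x \<in> V \<Longrightarrow> \<rho> (g ** A) x = k *\<^sub>C \<rho> g (\<rho> A x)"
      using prod[OF g(1) A(1)] by blast
    have "intertwines (g ** A) (\<lambda>f x. k * U (W f) x)"
      using intertwines_scale[OF intertwines_comp[OF g(2) A(2)] k(1)] by simp
    moreover have "\<rho> (g ** A) (J f) = J (\<lambda>x. k * U (W f) x)" if f: "even_periodic f" for f
      using k(2)[of "J f"] f by (simp add: V A(3) g(3) evU[OF A(2) f] J_scale evU[OF g(2)])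
    ultimately show ?thesis by blast
  qed
  have all: "\<exists>W. intertwines g W \<and> (\<forall>f. even_periodic f \<longrightarrow> \<rho> g (J f) = J (W f))"
    if "g \<in> carrier SL2Z" for g
    using that
  proof (induction rule: SL2Z_induct)
    case one
    obtain e where e: "e \<noteq> 0" "\<And>x. x \<in> V \<Longrightarrow> \<rho> (mat 1) x = e *\<^sub>C x" using sub(2) by auto
    have "\<rho> (mat 1) (J f) = J (\<lambda>x. e * f x)" if "even_periodic f" for f
      using e(2)[of "J f"] that by (simp add: V J_scale)
    then show ?case using intertwines_scale[OF intertwines_id e(1)] by blast
  next
    case (s A)
    then show ?case
      using step[OF SL2Z_gens(1) intertwines_scale[OF intertwines_fourier c] \<rho>st(1)] by blast
  next
    case (t A)
    then show ?case
      using step[OF SL2Z_gens(2) intertwines_scale[OF intertwines_gauss d] \<rho>st(2)] by blast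
  qed
  have "principal_congruence_subgroup l \<subseteq> projective_kernel SL2Z V \<rho>"
  proof
    fix g assume "g \<in> principal_congruence_subgroup l"
    then have g: "g \<in> carrier SL2Z" and
      "\<And>i j. g $ i $ j mod int l = (mat 1 :: int^2^2) $ i $ j mod int l"
      by (auto simp: principal_congruence_subgroup_def)
    then have d: "int l dvd g $ i $ j - (mat 1 :: int^2^2) $ i $ j" for i j
      by (simp add: mod_eq_dvd_iff)
    obtain W where W: "intertwines g W" "\<And>f. even_periodic f \<Longrightarrow> \<rho> g (J f) = J (W f)"
      using all[OF g] by blast
    \<comment> \<open>The labels change only by multiples of \<open>l\<close>, so \<open>W\<close>
      commutes with all Heisenberg operators.\<close>
    have "heis (g $ 2 $ 2 * a - g $ 2 $ 1 * b) (g $ 1 $ 1 * b - g $ 1 $ 2 * a) f = heis a b f"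
      if "periodic f" for a b f
    proof (rule heis_cong[OF that])
      have "int l dvd (g $ 2 $ 2 - 1) * a - g $ 2 $ 1 * b" "int l dvd (g $ 1 $ 1 - 1) * b - g $ 1 $ 2 * a"
        using d[of 2 2] d[of 2 1] d[of 1 1] d[of 1 2] by simp_all
      then show "int l dvd g $ 2 $ 2 * a - g $ 2 $ 1 * b - a" "int l dvd g $ 1 $ 1 * b - g $ 1 $ 2 * a - b"
        by (simp_all add: algebra_simps)
    qed
    moreover have "periodic (W f)" if "periodic f" for f
      using W(1) that unfolding intertwines_def bij_betw_def by auto
    ultimately have "intertwines (mat 1) W" using W(1) unfolding intertwines_def by simp
    from intertwines_unique[OF intertwines_id this]
    obtain k where "k \<noteq> 0" "\<And>f. periodic f \<Longrightarrow> W f = (\<lambda>x. k * f x)" by blast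
    then have "\<rho> g x = k *\<^sub>C x" if "x \<in> V" for x
      using that W(2) by (auto simp: V J_scale even_periodicD)
    then show "g \<in> projective_kernel SL2Z V \<rho>" using g by (auto simp: projective_kernel_def)
  qed
  then show "congruence_subgroup (projective_kernel SL2Z V \<rho>)"
    unfolding congruence_subgroup_def using sub(1) l_ge by (intro conjI exI[of _ l]) auto
qed

end

section \<open>Evaluation of polynomials in a complex algebra\<close>

definition alg_eval :: "'a::complex_algebra_1 \<Rightarrow> complex poly \<Rightarrow> 'a"
  where "alg_eval c p = fold_coeffs (\<lambda>a y. a *\<^sub>C 1 + c * y) p 0"

lemma alg_eval_0 [simp]: "alg_eval c 0 = 0"
  by (simp add: alg_eval_def)

lemma alg_eval_pCons [simp]: "alg_eval c (pCons a p) = a *\<^sub>C 1 + c * alg_eval c p"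
  by (cases "p = 0 \<and> a = 0") (auto simp: alg_eval_def)

lemma alg_eval_1 [simp]: "alg_eval c 1 = 1"
  by (simp add: one_pCons scaleC_one)

lemma alg_eval_add: "alg_eval c (p + p') = alg_eval c p + alg_eval c p'"
  by (induction p p' rule: poly_induct2) (simp_all add: scaleC_add_left algebra_simps)

lemma alg_eval_smult: "alg_eval c (smult a p) = a *\<^sub>C alg_eval c p"
  by (induction p) (simp_all add: scaleC_add_right scaleC_scaleC mult_scaleC_right)

lemma alg_eval_mult: "alg_eval c (p * p') = alg_eval c p * alg_eval c p'"
  by (induction p)
    (simp_all add: alg_eval_add alg_eval_smult mult_scaleC_left distrib_right mult.assoc)

lemma alg_eval_sum: "alg_eval c (sum f X) = (\<Sum>x\<in>X. alg_eval c (f x))"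
  by (induction X rule: infinite_finite_induct) (simp_all add: alg_eval_add)

lemma alg_eval_commute: "x * c = c * x \<Longrightarrow> x * alg_eval c p = alg_eval c p * x"
proof (induction p)
  case (pCons a p)
  have "x * (c * alg_eval c p) = c * alg_eval c p * x"
    using pCons by (metis mult.assoc)
  then show ?case by (simp add: algebra_simps mult_scaleC_left mult_scaleC_right)
qed simp

lemma clinear_add: "clinear f \<Longrightarrow> f (x + y) = f x + f y"
  and clinear_scale: "clinear f \<Longrightarrow> f (c *\<^sub>C x) = c *\<^sub>C f x"
  by (simp_all add: clinear_iff)

lemma clinear_zero: "clinear f \<Longrightarrow> f 0 = 0"
  using clinear_scale[of f 0 0] by simp

lemma clinear_minus: "clinear f \<Longrightarrow> f (- x) = - f x"
  using clinear_scale[of f "- 1" x] by simp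

lemma clinear_sum: "clinear f \<Longrightarrow> f (\<Sum>x\<in>X. g x) = (\<Sum>x\<in>X. f (g x))"
  by (induction X rule: infinite_finite_induct) (simp_all add: clinear_zero clinear_add)

lemma scaleC_complex [simp]: "(c::complex) *\<^sub>C x = c * x"
  by (simp add: scaleC_complex_def)

lemma clinear_scale_complex: "clinear f \<Longrightarrow> f (c *\<^sub>C x) = c * (f x :: complex)"
  by (simp add: clinear_scale)

section \<open>The algebra structure of the small quantum group\<close>

text \<open>The algebra without its Hopf structure, with the inverse of \<open>K\<close> as a
  parameter: in this form it can be instantiated a second time with \<open>E\<close>,
  \<open>F\<close> and \<open>K\<close>, \<open>Ki\<close> exchanged.\<close>

locale uq_algebra = root_of_unity l q for l q +
  fixes E F K Ki :: "'a::complex_algebra_1"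
  assumes E_pow: "E ^ l = 0" and F_pow: "F ^ l = 0" and K_pow: "K ^ l = 1"
    and K_Ki: "K * Ki = 1" and Ki_K: "Ki * K = 1"
    and KE: "K * E = q\<^sup>2 *\<^sub>C (E * K)"
    and KF: "K * F = (q powi (- 2)) *\<^sub>C (F * K)"
    and EF: "E * F - F * E = (1 / (q - inverse q)) *\<^sub>C (K - Ki)"
    and generated: "subalgebra_generated {E, F, K} = UNIV"
    and dimension: "cvs.dim (UNIV :: 'a set) = l ^ 3"
begin

definition dl :: complex where "dl = q - inverse q"

lemma dl_nz [simp]: "dl \<noteq> 0"
proof
  assume "dl = 0"
  then have "q * q = 1" by (simp add: dl_def field_simps)
  then have "q ^ 2 = 1" by (simp add: power2_eq_square)
  then show False using q_root l_ge by (auto simp: primitive_root_of_unity_def)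
qed

definition ch :: "int \<Rightarrow> complex" where "ch w = qp (2 * w) + qp (- 2 * w)"

lemma ch_neg: "ch (- w) = ch w" by (simp add: ch_def)

lemma periodic_ch: "periodic ch"
  unfolding ch_def[abs_def] using periodic_add[OF periodic_qp[of 2 0] periodic_qp[of "- 2" 0]] by simp

definition Kp :: "int \<Rightarrow> 'a" where "Kp j = K ^ nat (j mod int l)"

lemma periodic_Kp: "periodic Kp"
  by (rule periodicI) (simp add: Kp_def mod_eq_dvd_iff[symmetric])

lemma K_power_mod: "K ^ n = K ^ (n mod l)"
proof -
  have "K ^ n = K ^ (l * (n div l) + n mod l)" by simp
  then show ?thesis by (simp only: power_add power_mult K_pow) simp
qed

lemma Kp_of_nat: "Kp (int n) = K ^ n"
proof -
  have "nat (int n mod int l) = n mod l" by (metis nat_int zmod_int)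
  then show ?thesis using K_power_mod[of n] by (simp only: Kp_def)
qed

lemma Kp_add: "Kp (i + j) = Kp i * Kp j"
proof -
  have "Kp (i + j) = Kp (int (nat (i mod int l) + nat (j mod int l)))"
    by (rule periodicD[OF periodic_Kp]) (use l_pos in \<open>simp add: mod_eq_dvd_iff[symmetric] mod_simps\<close>)
  also have "\<dots> = Kp i * Kp j" by (simp only: Kp_of_nat power_add) (simp add: Kp_def)
  finally show ?thesis .
qed

lemma Kp_0 [simp]: "Kp 0 = 1" and Kp_1 [simp]: "Kp 1 = K"
  using Kp_of_nat[of 0] Kp_of_nat[of 1] by simp_all

lemma Kp_minus_1 [simp]: "Kp (- 1) = Ki"
proof -
  have "Kp (- 1) * K = 1" using Kp_add[of "- 1" 1] by simp
  then show ?thesis by (metis K_Ki mult.assoc mult.right_neutral mult_1)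
qed

lemma Kp_E: "Kp j * E = qp (2 * j) *\<^sub>C (E * Kp j)"
proof -
  have nat: "K ^ n * E = qp (2 * int n) *\<^sub>C (E * K ^ n)" for n
  proof (induction n)
    case 0
    then show ?case by (simp add: scaleC_one)
  next
    case (Suc n)
    have "K ^ Suc n * E = qp (2 * int n) *\<^sub>C (K * E * K ^ n)"
      by (simp add: mult.assoc Suc mult_scaleC_right)
    also have "\<dots> = qp (2 * int (Suc n)) *\<^sub>C (E * K ^ Suc n)"
      by (simp add: KE mult_scaleC_left scaleC_scaleC mult.assoc qp_add power_int_add distrib_left)
    finally show ?case .
  qed
  have "qp (2 * (j mod int l)) = qp (2 * j)"
    by (rule qp_cong) (simp add: mod_eq_dvd_iff[symmetric] mod_mult_right_eq)
  then show ?thesis using nat[of "nat (j mod int l)"] l_pos by (simp add: Kp_def)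
qed

lemma Kp_F: "Kp j * F = qp (- (2 * j)) *\<^sub>C (F * Kp j)"
proof -
  have nat: "K ^ n * F = qp (- (2 * int n)) *\<^sub>C (F * K ^ n)" for n
  proof (induction n)
    case 0
    then show ?case by (simp add: scaleC_one)
  next
    case (Suc n)
    have "K ^ Suc n * F = qp (- (2 * int n)) *\<^sub>C (K * F * K ^ n)"
      by (simp add: mult.assoc Suc mult_scaleC_right)
    also have "\<dots> = (qp (- (2 * int n)) * qp (- 2)) *\<^sub>C (F * K ^ Suc n)"
      by (simp add: KF mult_scaleC_left scaleC_scaleC mult.assoc)
    also have "qp (- (2 * int n)) * qp (- 2) = qp (- (2 * int (Suc n)))"
      by (simp only: qp_add[symmetric]) (simp add: algebra_simps)
    finally show ?case .
  qed
  have "qp (- (2 * (j mod int l))) = qp (- (2 * j))"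
    by (rule qp_cong) (simp add: mod_eq_dvd_iff[symmetric] mod_mult_right_eq mod_minus_cong)
  then show ?thesis using nat[of "nat (j mod int l)"] l_pos by (simp add: Kp_def)
qed

text \<open>The idempotent of \<open>K\<close>-weight \<open>q\<^sup>2\<^sup>w\<^sup>-\<^sup>1\<close>; the shift makes the Casimir eigenvalues symmetric in \<open>w\<close>.\<close>

definition pr :: "int \<Rightarrow> 'a"
  where "pr w = (1 / of_nat l) *\<^sub>C (\<Sum>j\<in>residues. qp (- ((2 * w - 1) * j)) *\<^sub>C Kp j)"

lemma periodic_pr: "periodic pr"
proof (rule periodicI)
  fix a b assume d: "int l dvd a - b"
  have "qp (- ((2 * a - 1) * j)) = qp (- ((2 * b - 1) * j))" for j
  proof (rule qp_cong)
    have "- ((2 * a - 1) * j) - - ((2 * b - 1) * j) = - 2 * j * (a - b)" by (simp add: algebra_simps)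
    then show "int l dvd - ((2 * a - 1) * j) - - ((2 * b - 1) * j)" using d by simp
  qed
  then show "pr a = pr b" by (simp add: pr_def)
qed

lemma Kp_pr: "Kp i * pr w = qp ((2 * w - 1) * i) *\<^sub>C pr w"
proof -
  define g where "g j = qp (- ((2 * w - 1) * j)) *\<^sub>C Kp j" for j
  have per: "periodic (\<lambda>j. qp (- ((2 * w - 1) * j)))"
    using periodic_qp[of "- (2 * w - 1)" 0] by (simp only: add_0_right mult_minus_left)
  have g: "periodic g"
  proof (rule periodicI)
    fix a b assume d: "int l dvd a - b"
    show "g a = g b"
      by (simp only: g_def periodicD[OF periodic_Kp d] periodicD[OF per d])
  qed
  have *: "qp (- ((2 * w - 1) * j)) *\<^sub>C (Kp i * Kp j) = qp ((2 * w - 1) * i) *\<^sub>C g (j + i)" for j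
    unfolding g_def by (simp add: Kp_add[symmetric] scaleC_scaleC qp_add[symmetric] algebra_simps)
  have "Kp i * pr w = (1 / of_nat l) *\<^sub>C (\<Sum>j\<in>residues. qp ((2 * w - 1) * i) *\<^sub>C g (j + i))"
    by (simp only: pr_def mult_scaleC_right sum_distrib_left *)
  also have "\<dots> = (1 / of_nat l) *\<^sub>C qp ((2 * w - 1) * i) *\<^sub>C (\<Sum>j\<in>residues. g j)"
    by (simp only: cvs.scale_sum_right[symmetric] sum_residues_shift[OF g])
  also have "\<dots> = qp ((2 * w - 1) * i) *\<^sub>C pr w"
    by (simp only: pr_def g_def scaleC_scaleC mult.commute)
  finally show ?thesis .
qed

lemma pr_Kp: "pr w * Kp i = qp ((2 * w - 1) * i) *\<^sub>C pr w"
proof -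
  have "pr w * Kp i = Kp i * pr w"
    by (simp add: pr_def mult_scaleC_left mult_scaleC_right sum_distrib_left sum_distrib_right
        Kp_add[symmetric] add.commute)
  then show ?thesis by (simp add: Kp_pr)
qed

lemma K_pr: "K * pr w = qp (2 * w - 1) *\<^sub>C pr w" and Ki_pr: "Ki * pr w = qp (1 - 2 * w) *\<^sub>C pr w"
  and pr_K: "pr w * K = qp (2 * w - 1) *\<^sub>C pr w" and pr_Ki: "pr w * Ki = qp (1 - 2 * w) *\<^sub>C pr w"
  using Kp_pr[of 1 w] Kp_pr[of "- 1" w] pr_Kp[of w 1] pr_Kp[of w "- 1"] by simp_all

lemma pr_pr: "pr u * pr w = (if int l dvd u - w then pr w else 0)"
proof -
  have "pr u * pr w = (1 / of_nat l) *\<^sub>C (\<Sum>j\<in>residues. qp (2 * (w - u) * j) *\<^sub>C pr w)"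
    unfolding pr_def[of u] mult_scaleC_left sum_distrib_right Kp_pr scaleC_scaleC qp_add[symmetric]
    by (simp add: algebra_simps)
  also have "\<dots> = (1 / of_nat l * (if int l dvd w - u then of_nat l else 0)) *\<^sub>C pr w"
    by (simp add: cvs.scale_sum_left[symmetric] sum_qp scaleC_scaleC dvd_2_mult dvd_2_mult_diff)
  finally show ?thesis by (simp add: dvd_diff_commute scaleC_one)
qed

lemma pr_idem: "pr w * pr w = pr w" by (simp add: pr_pr)

lemma sum_pr: "(\<Sum>w\<in>residues. pr w) = 1"
proof -
  have "(\<Sum>w\<in>residues. pr w)
    = (1 / of_nat l) *\<^sub>C (\<Sum>j\<in>residues. (\<Sum>w\<in>residues. qp (- ((2 * w - 1) * j))) *\<^sub>C Kp j)"
    unfolding pr_def cvs.scale_sum_right[symmetric] cvs.scale_sum_left by (subst sum.swap) simp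
  also have "(\<Sum>w\<in>residues. qp (- ((2 * w - 1) * j))) = (if j = 0 then of_nat l else 0)"
    if "j \<in> residues" for j
  proof -
    have "(\<Sum>w\<in>residues. qp (- ((2 * w - 1) * j))) = qp j * (\<Sum>w\<in>residues. qp ((2 * - j) * w))"
      unfolding sum_distrib_left qp_add[symmetric] by (simp add: algebra_simps)
    moreover have "int l dvd - j \<longleftrightarrow> j = 0" using that zdvd_imp_le[of "int l" j] by (cases "j = 0") auto
    ultimately show ?thesis by (simp only: sum_qp dvd_2_mult) simp
  qed
  then have "(\<Sum>j\<in>residues. (\<Sum>w\<in>residues. qp (- ((2 * w - 1) * j))) *\<^sub>C Kp j)
    = (\<Sum>j\<in>residues. if j = 0 then of_nat l *\<^sub>C Kp j else 0)" by (intro sum.cong) auto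
  finally show ?thesis using l_pos by (simp add: scaleC_scaleC scaleC_one)
qed

lemma E_pr: "E * pr w = pr (w + 1) * E"
proof -
  have "qp (- ((2 * w - 1) * j)) *\<^sub>C (E * Kp j) = qp (- ((2 * (w + 1) - 1) * j)) *\<^sub>C (Kp j * E)" for j
    unfolding Kp_E scaleC_scaleC qp_add[symmetric] by (simp add: algebra_simps)
  then show ?thesis by (simp add: pr_def mult_scaleC_left mult_scaleC_right sum_distrib_left sum_distrib_right)
qed

lemma F_pr: "F * pr w = pr (w - 1) * F"
proof -
  have "qp (- ((2 * w - 1) * j)) *\<^sub>C (F * Kp j) = qp (- ((2 * (w - 1) - 1) * j)) *\<^sub>C (Kp j * F)" for j
    unfolding Kp_F scaleC_scaleC qp_add[symmetric] by (simp add: algebra_simps)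
  then show ?thesis by (simp add: pr_def mult_scaleC_left mult_scaleC_right sum_distrib_left sum_distrib_right)
qed

lemma E_pow_pr: "E ^ n * pr w = pr (w + int n) * E ^ n"
proof (induction n)
  case (Suc n)
  have "E ^ Suc n * pr w = E * pr (w + int n) * E ^ n" by (simp add: mult.assoc Suc)
  then show ?case by (simp add: E_pr mult.assoc add.assoc add.commute[of 1])
qed simp

lemma F_pow_pr: "F ^ n * pr w = pr (w - int n) * F ^ n"
proof (induction n)
  case (Suc n)
  have "F ^ Suc n * pr w = F * pr (w - int n) * F ^ n" by (simp add: mult.assoc Suc)
  then show ?case by (simp add: F_pr mult.assoc diff_diff_eq add.commute[of 1])
qed simp

lemma E_pow_ge: "l \<le> n \<Longrightarrow> E ^ n = 0" and F_pow_ge: "l \<le> n \<Longrightarrow> F ^ n = 0"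
  by (metis E_pow le_add_diff_inverse mult_zero_left power_add)
    (metis F_pow le_add_diff_inverse mult_zero_left power_add)

text \<open>The Casimir element scaled by \<open>dl^2\<close>: wherever \<open>F * E\<close>
  vanishes on weight \<open>w\<close>, what remains is
  \<open>q * qp (2 * w - 1) + inverse q * qp (1 - 2 * w) = ch w\<close>.\<close>

definition C :: 'a where "C = dl\<^sup>2 *\<^sub>C (F * E) + q *\<^sub>C K + inverse q *\<^sub>C Ki"

lemma C_central: "C * x = x * C"
proof -
  have EK: "K * E = q\<^sup>2 *\<^sub>C (E * K)" "E * Ki = q\<^sup>2 *\<^sub>C (Ki * E)" "K * F = inverse (q\<^sup>2) *\<^sub>C (F * K)" "Ki * F = q\<^sup>2 *\<^sub>C (F * Ki)"
    using KE KF Kp_E[of "- 1"] Kp_F[of "- 1"]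
    by (simp_all add: power_int_minus power_int_def scaleC_scaleC scaleC_one power_inverse)
  have EF': "E * F = F * E + (1 / dl) *\<^sub>C K - (1 / dl) *\<^sub>C Ki"
    using EF by (simp add: dl_def algebra_simps cvs.scale_right_diff_distrib)
  have CE: "C * E = E * C"
  proof -
    have "E * C = dl\<^sup>2 *\<^sub>C (E * F * E) + q *\<^sub>C (E * K) + inverse q *\<^sub>C (E * Ki)"
      by (simp add: C_def algebra_simps mult_scaleC_right mult.assoc)
    also have "\<dots> = dl\<^sup>2 *\<^sub>C (F * E * E) + (dl * q\<^sup>2 + q) *\<^sub>C (E * K) + (inverse q * q\<^sup>2 - dl) *\<^sub>C (Ki * E)"
      unfolding EF'
      by (simp add: algebra_simps mult_scaleC_left mult_scaleC_right mult.assoc EK scaleC_scaleC scaleC_add_right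
          scaleC_add_left cvs.scale_left_diff_distrib cvs.scale_right_diff_distrib power2_eq_square)
    also have "dl * q\<^sup>2 + q = q * q\<^sup>2" by (simp add: dl_def field_simps power2_eq_square)
    also have "inverse q * q\<^sup>2 - dl = inverse q" by (simp add: dl_def field_simps power2_eq_square)
    finally show ?thesis
      by (simp add: C_def algebra_simps mult_scaleC_left mult.assoc EK scaleC_scaleC)
  qed
  have CF: "C * F = F * C"
  proof -
    have "C * F = dl\<^sup>2 *\<^sub>C (F * (E * F)) + q *\<^sub>C (K * F) + inverse q *\<^sub>C (Ki * F)"
      by (simp add: C_def algebra_simps mult_scaleC_left mult.assoc)
    also have "\<dots> = dl\<^sup>2 *\<^sub>C (F * F * E) + (dl + q * inverse (q\<^sup>2)) *\<^sub>C (F * K) + (inverse q * q\<^sup>2 - dl) *\<^sub>C (F * Ki)"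
      unfolding EF'
      by (simp add: algebra_simps mult_scaleC_left mult_scaleC_right mult.assoc EK scaleC_scaleC scaleC_add_right
          scaleC_add_left cvs.scale_left_diff_distrib cvs.scale_right_diff_distrib power2_eq_square)
    also have "dl + q * inverse (q\<^sup>2) = q" by (simp add: dl_def field_simps power2_eq_square)
    also have "inverse q * q\<^sup>2 - dl = inverse q" by (simp add: dl_def field_simps power2_eq_square)
    finally show ?thesis
      by (simp add: C_def algebra_simps mult_scaleC_right mult.assoc)
  qed
  have CK: "C * K = K * C"
  proof -
    have "K * (F * E) = F * E * K"
      by (simp add: mult.assoc[symmetric] EK mult_scaleC_left) 
        (simp add: mult.assoc EK mult_scaleC_right scaleC_scaleC scaleC_one)
    then show ?thesis
      by (simp add: C_def algebra_simps mult_scaleC_left mult_scaleC_right K_Ki Ki_K mult.assoc)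
  qed
  have "x \<in> subalgebra_generated {E, F, K}" by (simp add: generated)
  then show ?thesis
  proof (induction rule: subalgebra_generated.induct)
    case (mult x y)
    then show ?case by (metis mult.assoc)
  qed (auto simp: CE CF CK mult_scaleC_left mult_scaleC_right distrib_left distrib_right)
qed

abbreviation ev :: "complex poly \<Rightarrow> 'a" where "ev \<equiv> alg_eval C"

lemma ev_central: "x * ev p = ev p * x"
  by (rule alg_eval_commute) (simp add: C_central)

lemma ev_left_commute: "x * (ev p * y) = ev p * (x * y)"
  by (metis ev_central mult.assoc)

abbreviation nd :: "int \<Rightarrow> complex poly" where "nd w \<equiv> [:- ch w, 1:]"

lemma ev_nd: "ev (nd w) = C - ch w *\<^sub>C 1"
  by (simp add: scaleC_one)

lemma FE_pr: "F * E * pr w = (1 / dl\<^sup>2) *\<^sub>C (ev (nd w) * pr w)"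
proof -
  have "ev (nd w) * pr w = dl\<^sup>2 *\<^sub>C (F * E * pr w) + q *\<^sub>C (K * pr w) + inverse q *\<^sub>C (Ki * pr w) - ch w *\<^sub>C pr w"
    unfolding ev_nd C_def by (simp add: algebra_simps mult_scaleC_left)
  also have "\<dots> = dl\<^sup>2 *\<^sub>C (F * E * pr w) + (q * qp (2 * w - 1) + inverse q * qp (1 - 2 * w) - ch w) *\<^sub>C pr w"
    by (simp add: K_pr Ki_pr scaleC_scaleC scaleC_add_left cvs.scale_left_diff_distrib)
  also have "q * qp (2 * w - 1) + inverse q * qp (1 - 2 * w) - ch w = 0"
    by (simp add: ch_def power_int_diff power_int_minus field_simps)
  finally show ?thesis by (simp add: scaleC_scaleC scaleC_one)
qed

lemma EF_pr: "E * F * pr w = (1 / dl\<^sup>2) *\<^sub>C (ev (nd (w - 1)) * pr w)"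
proof -
  have "E * F * pr w = F * E * pr w + (1 / dl) *\<^sub>C (K * pr w) - (1 / dl) *\<^sub>C (Ki * pr w)"
  proof -
    have "E * F = F * E + (1 / dl) *\<^sub>C K - (1 / dl) *\<^sub>C Ki"
      using EF by (simp add: dl_def algebra_simps cvs.scale_right_diff_distrib)
    then show ?thesis by (simp add: distrib_right left_diff_distrib mult_scaleC_left)
  qed
  also have "\<dots> = (1 / dl\<^sup>2) *\<^sub>C (ev (nd w) * pr w + (dl * qp (2 * w - 1) - dl * qp (1 - 2 * w)) *\<^sub>C pr w)"
    by (simp add: FE_pr K_pr Ki_pr scaleC_scaleC scaleC_add_left scaleC_add_right
        cvs.scale_left_diff_distrib cvs.scale_right_diff_distrib power2_eq_square)
  also have "dl * qp (2 * w - 1) - dl * qp (1 - 2 * w) = ch w - ch (w - 1)"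
  proof -
    have "dl = qp 1 - qp (- 1)" by (simp add: dl_def power_int_minus)
    then show ?thesis
      by (simp only: left_diff_distrib qp_add[symmetric] ch_def) (simp add: algebra_simps)
  qed
  also have "ev (nd w) * pr w + (ch w - ch (w - 1)) *\<^sub>C pr w = ev (nd (w - 1)) * pr w"
    unfolding ev_nd by (simp add: algebra_simps mult_scaleC_left cvs.scale_left_diff_distrib)
  finally show ?thesis .
qed

definition up_nodes :: "nat \<Rightarrow> int \<Rightarrow> complex poly"
  where "up_nodes m w = (\<Prod>i<m. nd (w + int i))"

text \<open>The nodes start at \<open>w - 1\<close> and not at \<open>w\<close>: on weight
  \<open>w\<close> the element \<open>F * E\<close> is \<open>C - ch w\<close> up to scale, but
  \<open>E * F\<close> is \<open>C - ch (w - 1)\<close>.\<close>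

definition down_nodes :: "nat \<Rightarrow> int \<Rightarrow> complex poly"
  where "down_nodes m w = (\<Prod>i<m. nd (w - 1 - int i))"

lemma up_nodes_Suc: "up_nodes (Suc m) w = nd (w + int m) * up_nodes m w"
  by (simp only: up_nodes_def prod.lessThan_Suc mult.commute)

lemma down_nodes_Suc: "down_nodes (Suc m) w = nd (w - 1 - int m) * down_nodes m w"
  by (simp only: down_nodes_def prod.lessThan_Suc mult.commute)

lemma FE_pow_pr: "F ^ m * E ^ m * pr w = (1 / dl ^ (2 * m)) *\<^sub>C (ev (up_nodes m w) * pr w)"
proof (induction m)
  case 0
  then show ?case by (simp add: up_nodes_def scaleC_one)
next
  case (Suc m)
  have "F ^ Suc m * E ^ Suc m * pr w = F ^ m * (F * E * (E ^ m * pr w))"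
    unfolding power_Suc2[of F] power_Suc[of E] by (simp add: mult.assoc)
  also have "\<dots> = F ^ m * (F * E * pr (w + int m)) * E ^ m"
    by (simp only: E_pow_pr mult.assoc)
  also have "\<dots> = (1 / dl\<^sup>2) *\<^sub>C (ev (nd (w + int m)) * (F ^ m * E ^ m * pr w))"
    unfolding FE_pr mult_scaleC_left mult_scaleC_right
    by (simp only: ev_left_commute mult.assoc E_pow_pr)
  also have "\<dots> = (1 / dl ^ (2 * Suc m)) *\<^sub>C (ev (up_nodes (Suc m) w) * pr w)"
    unfolding Suc mult_scaleC_right scaleC_scaleC up_nodes_Suc alg_eval_mult mult.assoc[symmetric]
    by (simp add: power2_eq_square del: alg_eval_pCons)
  finally show ?case .
qed

lemma EF_pow_pr: "E ^ m * F ^ m * pr w = (1 / dl ^ (2 * m)) *\<^sub>C (ev (down_nodes m w) * pr w)"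
proof (induction m)
  case 0
  then show ?case by (simp add: down_nodes_def scaleC_one)
next
  case (Suc m)
  have "E ^ Suc m * F ^ Suc m * pr w = E ^ m * (E * F * (F ^ m * pr w))"
    unfolding power_Suc2[of E] power_Suc[of F] by (simp add: mult.assoc)
  also have "\<dots> = E ^ m * (E * F * pr (w - int m)) * F ^ m"
    by (simp only: F_pow_pr mult.assoc)
  also have "\<dots> = (1 / dl\<^sup>2) *\<^sub>C (ev (nd (w - 1 - int m)) * (E ^ m * F ^ m * pr w))"
  proof -
    have *: "w - int m - 1 = w - 1 - int m" by simp
    show ?thesis
      unfolding EF_pr mult_scaleC_left mult_scaleC_right
      by (simp only: * ev_left_commute mult.assoc F_pow_pr)
  qed
  also have "\<dots> = (1 / dl ^ (2 * Suc m)) *\<^sub>C (ev (down_nodes (Suc m) w) * pr w)"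
    unfolding Suc mult_scaleC_right scaleC_scaleC down_nodes_Suc alg_eval_mult mult.assoc[symmetric]
    by (simp add: power2_eq_square del: alg_eval_pCons)
  finally show ?case .
qed

section \<open>The Poincare-Birkhoff-Witt basis\<close>

definition pbw :: "nat \<times> nat \<times> int \<Rightarrow> 'a"
  where "pbw = (\<lambda>(m, n, w). F ^ m * E ^ n * pr w)"

definition pbw_index :: "(nat \<times> nat \<times> int) set"
  where "pbw_index = {..<l} \<times> {..<l} \<times> residues"

lemma pbw_in_span: "F ^ m * E ^ n * pr w \<in> cvs.span (pbw ` pbw_index)"
proof (cases "m < l \<and> n < l")
  case True
  have "pr w = pr (w mod int l)" by (simp add: periodic_mod[OF periodic_pr])
  moreover have "(m, n, w mod int l) \<in> pbw_index" using True l_pos by (simp add: pbw_index_def)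
  ultimately have "F ^ m * E ^ n * pr w \<in> pbw ` pbw_index"
    by (intro image_eqI[of _ _ "(m, n, w mod int l)"]) (simp_all add: pbw_def)
  then show ?thesis by (rule cvs.span_base)
next
  case False
  then have "F ^ m * E ^ n * pr w = 0" using E_pow_ge[of n] F_pow_ge[of m] by auto
  then show ?thesis by (simp add: cvs.span_zero)
qed

text \<open>The span contains 1 and is stable under left multiplication by the generators. Only
  \<open>E\<close> has to be moved past a power of \<open>F\<close>.\<close>

lemma span_pbw: "cvs.span (pbw ` pbw_index) = UNIV"
proof -
  let ?T = "cvs.span (pbw ` pbw_index)"
  have ind: "x * y \<in> ?T" if gen: "\<And>i. i \<in> pbw_index \<Longrightarrow> x * pbw i \<in> ?T" and y: "y \<in> ?T" for x y
    using y
  proof (induction rule: cvs.span_induct_alt)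
    case base
    then show ?case by (simp add: cvs.span_zero)
  next
    case (step c z y)
    then show ?case using gen
      by (auto simp: distrib_left mult_scaleC_right intro!: cvs.span_add cvs.span_scale)
  qed
  have F: "F * y \<in> ?T" if "y \<in> ?T" for y
  proof (rule ind[OF _ that])
    fix i assume "i \<in> pbw_index"
    then show "F * pbw i \<in> ?T"
      using pbw_in_span[of "Suc (fst i)"] by (auto simp: pbw_def mult.assoc split: prod.splits)
  qed
  have K: "K * y \<in> ?T" if "y \<in> ?T" for y
  proof (rule ind[OF _ that])
    fix i assume i: "i \<in> pbw_index"
    obtain m n w where i': "i = (m, n, w)" by (cases i)
    have "K * pbw i = K * pr (w + int n - int m) * F ^ m * E ^ n"
      unfolding i' pbw_def by (simp only: prod.case mult.assoc E_pow_pr) (simp only: mult.assoc[symmetric] F_pow_pr)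
    also have "\<dots> = qp (2 * (w + int n - int m) - 1) *\<^sub>C pbw i"
      unfolding i' pbw_def K_pr mult_scaleC_left
      by (simp only: prod.case mult.assoc E_pow_pr) (simp only: mult.assoc[symmetric] F_pow_pr)
    finally show "K * pbw i \<in> ?T" using i by (simp add: cvs.span_base cvs.span_scale)
  qed
  have E: "E * y \<in> ?T" if "y \<in> ?T" for y
  proof (rule ind[OF _ that])
    fix i assume i: "i \<in> pbw_index"
    obtain m n w where i': "i = (m, n, w)" by (cases i)
    show "E * pbw i \<in> ?T"
    proof (cases m)
      case 0
      then show ?thesis using pbw_in_span[of 0 "Suc n" w] by (simp add: i' pbw_def mult.assoc)
    next
      case (Suc k)
      let ?x = "F ^ k * E ^ n * pr w"
      have x: "?x = pr (w + int n - int k) * F ^ k * E ^ n"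
        by (simp only: mult.assoc E_pow_pr) (simp only: mult.assoc[symmetric] F_pow_pr)
      \<comment> \<open>On a weight space \<open>E * F\<close> is \<open>C\<close> minus a scalar.
        The central \<open>C\<close> then passes to the inner weight space, where \<open>C\<close>
        minus another scalar is \<open>F * E\<close> again, now in PBW order.\<close>
      have "E * pbw i = E * F * ?x" by (simp add: i' pbw_def Suc mult.assoc)
      also have "\<dots> = E * F * pr (w + int n - int k) * F ^ k * E ^ n"
        unfolding x by (simp add: mult.assoc)
      also have "\<dots> = (1 / dl\<^sup>2) *\<^sub>C (ev (nd (w + int n - int k - 1)) * ?x)"
        unfolding EF_pr x by (simp add: mult_scaleC_left mult.assoc)
      also have "\<dots> = (1 / dl\<^sup>2) *\<^sub>C (C * ?x - ch (w + int n - int k - 1) *\<^sub>C ?x)"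
        by (simp add: ev_nd left_diff_distrib mult_scaleC_left)
      also have "C * ?x = ev (nd (w + int n)) * ?x + ch (w + int n) *\<^sub>C ?x"
        by (simp add: ev_nd left_diff_distrib mult_scaleC_left)
      also have "ev (nd (w + int n)) * ?x = dl\<^sup>2 *\<^sub>C (F ^ Suc k * E ^ Suc n * pr w)"
      proof -
        have "F ^ Suc k * E ^ Suc n * pr w = F ^ k * (F * E * (E ^ n * pr w))"
          unfolding power_Suc2[of F] power_Suc[of E] by (simp only: mult.assoc)
        also have "\<dots> = F ^ k * (F * E * pr (w + int n)) * E ^ n"
          by (simp only: E_pow_pr mult.assoc)
        also have "\<dots> = (1 / dl\<^sup>2) *\<^sub>C (ev (nd (w + int n)) * ?x)"
          unfolding FE_pr mult_scaleC_left mult_scaleC_right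
          by (simp only: ev_left_commute mult.assoc E_pow_pr)
        finally show ?thesis by (simp add: scaleC_scaleC scaleC_one)
      qed
      finally have eq: "E * pbw i = (1 / dl\<^sup>2) *\<^sub>C (dl\<^sup>2 *\<^sub>C (F ^ Suc k * E ^ Suc n * pr w)
          + ch (w + int n) *\<^sub>C ?x - ch (w + int n - int k - 1) *\<^sub>C ?x)" .
      show ?thesis unfolding eq
        by (intro cvs.span_add cvs.span_scale cvs.span_diff pbw_in_span)
    qed
  qed
  have all: "\<forall>y\<in>?T. x * y \<in> ?T" for x
  proof -
    have "x \<in> subalgebra_generated {E, F, K}" by (simp add: generated)
    then show ?thesis
    proof (induction rule: subalgebra_generated.induct)
      case (scale x c)
      then show ?case by (auto simp: mult_scaleC_left intro: cvs.span_scale)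
    next
      case (add x y)
      then show ?case by (auto simp: distrib_right intro: cvs.span_add)
    next
      case (mult x y)
      then show ?case by (auto simp: mult.assoc)
    qed (use E F K in auto)
  qed
  have "(1::'a) \<in> ?T"
  proof -
    have "pr w \<in> ?T" for w using pbw_in_span[of 0 0 w] by simp
    then show ?thesis unfolding sum_pr[symmetric] by (intro cvs.span_sum) auto
  qed
  then show ?thesis using all by (metis UNIV_eq_I mult.right_neutral)
qed

lemma card_pbw_index: "card pbw_index = l ^ 3"
  by (simp add: pbw_index_def card_cartesian_product power3_eq_cube)

lemma finite_pbw_index: "finite pbw_index"
  by (simp add: pbw_index_def)

lemma inj_pbw: "inj_on pbw pbw_index"
proof (rule eq_card_imp_inj_on[OF finite_pbw_index])
  have "l ^ 3 \<le> card (pbw ` pbw_index)"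
    using cvs.dim_le_card[of UNIV "pbw ` pbw_index"] by (simp add: span_pbw dimension finite_pbw_index)
  then show "card (pbw ` pbw_index) = card pbw_index"
    using card_image_le[OF finite_pbw_index, of pbw] by (simp add: card_pbw_index)
qed

text \<open>A spanning set with no more elements than the dimension cannot lose an element, so the
  assumed dimension forces independence.\<close>

lemma independent_pbw: "cvs.independent (pbw ` pbw_index)"
proof
  assume "cvs.dependent (pbw ` pbw_index)"
  then obtain b where b: "b \<in> pbw ` pbw_index" "b \<in> cvs.span (pbw ` pbw_index - {b})"
    by (auto simp: cvs.dependent_def)
  have "cvs.span (pbw ` pbw_index - {b}) = UNIV"
    using cvs.span_redundant[OF b(2)] b(1) span_pbw by (simp add: insert_absorb)
  then have "l ^ 3 \<le> card (pbw ` pbw_index - {b})"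
    using cvs.dim_le_card[of UNIV "pbw ` pbw_index - {b}"] by (simp add: dimension finite_pbw_index)
  moreover have "card (pbw ` pbw_index - {b}) < l ^ 3"
    using card_image[OF inj_pbw] b(1) finite_pbw_index by (metis card_Diff1_less card_pbw_index finite_imageI)
  ultimately show False by simp
qed

text \<open>Dual basis. Quantum traces and Drinfeld preimages are prescribed by their values on the
  PBW basis.\<close>

lemma functional_exists:
  "\<exists>\<beta> :: 'a \<Rightarrow> complex. clinear \<beta> \<and>
    (\<forall>m<l. \<forall>n<l. \<forall>w\<in>residues. \<beta> (F ^ m * E ^ n * pr w) = g m n w)"
proof -
  have V: "vector_space_pair (scaleC :: complex \<Rightarrow> 'a \<Rightarrow> 'a) (scaleC :: complex \<Rightarrow> complex \<Rightarrow> complex)" by standard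
  define h where "h x = (case inv_into pbw_index pbw x of (m, n, w) \<Rightarrow> g m n w)" for x
  obtain \<beta> :: "'a \<Rightarrow> complex" where \<beta>: "clinear \<beta>" "\<And>x. x \<in> pbw ` pbw_index \<Longrightarrow> \<beta> x = h x"
    using vector_space_pair.linear_independent_extend[OF V independent_pbw, of h] by auto
  have "\<beta> (F ^ m * E ^ n * pr w) = g m n w" if "m < l" "n < l" "w \<in> residues" for m n w
  proof -
    have i: "(m, n, w) \<in> pbw_index" using that by (simp add: pbw_index_def)
    have "h (pbw (m, n, w)) = g m n w"
      unfolding h_def inv_into_f_f[OF inj_pbw i] by simp
    then have "\<beta> (pbw (m, n, w)) = g m n w" using \<beta>(2)[of "pbw (m, n, w)"] i by simp
    then show ?thesis by (simp only: pbw_def prod.case)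
  qed
  then show ?thesis using \<beta>(1) by blast
qed

lemma pbw_induct [case_names add scale pbw]:
  assumes "\<And>x y. P x \<Longrightarrow> P y \<Longrightarrow> P (x + y)" "\<And>c x. P x \<Longrightarrow> P (c *\<^sub>C x)"
    and "\<And>m n w. m < l \<Longrightarrow> n < l \<Longrightarrow> P (F ^ m * E ^ n * pr w)"
  shows "P x"
proof -
  have "x \<in> cvs.span (pbw ` pbw_index)" by (simp add: span_pbw)
  then show ?thesis
  proof (induction rule: cvs.span_induct_alt)
    case base
    have "P (0 *\<^sub>C (F ^ 0 * E ^ 0 * pr 0))" using l_ge by (intro assms(2,3)) auto
    then show ?case by simp
  next
    case (step c x y)
    then show ?case by (auto simp: pbw_def pbw_index_def intro!: assms)
  qed
qed

lemma pbw_zero: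
  assumes "(\<Sum>m<l. \<Sum>n<l. \<Sum>w\<in>residues. a m n w *\<^sub>C (F ^ m * E ^ n * pr w)) = 0"
    and i: "i < l" "j < l" "u \<in> residues"
  shows "a i j u = 0"
proof -
  obtain \<beta> :: "'a \<Rightarrow> complex" where \<beta>: "clinear \<beta>"
    "\<And>m n w. m < l \<Longrightarrow> n < l \<Longrightarrow> w \<in> residues \<Longrightarrow>
      \<beta> (F ^ m * E ^ n * pr w) = (if w = u then if n = j then if m = i then 1 else 0 else 0 else 0)"
    using functional_exists[of "\<lambda>m n w. if w = u then if n = j then if m = i then 1 else 0 else 0 else 0"] by blast
  have "0 = (\<Sum>m<l. \<Sum>n<l. \<Sum>w\<in>residues. a m n w * \<beta> (F ^ m * E ^ n * pr w))"
  proof -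
    have "\<beta> (\<Sum>m<l. \<Sum>n<l. \<Sum>w\<in>residues. a m n w *\<^sub>C (F ^ m * E ^ n * pr w)) = 0"
      using assms(1) clinear_zero[OF \<beta>(1)] by simp
    then show ?thesis by (simp only: clinear_sum[OF \<beta>(1)] clinear_scale_complex[OF \<beta>(1)])
  qed
  also have "\<dots> = (\<Sum>m<l. \<Sum>n<l. \<Sum>w\<in>residues. if w = u then if n = j then if m = i then a m n w else 0 else 0 else 0)"
    by (intro sum.cong refl) (simp add: \<beta>(2))
  also have "\<dots> = (\<Sum>m<l. \<Sum>n<l. if n = j then if m = i then a m n u else 0 else 0)"
    using i by (intro sum.cong refl) simp
  also have "\<dots> = (\<Sum>m<l. if m = i then a m j u else 0)"
    using i by (intro sum.cong refl) simp
  finally show ?thesis using i by simp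
qed

end

lemma mult_const_poly: "p * [:c:] = smult c p" "[:c:] * p = smult c p" for p :: "'b::comm_ring_1 poly"
  by simp_all

lemma interpolation_poly:
  assumes "finite (X :: 'b::field set)"
  shows "\<exists>p. \<forall>x\<in>X. poly p x = g x"
  using assms
proof (induction X rule: finite_induct)
  case (insert x X)
  then obtain p where p: "\<forall>y\<in>X. poly p y = g y" by blast
  define P where "P = (\<Prod>y\<in>X. [:- y, 1:])"
  have "poly P x \<noteq> 0" using insert by (simp add: P_def poly_prod)
  moreover have "poly P y = 0" if "y \<in> X" for y
    using that insert(1) by (auto simp: P_def poly_prod intro!: prod_zero bexI[of _ y])
  ultimately have "\<forall>y\<in>insert x X. poly (p + smult ((g x - poly p x) / poly P x) P) y = g y"
    using p by auto
  then show ?case by blast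
qed simp

context root_of_unity
begin

lemma prod_residues_shift:
  fixes f :: "int \<Rightarrow> 'b::comm_monoid_mult"
  assumes "periodic f"
  shows "(\<Prod>i<l. f (a + int i)) = (\<Prod>w\<in>residues. f w)"
proof -
  have "(\<Prod>i<l. f (a + int i)) = (\<Prod>w\<in>residues. f ((w + a) mod int l))"
    unfolding periodic_mod[OF assms]
    by (rule prod.reindex_bij_witness[where j = int and i = nat]) (auto simp: add.commute)
  also have "\<dots> = (\<Prod>w\<in>residues. f w)"
    by (rule prod.reindex_bij_betw[OF bij_betw_add_mod[OF l_pos]])
  finally show ?thesis .
qed

end

context uq_algebra
begin

section \<open>Products over Casimir eigenvalues\<close>

text \<open>The difference factors as a product of two terms \<open>qp x - qp (- x)\<close> with
  \<open>x = a + b\<close> and \<open>x = a - b\<close>; each vanishes only for multiples of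
  \<open>l\<close>, as 2 is invertible.\<close>

lemma ch_eq_iff: "ch a = ch b \<longleftrightarrow> int l dvd a - b \<or> int l dvd a + b"
proof -
  have "ch a - ch b = (qp (a + b) - qp (- (a + b))) * (qp (a - b) - qp (- (a - b)))"
    unfolding left_diff_distrib right_diff_distrib qp_add[symmetric] ch_def by (simp add: algebra_simps)
  moreover have "qp x - qp (- x) = 0 \<longleftrightarrow> int l dvd x" for x
  proof -
    have "qp x - qp (- x) = 0 \<longleftrightarrow> int l dvd x - - x" unfolding right_minus_eq by (rule qp_eq_iff)
    then show ?thesis using dvd_2_mult[of x] by simp
  qed
  ultimately show ?thesis by (metis mult_eq_0_iff right_minus_eq)
qed

lemma periodic_nd: "periodic nd"
  by (rule periodicI) (simp add: periodicD[OF periodic_ch])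

lemma nd_neq_0 [simp]: "nd w \<noteq> 0" by simp

lemma up_nodes_Suc_shift: "up_nodes (Suc m) w = nd w * up_nodes m (w + 1)"
  unfolding up_nodes_def prod.lessThan_Suc_shift by (simp add: add.assoc add.commute[of 1])

lemma down_nodes_eq: "down_nodes m w = up_nodes m (w - int m)"
proof (induction m)
  case 0
  then show ?case by (simp add: up_nodes_def down_nodes_def)
next
  case (Suc m)
  have "w - int (Suc m) + 1 = w - int m" "w - 1 - int m = w - int (Suc m)" by simp_all
  then show ?case by (simp only: down_nodes_Suc up_nodes_Suc_shift Suc)
qed

lemma nodes_0 [simp]: "up_nodes 0 w = 1" "down_nodes 0 w = 1"
  by (simp_all add: up_nodes_def down_nodes_def)

lemma up_nodes_add: "up_nodes (a + b) w = up_nodes a w * up_nodes b (w + int a)"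
proof (induction b)
  case 0
  then show ?case by (simp add: up_nodes_def)
next
  case (Suc b)
  have "w + int a + int b = w + int (a + b)" by simp
  then show ?case by (simp only: add_Suc_right up_nodes_Suc Suc mult.left_commute)
qed

lemma periodic_up_nodes: "periodic (up_nodes m)"
  unfolding up_nodes_def[abs_def]
  by (intro periodicI prod.cong refl periodicD[OF periodic_nd]) simp

definition Psi :: "complex poly" where "Psi = (\<Prod>w\<in>residues. nd w)"

text \<open>The cofactor of \<open>nd k\<close> in \<open>Psi\<close>, written as the product over
  \<open>k + 1, ..., k + l - 1\<close>, so that no polynomial division occurs.\<close>

definition Psi_at :: "int \<Rightarrow> complex poly" where "Psi_at k = up_nodes (l - 1) (k + 1)"

lemma up_nodes_l: "up_nodes l w = Psi"
  unfolding up_nodes_def Psi_def by (rule prod_residues_shift[OF periodic_nd])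

lemma down_nodes_l: "down_nodes l w = Psi"
  by (simp add: down_nodes_eq up_nodes_l)

lemma nd_Psi_at: "nd k * Psi_at k = Psi"
proof -
  have "nd k * Psi_at k = up_nodes (Suc (l - 1)) k" by (simp only: Psi_at_def up_nodes_Suc_shift)
  then show ?thesis using l_ge by (simp add: up_nodes_l)
qed

lemma Psi_at_neg: "Psi_at (- k) = Psi_at k"
proof -
  have "nd k * Psi_at (- k) = nd k * Psi_at k" using nd_Psi_at[of k] nd_Psi_at[of "- k"] by (simp add: ch_neg)
  then show ?thesis by (simp only: mult_cancel_left nd_neq_0) simp
qed

lemma periodic_Psi_at: "periodic Psi_at"
  unfolding Psi_at_def[abs_def] by (intro periodicI periodicD[OF periodic_up_nodes]) simp

lemma poly_Psi: "poly Psi (ch j) = 0"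
  by (simp flip: nd_Psi_at[of j])

text \<open>The nodes \<open>w, ..., w + a - 1\<close> together with the \<open>l - 1 - a\<close>
  nodes below \<open>w\<close> are consecutive and, modulo \<open>l\<close>, omit exactly
  \<open>w + a\<close>.\<close>

lemma missing_node:
  assumes "a < l"
  shows "up_nodes a w * down_nodes (l - 1 - a) w = Psi_at (w + int a)"
proof -
  let ?b = "l - 1 - a"
  have "nd (w + int a) * (up_nodes a w * down_nodes ?b w) = up_nodes ?b (w - int ?b) * up_nodes (Suc a) w"
    by (simp only: up_nodes_Suc down_nodes_eq mult.assoc mult.left_commute mult.commute)
  also have "\<dots> = up_nodes (?b + Suc a) (w - int ?b)"
    using up_nodes_add[of ?b "Suc a" "w - int ?b"] by (simp only: diff_add_cancel)
  also have "?b + Suc a = l" using assms by simp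
  also have "up_nodes l (w - int ?b) = nd (w + int a) * Psi_at (w + int a)" by (simp only: up_nodes_l nd_Psi_at)
  finally show ?thesis by (simp only: mult_cancel_left nd_neq_0) simp
qed

lemma telescope_lessThan:
  fixes f :: "nat \<Rightarrow> 'b::ab_group_add"
  shows "(\<Sum>k<n. f k - f (Suc k)) = f 0 - f n"
  by (induction n) simp_all

text \<open>\<open>Psi_at j\<close> is the divided difference of \<open>Psi\<close> at its root
  \<open>ch j\<close>. Replacing the variable by \<open>ch j\<close> in one factor of
  \<open>Psi\<close> after another makes the difference telescope.\<close>

lemma divided_difference_up:
  "(\<Sum>k<l. smult (poly (down_nodes k w) (ch j)) (up_nodes (l - 1 - k) w)) = Psi_at j"
proof -
  define g where "g k = smult (poly (down_nodes k w) (ch j)) (up_nodes (l - k) w)" for k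
  have "nd j * smult (poly (down_nodes k w) (ch j)) (up_nodes (l - 1 - k) w) = g k - g (Suc k)" if "k < l" for k
  proof -
    let ?x = "ch (w - 1 - int k)"
    let ?D = "poly (down_nodes k w) (ch j)"
    \<comment> \<open>The uppermost of the \<open>l - k\<close> nodes is, modulo \<open>l\<close>,
      the next node below \<open>w\<close>; the factor thus passes from one product to the
      other.\<close>
    have "nd (w + int (l - 1 - k)) = nd (w - 1 - int k)"
      using that by (intro periodicD[OF periodic_nd]) (simp add: of_nat_diff)
    moreover have "l - k = Suc (l - 1 - k)" using that by simp
    ultimately have U: "up_nodes (l - k) w = nd (w - 1 - int k) * up_nodes (l - 1 - k) w"
      by (simp only: up_nodes_Suc)
    have D: "poly (down_nodes (Suc k) w) (ch j) = (ch j - ?x) * ?D"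
      by (simp add: down_nodes_Suc algebra_simps)
    have nd: "nd j = nd (w - 1 - int k) - [:ch j - ?x:]" by simp
    show ?thesis unfolding g_def U D nd
      using that by (simp add: left_diff_distrib algebra_simps smult_add_right smult_diff_left smult_diff_right del: pCons_0_0)
  qed
  then have "nd j * (\<Sum>k<l. smult (poly (down_nodes k w) (ch j)) (up_nodes (l - 1 - k) w)) = (\<Sum>k<l. g k - g (Suc k))"
    unfolding sum_distrib_left by (intro sum.cong) auto
  also have "\<dots> = g 0 - g l" by (rule telescope_lessThan)
  also have "\<dots> = Psi" by (simp add: g_def down_nodes_l up_nodes_l poly_Psi)
  also have "\<dots> = nd j * Psi_at j" by (simp only: nd_Psi_at)
  finally show ?thesis by (simp only: mult_cancel_left nd_neq_0) simp
qed

text \<open>The same telescoping with the two products exchanged; the boundary terms change places,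
  which accounts for the sign.\<close>

lemma divided_difference_down:
  "(\<Sum>m<l. smult (poly (up_nodes (l - 1 - m) w) (ch k)) (down_nodes m w)) = Psi_at k"
proof -
  define g where "g m = smult (poly (up_nodes (l - m) w) (ch k)) (down_nodes m w)" for m
  have "nd k * smult (poly (up_nodes (l - 1 - m) w) (ch k)) (down_nodes m w) = - (g m - g (Suc m))" if "m < l" for m
  proof -
    let ?x = "ch (w - 1 - int m)"
    let ?U = "poly (up_nodes (l - 1 - m) w) (ch k)"
    have "nd (w + int (l - 1 - m)) = nd (w - 1 - int m)"
      using that by (intro periodicD[OF periodic_nd]) (simp add: of_nat_diff)
    moreover have "l - m = Suc (l - 1 - m)" using that by simp
    ultimately have U0: "up_nodes (l - m) w = nd (w - 1 - int m) * up_nodes (l - 1 - m) w"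
      by (simp only: up_nodes_Suc)
    have U: "poly (up_nodes (l - m) w) (ch k) = (ch k - ?x) * ?U"
      by (simp only: U0 poly_mult) (simp add: algebra_simps)
    have D: "down_nodes (Suc m) w = nd (w - 1 - int m) * down_nodes m w" by (rule down_nodes_Suc)
    have nd: "nd k = nd (w - 1 - int m) - [:ch k - ?x:]" by simp
    show ?thesis unfolding g_def U D nd
      using that by (simp add: left_diff_distrib algebra_simps smult_add_right smult_diff_left smult_diff_right del: pCons_0_0)
  qed
  then have "nd k * (\<Sum>m<l. smult (poly (up_nodes (l - 1 - m) w) (ch k)) (down_nodes m w)) = - (\<Sum>m<l. g m - g (Suc m))"
    unfolding sum_distrib_left sum_negf[symmetric] by (intro sum.cong) auto
  also have "\<dots> = - (g 0 - g l)" by (simp only: telescope_lessThan)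
  also have "\<dots> = Psi" by (simp add: g_def down_nodes_l up_nodes_l poly_Psi)
  also have "\<dots> = nd k * Psi_at k" by (simp only: nd_Psi_at)
  finally show ?thesis by (simp only: mult_cancel_left nd_neq_0) simp
qed

text \<open>Newton's form with nodes \<open>ch w, ch (w + 1), ...\<close>, by repeated synthetic
  division. With \<open>k = l\<close> the remainder is a multiple of \<open>Psi\<close>, which
  annihilates \<open>C\<close>.\<close>

lemma newton_expansion: "\<exists>a r. p = (\<Sum>m<k. smult (a m) (up_nodes m w)) + up_nodes k w * r"
proof (induction k)
  case 0
  then show ?case by (simp add: up_nodes_def)
next
  case (Suc k)
  then obtain a r where p: "p = (\<Sum>m<k. smult (a m) (up_nodes m w)) + up_nodes k w * r" by blast
  let ?x = "ch (w + int k)"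
  have r: "r = nd (w + int k) * synthetic_div r ?x + [:poly r ?x:]" using synthetic_div_correct'[of ?x r] by simp
  have "up_nodes k w * r = up_nodes (Suc k) w * synthetic_div r ?x + smult (poly r ?x) (up_nodes k w)"
    by (subst r) (simp add: up_nodes_Suc distrib_left mult_ac mult_const_poly del: mult_pCons_left mult_pCons_right)
  then have "p = (\<Sum>m<Suc k. smult ((a(k := poly r ?x)) m) (up_nodes m w)) + up_nodes (Suc k) w * synthetic_div r ?x"
    by (subst p) (simp add: algebra_simps)
  then show ?case by blast
qed

section \<open>Central elements annihilated by the radical\<close>

text \<open>For every weight \<open>w\<close>, nilpotency gives \<open>F^l * E^l * pr w = 0\<close>,
  and this is a nonzero multiple of \<open>ev Psi * pr w\<close>. The idempotents sum to 1.\<close>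

lemma ev_Psi: "ev Psi = 0"
proof -
  have "ev Psi * pr w = 0" for w
  proof -
    have "(1 / dl ^ (2 * l)) *\<^sub>C (ev (up_nodes l w) * pr w) = 0"
      using FE_pow_pr[of l w] by (simp add: F_pow)
    then show ?thesis by (simp add: up_nodes_l)
  qed
  then have "ev Psi * (\<Sum>w\<in>residues. pr w) = 0" by (simp add: sum_distrib_left)
  then show ?thesis by (simp add: sum_pr)
qed

definition ec :: "int \<Rightarrow> 'a" where "ec k = ev (Psi_at k)"

lemma ec_neg: "ec (- k) = ec k" by (simp add: ec_def Psi_at_neg)

lemma periodic_ec: "periodic ec"
  unfolding ec_def[abs_def] by (intro periodicI arg_cong[where f = ev] periodicD[OF periodic_Psi_at])

lemma ec_central: "x * ec k = ec k * x" by (simp add: ec_def ev_central)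

text \<open>\<open>(C - ch k) * ec k = ev Psi = 0\<close>, so \<open>C\<close> acts on
  \<open>ec k\<close> by \<open>ch k\<close>.\<close>

lemma ev_ec: "ev p * ec k = poly p (ch k) *\<^sub>C ec k"
proof -
  have "p * Psi_at k = synthetic_div p (ch k) * Psi + smult (poly p (ch k)) (Psi_at k)"
  proof -
    let ?s = "synthetic_div p (ch k)"
    have "p = nd k * ?s + [:poly p (ch k):]" using synthetic_div_correct'[of "ch k" p] by simp
    then have "p * Psi_at k = (nd k * ?s + [:poly p (ch k):]) * Psi_at k" by simp
    also have "\<dots> = ?s * (nd k * Psi_at k) + [:poly p (ch k):] * Psi_at k"
      by (simp only: distrib_right mult.assoc mult.left_commute)
    finally show ?thesis by (simp only: nd_Psi_at mult_const_poly)
  qed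
  then have "ev (p * Psi_at k) = poly p (ch k) *\<^sub>C ec k"
    by (simp add: alg_eval_add alg_eval_mult alg_eval_smult ev_Psi ec_def)
  then show ?thesis by (simp add: alg_eval_mult ec_def)
qed

lemma pbw_nz:
  assumes "m < l" "n < l"
  shows "F ^ m * E ^ n * pr w \<noteq> 0"
proof -
  obtain \<beta> :: "'a \<Rightarrow> complex" where \<beta>: "clinear \<beta>"
    "\<And>m n w. m < l \<Longrightarrow> n < l \<Longrightarrow> w \<in> residues \<Longrightarrow> \<beta> (F ^ m * E ^ n * pr w) = 1"
    using functional_exists[of "\<lambda>m n w. 1"] by blast
  have "\<beta> (F ^ m * E ^ n * pr (w mod int l)) = 1" using l_pos by (intro \<beta>(2) assms) auto
  then show ?thesis using clinear_zero[OF \<beta>(1)] by (auto simp: periodic_mod[OF periodic_pr])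
qed

text \<open>A nonzero multiple of \<open>ec k * pr (k + 1)\<close> is the PBW basis element with
  both exponents \<open>l - 1\<close>.\<close>

lemma ec_nz: "ec k \<noteq> 0"
proof
  assume "ec k = 0"
  then have "F ^ (l - 1) * E ^ (l - 1) * pr (k + 1) = 0"
    by (simp add: FE_pow_pr ec_def Psi_at_def)
  then show False using pbw_nz[of "l - 1" "l - 1" "k + 1"] l_ge by simp
qed

lemma even_periodic_ch_cong:
  assumes "even_periodic f" "ch a = ch b"
  shows "f a = f b"
proof -
  consider "int l dvd a - b" | "int l dvd a - (- b)" using assms(2) by (auto simp: ch_eq_iff)
  then show ?thesis
  proof cases
    case 1
    then show ?thesis using assms(1) by (simp add: even_periodic_def periodicD)
  next
    case 2
    then have "f a = f (- b)" using assms(1) periodicD unfolding even_periodic_def by blast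
    then show ?thesis using assms(1) by (simp add: even_periodic_def)
  qed
qed

text \<open>Even periodic functions are exactly the functions of \<open>ch k\<close>, hence
  interpolated by polynomials. They can therefore be realized as eigenvalues of polynomials in the
  Casimir element.\<close>

lemma even_function_of_ch:
  assumes "even_periodic f"
  shows "\<exists>p. \<forall>k. poly p (ch k) = f k"
proof -
  \<comment> \<open>Any preimage under \<open>ch\<close> may be chosen, since \<open>f\<close> takes
    the same value on all of them.\<close>
  define g where "g x = f (SOME k. ch k = x)" for x
  have g: "g (ch k) = f k" for k
  proof -
    have "ch (SOME i. ch i = ch k) = ch k" by (rule someI[of _ k]) simp
    then show ?thesis unfolding g_def by (rule even_periodic_ch_cong[OF assms])
  qed
  obtain p where p: "\<forall>x\<in>ch ` residues. poly p x = g x" using interpolation_poly[of "ch ` residues" g] by auto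
  have "poly p (ch k) = f k" for k
  proof -
    have "ch k = ch (k mod int l)" by (simp add: periodic_mod[OF periodic_ch])
    then have "ch k \<in> ch ` residues" using l_pos by auto
    then have "poly p (ch k) = g (ch k)" using p by blast
    then show ?thesis by (simp only: g)
  qed
  then show ?thesis by blast
qed

text \<open>Since \<open>ec (- k) = ec k\<close>, only even coefficient functions are determined.
  Multiplying by a polynomial in \<open>C\<close> that is the indicator of the class of
  \<open>i\<close> up to sign isolates one term.\<close>

lemma sum_ec_zero:
  assumes f: "even_periodic f" and z: "(\<Sum>k\<in>residues. f k *\<^sub>C ec k) = 0"
  shows "f i = 0"
proof -
  define d where "d k = (if int l dvd k - i \<or> int l dvd k + i then 1 else 0 :: complex)" for k
  have d_eq: "d k = (if ch k = ch i then 1 else 0)" for k by (simp add: d_def ch_eq_iff)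
  have per: "periodic d" unfolding d_eq[abs_def]
    by (rule periodicI) (simp add: periodicD[OF periodic_ch])
  have d: "even_periodic d"
    unfolding even_periodic_def using per by (simp add: d_eq ch_neg)
  obtain p where p: "\<And>k. poly p (ch k) = d k" using even_function_of_ch[OF d] by blast
  have "0 = ev p * (\<Sum>k\<in>residues. f k *\<^sub>C ec k)" using z by simp
  also have "\<dots> = (\<Sum>k\<in>residues. (f k * d k) *\<^sub>C ec k)"
    by (simp add: sum_distrib_left mult_scaleC_right ev_ec p scaleC_scaleC)
  also have "\<dots> = (\<Sum>k\<in>residues. (f i * d k) *\<^sub>C ec i)"
  proof (intro sum.cong refl)
    fix k
    show "(f k * d k) *\<^sub>C ec k = (f i * d k) *\<^sub>C ec i"
    proof (cases "d k = 0")
      case False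
      then consider "int l dvd k - i" | "int l dvd k - (- i)" by (auto simp: d_def split: if_splits)
      then have "f k = f i \<and> ec k = ec i"
      proof cases
        case 1
        then show ?thesis using f periodic_ec by (simp add: even_periodic_def periodicD)
      next
        case 2
        then have "f k = f (- i)" "ec k = ec (- i)"
          using f periodic_ec periodicD unfolding even_periodic_def by blast+
        then show ?thesis using f by (simp add: even_periodic_def ec_neg)
      qed
      then show ?thesis by simp
    qed simp
  qed
  also have "\<dots> = (f i * (\<Sum>k\<in>residues. d k)) *\<^sub>C ec i"
    by (simp add: cvs.scale_sum_left[symmetric] sum_distrib_left)
  finally have "f i * (\<Sum>k\<in>residues. d k) = 0" using ec_nz[of i] by (metis cvs.scale_eq_0_iff)
  \<comment> \<open>The sum counts the residues with Casimir eigenvalue \<open>ch i\<close>, among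
    them \<open>i mod l\<close>.\<close>
  moreover have "(\<Sum>k\<in>residues. d k) \<noteq> 0"
  proof -
    have card: "(\<Sum>k\<in>residues. d k) = of_nat (card {k\<in>residues. ch k = ch i})"
      by (simp add: d_eq sum.If_cases Int_def)
    have "i mod int l \<in> {k\<in>residues. ch k = ch i}"
      using l_pos by (simp add: periodic_mod[OF periodic_ch])
    moreover have "finite {k\<in>residues. ch k = ch i}" by (rule finite_subset[of _ residues]) auto
    ultimately have "card {k\<in>residues. ch k = ch i} \<noteq> 0" by (metis card_eq_0_iff empty_iff)
    then show ?thesis using card by simp
  qed
  ultimately show ?thesis by simp
qed

end

context uq_algebra
begin

section \<open>The basis with the roles of E and F exchanged\<close>

lemma Kp_minus_power: "Ki ^ n = Kp (- int n)"
proof (induction n)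
  case (Suc n)
  have "Kp (- int (Suc n)) = Kp (- 1) * Kp (- int n)" using Kp_add[of "- 1" "- int n"] by simp
  then show ?case using Suc by simp
qed simp

text \<open>The defining relations are symmetric under this exchange. It yields the basis
  \<open>E^m * F^n * pr w\<close>, the order in which the second leg of the monodromy
  appears.\<close>

lemma swapped: "uq_algebra l q F E Ki K"
proof
  show "F ^ l = 0" "E ^ l = 0" "Ki * K = 1" "K * Ki = 1" "cvs.dim (UNIV :: 'a set) = l ^ 3"
    by (fact F_pow E_pow Ki_K K_Ki dimension)+
  have "Kp (- int l) = Kp 0" by (rule periodicD[OF periodic_Kp]) simp
  then show "Ki ^ l = 1" by (simp add: Kp_minus_power)
  show "Ki * F = q\<^sup>2 *\<^sub>C (F * Ki)" using Kp_F[of "- 1"] by simp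
  show "Ki * E = (q powi (- 2)) *\<^sub>C (E * Ki)" using Kp_E[of "- 1"] by simp
  show "F * E - E * F = (1 / (q - inverse q)) *\<^sub>C (Ki - K)"
    using EF by (metis cvs.scale_minus_right minus_diff_eq)
  have K: "K \<in> subalgebra_generated {F, E, Ki}"
  proof -
    have pow: "Ki ^ n \<in> subalgebra_generated {F, E, Ki}" for n
      by (induction n) (auto intro: subalgebra_generated.intros)
    have "Ki ^ (l - 1) = Kp 1"
      unfolding Kp_minus_power using l_ge by (intro periodicD[OF periodic_Kp]) (simp add: of_nat_diff)
    then show ?thesis using pow[of "l - 1"] by simp
  qed
  have "x \<in> subalgebra_generated {F, E, Ki}" for x
  proof -
    have "x \<in> subalgebra_generated {E, F, K}" by (simp add: generated)
    then show ?thesis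
      by (induction rule: subalgebra_generated.induct) (use K in \<open>auto intro: subalgebra_generated.intros\<close>)
  qed
  then show "subalgebra_generated {F, E, Ki} = UNIV" by blast
qed

text \<open>An eigenvalue \<open>qp (2 * w - 1)\<close> of \<open>Ki\<close> is the eigenvalue
  \<open>qp (2 * (1 - w) - 1)\<close> of \<open>K\<close>.\<close>

lemma swapped_pr: "uq_algebra.pr l q Ki w = pr (1 - w)"
proof -
  interpret sw: uq_algebra l q F E Ki K by (rule swapped)
  have Kp: "sw.Kp j = Kp (- j)" for j
  proof -
    have "sw.Kp j = Kp (- (j mod int l))" unfolding sw.Kp_def Kp_minus_power using l_pos by simp
    also have "\<dots> = Kp (- j)"
      by (rule periodicD[OF periodic_Kp]) (simp add: mod_eq_dvd_iff[symmetric] mod_minus_cong)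
    finally show ?thesis .
  qed
  define g where "g j = qp (- ((2 * (1 - w) - 1) * j)) *\<^sub>C Kp j" for j
  have per: "periodic (\<lambda>j. qp (- ((2 * (1 - w) - 1) * j)))"
    using periodic_qp[of "- (2 * (1 - w) - 1)" 0] by (simp only: add_0_right mult_minus_left)
  have g: "periodic g"
    by (rule periodicI) (simp only: g_def periodicD[OF periodic_Kp] periodicD[OF per])
  have "sw.pr w = (1 / of_nat l) *\<^sub>C (\<Sum>j\<in>residues. g (0 - j))"
    unfolding sw.pr_def Kp g_def by (simp add: algebra_simps)
  also have "\<dots> = pr (1 - w)" unfolding sum_residues_reflect[OF g] by (simp add: pr_def g_def)
  finally show ?thesis .
qed

lemma periodic_scaleC: "periodic f \<Longrightarrow> periodic g \<Longrightarrow> periodic (\<lambda>w. f w *\<^sub>C (g w :: 'b::complex_vector))"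
  by (intro periodicI arg_cong2[where f = scaleC]; erule (1) periodicD)

lemma periodic_mult_pr: "periodic (\<lambda>w. x * pr w)"
  by (intro periodicI arg_cong[where f = "(*) x"]; erule periodicD[OF periodic_pr])

lemma swapped_sum:
  assumes "\<And>m n. periodic (a m n)"
  shows "(\<Sum>m<l. \<Sum>n<l. \<Sum>w\<in>residues. a m n w *\<^sub>C (E ^ m * F ^ n * pr w))
    = (\<Sum>m<l. \<Sum>n<l. \<Sum>w\<in>residues. a m n (1 - w) *\<^sub>C (E ^ m * F ^ n * uq_algebra.pr l q Ki w))"
  unfolding swapped_pr
  by (intro sum.cong refl sum_residues_reflect[symmetric] periodic_scaleC periodic_mult_pr assms)

lemma swapped_pbw_zero:
  assumes a: "\<And>m n. periodic (a m n)"
    and z: "(\<Sum>m<l. \<Sum>n<l. \<Sum>w\<in>residues. a m n w *\<^sub>C (E ^ m * F ^ n * pr w)) = 0"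
    and i: "i < l" "j < l"
  shows "a i j u = 0"
proof -
  interpret sw: uq_algebra l q F E Ki K by (rule swapped)
  have "a i j (1 - (1 - u) mod int l) = 0"
    by (rule sw.pbw_zero[of "\<lambda>m n w. a m n (1 - w)", OF _ i])
      (use z l_pos in \<open>simp_all add: swapped_sum[OF a]\<close>)
  moreover have "a i j (1 - (1 - u) mod int l) = a i j u"
    by (rule periodicD[OF a]) (simp add: mod_eq_dvd_iff[symmetric] mod_simps)
  ultimately show ?thesis by simp
qed

lemma swapped_pbw_exists:
  "\<exists>a. (\<forall>m n. periodic (a m n)) \<and> x = (\<Sum>m<l. \<Sum>n<l. \<Sum>w\<in>residues. a m n w *\<^sub>C (E ^ m * F ^ n * pr w))"
proof -
  interpret sw: uq_algebra l q F E Ki K by (rule swapped)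
  show ?thesis
  proof (induction x rule: sw.pbw_induct)
    case (add x y)
    then obtain a b where "\<forall>m n. periodic (a m n)" "\<forall>m n. periodic (b m n)"
      "x = (\<Sum>m<l. \<Sum>n<l. \<Sum>w\<in>residues. a m n w *\<^sub>C (E ^ m * F ^ n * pr w))"
      "y = (\<Sum>m<l. \<Sum>n<l. \<Sum>w\<in>residues. b m n w *\<^sub>C (E ^ m * F ^ n * pr w))" by blast
    then show ?case
      by (intro exI[of _ "\<lambda>m n w. a m n w + b m n w"]) (simp add: periodic_add scaleC_add_left sum.distrib)
  next
    case (scale c x)
    then obtain a where "\<forall>m n. periodic (a m n)"
      "x = (\<Sum>m<l. \<Sum>n<l. \<Sum>w\<in>residues. a m n w *\<^sub>C (E ^ m * F ^ n * pr w))" by blast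
    then show ?case
      by (intro exI[of _ "\<lambda>m n w. c * a m n w"])
        (simp add: periodic_cmult cvs.scale_sum_right scaleC_scaleC del: scaleC_complex)
  next
    case (pbw i j u)
    define a where "a m n w = (if int l dvd w - (1 - u) then if n = j then if m = i then 1 else 0 else 0 else 0 :: complex)" for m n w
    have "periodic (a m n)" for m n
    proof (rule periodicI)
      fix x y assume "int l dvd x - y"
      moreover have "x - (1 - u) = (x - y) + (y - (1 - u))" by simp
      ultimately have "int l dvd x - (1 - u) \<longleftrightarrow> int l dvd y - (1 - u)"
        by (simp only: dvd_add_right_iff)
      then show "a m n x = a m n y" by (simp add: a_def)
    qed
    moreover have "(\<Sum>m<l. \<Sum>n<l. \<Sum>w\<in>residues. a m n w *\<^sub>C (E ^ m * F ^ n * pr w)) = E ^ i * F ^ j * sw.pr u"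
    proof -
      have "(\<Sum>m<l. \<Sum>n<l. \<Sum>w\<in>residues. a m n w *\<^sub>C (E ^ m * F ^ n * pr w))
        = (\<Sum>m<l. \<Sum>n<l. \<Sum>w\<in>residues. if int l dvd w - (1 - u) then
            if n = j then if m = i then E ^ m * F ^ n * pr w else 0 else 0 else 0)"
        by (intro sum.cong refl) (simp add: a_def scaleC_one)
      also have "\<dots> = (\<Sum>m<l. \<Sum>n<l. if n = j then if m = i then E ^ m * F ^ n * pr (1 - u) else 0 else 0)"
        by (intro sum.cong refl sum_residues_delta periodicI) (simp add: periodicD[OF periodic_pr])
      finally show ?thesis using pbw by (simp add: swapped_pr)
    qed
    ultimately show ?case by (intro exI[of _ a]) simp
  qed
qed

section \<open>Quantum traces on baby Verma modules\<close>

text \<open>The trace of \<open>K\<inverse> x\<close> on the baby Verma module with Casimir eigenvalue \<open>ch j\<close>, all of whose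
  weight spaces are one-dimensional.\<close>

definition mu :: "int \<Rightarrow> 'a \<Rightarrow> complex"
  where "mu j = (SOME \<beta>. clinear \<beta> \<and> (\<forall>m<l. \<forall>n<l. \<forall>w\<in>residues. \<beta> (F ^ m * E ^ n * pr w)
    = (if m = n then qp (1 - 2 * w) * poly (up_nodes m w) (ch j) / dl ^ (2 * m) else 0)))"

lemma mu: "clinear (mu j)"
  and mu_residues: "m < l \<Longrightarrow> n < l \<Longrightarrow> w \<in> residues \<Longrightarrow> mu j (F ^ m * E ^ n * pr w)
    = (if m = n then qp (1 - 2 * w) * poly (up_nodes m w) (ch j) / dl ^ (2 * m) else 0)"
  using someI_ex[OF functional_exists[of "\<lambda>m n w. if m = n then qp (1 - 2 * w) * poly (up_nodes m w) (ch j) / dl ^ (2 * m) else 0"]]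
  unfolding mu_def by blast+

lemma mu_pbw:
  assumes "m < l" "n < l"
  shows "mu j (F ^ m * E ^ n * pr w)
    = (if m = n then qp (1 - 2 * w) * poly (up_nodes m w) (ch j) / dl ^ (2 * m) else 0)"
proof -
  let ?w = "w mod int l"
  have "pr ?w = pr w" "up_nodes m ?w = up_nodes m w"
    by (simp_all add: periodic_mod[OF periodic_pr] periodic_mod[OF periodic_up_nodes])
  moreover have "qp (- 2 * ?w + 1) = qp (- 2 * w + 1)"
    using periodic_mod[OF periodic_qp[of "- 2" 1], of w] .
  then have "qp (1 - 2 * ?w) = qp (1 - 2 * w)" by simp
  moreover have "?w \<in> residues" using l_pos by simp
  ultimately show ?thesis using mu_residues[OF assms, of ?w j] by (cases "m = n") auto
qed

text \<open>On the elements \<open>F^m * E^m * pr w\<close> this is the prescribed value of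
  \<open>mu\<close>. The Newton expansion of \<open>p\<close> reduces the general case to these,
  because \<open>Psi\<close> kills both \<open>C\<close> and \<open>ch j\<close>.\<close>

lemma mu_ev: "mu j (ev p * pr w) = qp (1 - 2 * w) * poly p (ch j)"
proof -
  obtain a r where p: "p = (\<Sum>m<l. smult (a m) (up_nodes m w)) + up_nodes l w * r"
    using newton_expansion by blast
  have "ev p * pr w = (\<Sum>m<l. a m *\<^sub>C (ev (up_nodes m w) * pr w))"
    unfolding p by (simp add: alg_eval_add alg_eval_sum alg_eval_smult alg_eval_mult up_nodes_l ev_Psi
        sum_distrib_right mult_scaleC_left)
  also have "\<dots> = (\<Sum>m<l. (a m * dl ^ (2 * m)) *\<^sub>C (F ^ m * E ^ m * pr w))"
    by (simp add: FE_pow_pr scaleC_scaleC)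
  finally have "mu j (ev p * pr w) = (\<Sum>m<l. a m * dl ^ (2 * m) * mu j (F ^ m * E ^ m * pr w))"
    by (simp add: clinear_sum[OF mu] clinear_scale_complex[OF mu] del: scaleC_complex)
  also have "\<dots> = (\<Sum>m<l. a m * (qp (1 - 2 * w) * poly (up_nodes m w) (ch j)))"
    by (intro sum.cong refl) (simp add: mu_pbw)
  also have "\<dots> = qp (1 - 2 * w) * poly p (ch j)"
    unfolding p by (simp add: up_nodes_l poly_Psi poly_sum sum_distrib_left mult.left_commute)
  finally show ?thesis .
qed

lemma FEpr_weight: "F ^ m * E ^ n * pr w = pr (w + int n - int m) * F ^ m * E ^ n"
  by (simp only: mult.assoc E_pow_pr) (simp only: mult.assoc[symmetric] F_pow_pr)

lemma EFpr_weight: "E ^ m * F ^ n * pr w = pr (w - int n + int m) * E ^ m * F ^ n"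
  by (simp only: mult.assoc F_pow_pr) (simp only: mult.assoc[symmetric] E_pow_pr)

lemma mu_weight:
  assumes "\<not> int l dvd u - w"
  shows "mu j (pr u * x * pr w) = 0"
proof (induction x rule: pbw_induct)
  case (add x y)
  then show ?case by (simp add: distrib_left distrib_right clinear_add[OF mu])
next
  case (scale c x)
  then show ?case by (simp add: mult_scaleC_left mult_scaleC_right clinear_scale_complex[OF mu] del: scaleC_complex)
next
  case (pbw m n v)
  show ?case
  proof (cases "m = n")
    case True
    have "pr u * (F ^ m * E ^ n * pr v) * pr w = pr u * pr v * F ^ m * E ^ n * pr w"
      unfolding FEpr_weight True by (simp add: mult.assoc)
    also have "\<dots> = pr u * pr v * (pr w * F ^ m * E ^ n)"
      unfolding mult.assoc[of "pr u * pr v"] by (simp only: mult.assoc FEpr_weight[unfolded mult.assoc]) (simp add: True)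
    also have "\<dots> = 0"
      using assms by (simp add: pr_pr mult.assoc[symmetric] split: if_splits)
        (metis diff_add_cancel add_diff_eq dvd_add)
    finally show ?thesis by (simp add: clinear_zero[OF mu])
  next
    case False
    have "pr u * (F ^ m * E ^ n * pr v) * pr w = (if int l dvd v - w then pr u * (F ^ m * E ^ n * pr w) else 0)"
      by (simp add: mult.assoc pr_pr)
    also have "\<dots> = (if int l dvd v - w \<and> int l dvd u - (w + int n - int m) then F ^ m * E ^ n * pr w else 0)"
      unfolding FEpr_weight by (simp add: mult.assoc[symmetric] pr_pr)
    finally show ?thesis using False pbw by (simp add: mu_pbw clinear_zero[OF mu])
  qed
qed

lemma mu_weight':
  assumes "pr u * x = x" "x * pr w = x" "\<not> int l dvd u - w"
  shows "mu j x = 0"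
  using mu_weight[OF assms(3), of j x] assms(1,2) by simp

lemma FE_left_weight: "pr (w + int n - int m) * (F ^ m * E ^ n * pr w) = F ^ m * E ^ n * pr w"
  unfolding FEpr_weight by (simp only: mult.assoc[symmetric] pr_idem)

lemma FE_right_weight: "F ^ m * E ^ n * pr w * pr w = F ^ m * E ^ n * pr w"
  by (simp only: mult.assoc pr_idem)

text \<open>Applied to the weight of a basis element multiplied by \<open>E\<close> or
  \<open>F\<close>. Weight zero leaves the expected case and one that wraps around modulo
  \<open>l\<close>; in the latter an \<open>l\<close>-th power of the generator vanishes.\<close>

lemma dvd_Suc_diff:
  assumes "m < l" "n < l" "int l dvd int n + 1 - int m"
  shows "m = Suc n \<or> m = 0 \<and> Suc n = l"
proof -
  consider "int n + 1 - int m = 0" | "int n + 1 - int m > 0" | "int m - int n - 1 > 0" by linarith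
  then show ?thesis
  proof cases
    case 2
    then show ?thesis using zdvd_imp_le[OF assms(3)] assms(1,2) by auto
  next
    case 3
    have "int l dvd int m - int n - 1" using assms(3) by (metis diff_diff_eq dvd_diff_commute)
    then show ?thesis using zdvd_imp_le[OF _ 3] assms(1,2) by fastforce
  qed auto
qed

lemma mu_twisted_trace_K: "mu j (x * K) = mu j (K * x)"
proof (induction x rule: pbw_induct)
  case (pbw m n w)
  have 1: "F ^ m * E ^ n * pr w * K = qp (2 * w - 1) *\<^sub>C (F ^ m * E ^ n * pr w)"
    by (simp add: mult.assoc pr_K mult_scaleC_right)
  have 2: "K * (F ^ m * E ^ n * pr w) = qp (2 * (w + int n - int m) - 1) *\<^sub>C (F ^ m * E ^ n * pr w)"
    unfolding FEpr_weight by (simp add: mult.assoc[symmetric] K_pr mult_scaleC_left)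
  show ?case unfolding 1 2 clinear_scale_complex[OF mu] using pbw by (simp add: mu_pbw)
qed (simp_all add: distrib_left distrib_right clinear_add[OF mu] mult_scaleC_left mult_scaleC_right
      clinear_scale_complex[OF mu] del: scaleC_complex)

text \<open>If the product has nonzero weight, both sides vanish. Otherwise both are values of
  \<open>mu_ev\<close> for the same polynomial at the neighbouring weights \<open>w - 1\<close> and
  \<open>w\<close>, whose trace factors differ by \<open>q^2\<close>.\<close>

lemma mu_twisted_trace_E: "mu j (x * E) = q\<^sup>2 * mu j (E * x)"
proof (induction x rule: pbw_induct)
  case (pbw m n w)
  let ?x = "F ^ m * E ^ n * pr w"
  have prE: "pr w * E = E * pr (w - 1)" using E_pr[of "w - 1"] by simp
  show ?case
  proof (cases "int l dvd int n + 1 - int m")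
    case True
    then consider "m = Suc n" | "m = 0" "Suc n = l" using dvd_Suc_diff[OF pbw] by blast
    then show ?thesis
    proof cases
      case 1
      have "E * ?x = E * F * (F ^ n * E ^ n * pr w)" by (simp add: 1 mult.assoc)
      also have "\<dots> = (1 / dl ^ (2 * n)) *\<^sub>C (ev (up_nodes n w) * (E * F * pr w))"
        by (simp only: FE_pow_pr mult_scaleC_right ev_left_commute)
      also have "\<dots> = (1 / dl ^ (2 * m)) *\<^sub>C (ev (up_nodes n w) * (ev (nd (w - 1)) * pr w))"
        unfolding EF_pr 1 by (simp add: mult_scaleC_right scaleC_scaleC power2_eq_square del: alg_eval_pCons)
      also have "ev (up_nodes n w) * (ev (nd (w - 1)) * pr w) = ev (up_nodes m (w - 1)) * pr w"
        unfolding 1 up_nodes_Suc_shift alg_eval_mult mult.assoc ev_left_commute[of "ev (up_nodes n w)"] by simp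
      finally have Ex: "E * ?x = (1 / dl ^ (2 * m)) *\<^sub>C (ev (up_nodes m (w - 1)) * pr w)" .
      have "?x * E = F ^ m * (E ^ n * E) * pr (w - 1)" by (simp only: mult.assoc prE)
      then have xE: "?x * E = F ^ m * E ^ m * pr (w - 1)" by (simp only: 1 power_Suc2)
      have "q\<^sup>2 = qp 2" by simp
      then have q: "q\<^sup>2 * qp (1 - 2 * w) = qp (1 - 2 * (w - 1))"
        by (simp only: qp_add[symmetric]) (simp add: algebra_simps)
      show ?thesis
        unfolding xE Ex FE_pow_pr clinear_scale_complex[OF mu] mu_ev q[symmetric] by (simp only: mult_ac)
    next
      case 2
      have "E * E ^ n = 0" "E ^ n * E = 0" using E_pow 2(2) by (metis power_Suc, metis power_Suc2)
      then have "?x * E = 0" "E * ?x = 0"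
        by (simp_all add: 2(1) mult.assoc prE) (metis mult.assoc mult_zero_left)+
      then show ?thesis by (simp add: clinear_zero[OF mu])
    qed
  next
    case False
    have "mu j (?x * E) = 0"
    proof (rule mu_weight')
      show "pr (w + int n - int m) * (?x * E) = ?x * E" by (simp only: mult.assoc[symmetric] FE_left_weight[unfolded mult.assoc[symmetric]])
      show "?x * E * pr (w - 1) = ?x * E" by (simp only: mult.assoc prE[symmetric]) (simp only: mult.assoc[symmetric] FE_right_weight)
      show "\<not> int l dvd w + int n - int m - (w - 1)" using False by (simp add: algebra_simps)
    qed
    moreover have "mu j (E * ?x) = 0"
    proof (rule mu_weight')
      show "pr (w + int n - int m + 1) * (E * ?x) = E * ?x"
        by (simp only: mult.assoc[of _ E, symmetric] mult.assoc[of E] E_pr[symmetric] FE_left_weight)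
      show "E * ?x * pr w = E * ?x" by (simp only: mult.assoc[of E] FE_right_weight)
      show "\<not> int l dvd w + int n - int m + 1 - w" using False by (simp add: algebra_simps)
    qed
    ultimately show ?thesis by simp
  qed
qed (simp_all add: distrib_left distrib_right clinear_add[OF mu] mult_scaleC_left mult_scaleC_right
      clinear_scale_complex[OF mu] del: scaleC_complex)

lemma mu_twisted_trace_F: "mu j (x * F) = qp (- 2) * mu j (F * x)"
proof (induction x rule: pbw_induct)
  case (pbw m n w)
  let ?x = "F ^ m * E ^ n * pr w"
  have prF: "pr w * F = F * pr (w + 1)" using F_pr[of "w + 1"] by simp
  show ?case
  proof (cases "int l dvd int m + 1 - int n")
    case True
    then consider "n = Suc m" | "n = 0" "Suc m = l" using dvd_Suc_diff[OF pbw(2,1)] by blast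
    then show ?thesis
    proof cases
      case 1
      have "?x * F = F ^ m * (E ^ m * E) * (F * pr (w + 1))" by (simp only: 1 power_Suc2 mult.assoc prF)
      also have "\<dots> = F ^ m * E ^ m * (E * F * pr (w + 1))" by (simp only: mult.assoc)
      also have "\<dots> = (1 / dl\<^sup>2) *\<^sub>C (ev (nd w) * (F ^ m * E ^ m * pr (w + 1)))"
        unfolding EF_pr mult_scaleC_right by (simp only: ev_left_commute add_diff_cancel_right')
      also have "\<dots> = (1 / dl ^ (2 * n)) *\<^sub>C (ev (up_nodes n w) * pr (w + 1))"
        unfolding FE_pow_pr 1 up_nodes_Suc_shift alg_eval_mult
        by (simp add: mult_scaleC_right scaleC_scaleC power2_eq_square mult.assoc del: alg_eval_pCons)
      finally have xF: "?x * F = (1 / dl ^ (2 * n)) *\<^sub>C (ev (up_nodes n w) * pr (w + 1))" .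
      have "F * ?x = F ^ n * E ^ n * pr w" by (simp add: 1 mult.assoc)
      then have Fx: "F * ?x = (1 / dl ^ (2 * n)) *\<^sub>C (ev (up_nodes n w) * pr w)" by (simp only: FE_pow_pr)
      have q: "qp (- 2) * qp (1 - 2 * w) = qp (1 - 2 * (w + 1))"
        by (simp only: qp_add[symmetric]) (simp add: algebra_simps)
      show ?thesis
        unfolding xF Fx clinear_scale_complex[OF mu] mu_ev q[symmetric] by (simp only: mult_ac)
    next
      case 2
      have "F * F ^ m = 0" "F ^ m * F = 0" using F_pow 2(2) by (metis power_Suc, metis power_Suc2)
      then have "?x * F = 0" "F * ?x = 0"
        by (simp_all add: 2(1) mult.assoc prF) (metis mult.assoc mult_zero_left)+
      then show ?thesis by (simp add: clinear_zero[OF mu])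
    qed
  next
    case False
    then have dvd: "\<not> int l dvd int n - int m - 1" by (metis diff_diff_eq dvd_diff_commute)
    have "mu j (?x * F) = 0"
    proof (rule mu_weight')
      show "pr (w + int n - int m) * (?x * F) = ?x * F" by (simp only: mult.assoc[symmetric] FE_left_weight[unfolded mult.assoc[symmetric]])
      show "?x * F * pr (w + 1) = ?x * F" by (simp only: mult.assoc prF[symmetric]) (simp only: mult.assoc[symmetric] FE_right_weight)
      show "\<not> int l dvd w + int n - int m - (w + 1)" using dvd by (simp add: algebra_simps)
    qed
    moreover have "mu j (F * ?x) = 0"
    proof (rule mu_weight')
      show "pr (w + int n - int m - 1) * (F * ?x) = F * ?x"
        by (simp only: mult.assoc[of _ F, symmetric] mult.assoc[of F] F_pr[symmetric] FE_left_weight)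
      show "F * ?x * pr w = F * ?x" by (simp only: mult.assoc[of F] FE_right_weight)
      show "\<not> int l dvd w + int n - int m - 1 - w" using dvd by (simp add: algebra_simps)
    qed
    ultimately show ?thesis by simp
  qed
qed (simp_all add: distrib_left distrib_right clinear_add[OF mu] mult_scaleC_left mult_scaleC_right
      clinear_scale_complex[OF mu] del: scaleC_complex)

lemma K_conj: "K * E * Ki = q\<^sup>2 *\<^sub>C E" "K * F * Ki = qp (- 2) *\<^sub>C F"
  by (simp_all add: KE KF mult_scaleC_left mult.assoc K_Ki)

text \<open>The twisted trace condition is stable under products of \<open>y\<close>, so generators
  suffice. It serves both for the Verma traces and for Drinfeld preimages of central
  elements.\<close>

lemma twisted_trace_generators:
  fixes \<beta> :: "'a \<Rightarrow> complex"
  assumes \<beta>: "clinear \<beta>"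
    and K: "\<And>x. \<beta> (x * K) = \<beta> (K * x)" and E: "\<And>x. \<beta> (x * E) = q\<^sup>2 * \<beta> (E * x)"
    and F: "\<And>x. \<beta> (x * F) = qp (- 2) * \<beta> (F * x)"
  shows "\<beta> (x * y) = \<beta> (K * y * Ki * x)"
proof -
  have "y \<in> subalgebra_generated {E, F, K}" by (simp add: generated)
  then show ?thesis
  proof (induction arbitrary: x rule: subalgebra_generated.induct)
    case (base y)
    then consider "y = E" | "y = F" | "y = K" by blast
    then show ?case
    proof cases
      case 3
      then show ?thesis using K by (simp add: mult.assoc K_Ki)
    qed (simp_all only: K_conj E F mult_scaleC_left clinear_scale_complex[OF \<beta>])
  next
    case one
    then show ?case by (simp add: K_Ki)
  next
    case (scale y c)
    then show ?case by (simp add: mult_scaleC_left mult_scaleC_right clinear_scale_complex[OF \<beta>] del: scaleC_complex)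
  next
    case (add y z)
    then show ?case by (simp add: distrib_left distrib_right clinear_add[OF \<beta>])
  next
    case (mult y z)
    have "\<beta> (x * (y * z)) = \<beta> (K * z * Ki * (x * y))" using mult(4)[of "x * y"] by (simp add: mult.assoc)
    also have "\<dots> = \<beta> (K * y * Ki * (K * z * Ki * x))" using mult(3)[of "K * z * Ki * x"] by (simp add: mult.assoc)
    also have "K * y * Ki * (K * z * Ki * x) = K * y * (Ki * K) * z * Ki * x" by (simp only: mult.assoc)
    finally show ?case by (simp add: Ki_K mult.assoc)
  qed
qed

lemma mu_twisted_trace: "mu j (x * y) = mu j (K * y * Ki * x)"
  by (rule twisted_trace_generators[OF mu mu_twisted_trace_K mu_twisted_trace_E mu_twisted_trace_F])

end

section \<open>Gaussian binomial coefficients\<close>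

text \<open>Pascal's rule avoids quotients of q-factorials, which at a root of unity may take the
  form 0/0.\<close>

fun gbin :: "complex \<Rightarrow> nat \<Rightarrow> nat \<Rightarrow> complex" where
  "gbin Q n 0 = 1"
| "gbin Q 0 (Suc k) = 0"
| "gbin Q (Suc n) (Suc k) = Q ^ Suc k * gbin Q n (Suc k) + gbin Q n k"

lemma gbin_eq_0: "n < k \<Longrightarrow> gbin Q n k = 0"
  by (induction Q n k rule: gbin.induct) simp_all

text \<open>The ratio of neighbouring coefficients. The factor \<open>Q^k\<close> on both sides
  keeps the exponent \<open>n - k\<close> out of the formula.\<close>

lemma gbin_absorb: "(1 - Q ^ Suc k) * Q ^ k * gbin Q n (Suc k) = (Q ^ k - Q ^ n) * gbin Q n k"
proof (induction n arbitrary: k)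
  case 0
  then show ?case by (cases k) simp_all
next
  case (Suc n)
  show ?case
  proof (cases k)
    case 0
    have "Q * ((1 - Q) * gbin Q n 1) = Q * (1 - Q ^ n)" using Suc[of 0] by simp
    then show ?thesis using 0 by (simp add: algebra_simps)
  next
    case k: (Suc j)
    have "(1 - Q ^ Suc k) * Q ^ k * gbin Q (Suc n) (Suc k)
      = Q ^ Suc k * ((1 - Q ^ Suc k) * Q ^ k * gbin Q n (Suc k)) + (1 - Q ^ Suc k) * Q ^ k * gbin Q n k"
      by (simp add: algebra_simps)
    also have "\<dots> = (Q ^ k - Q ^ Suc n) * Q ^ k * gbin Q n k + Q * ((1 - Q ^ Suc j) * Q ^ j * gbin Q n (Suc j))"
      unfolding Suc[of k] unfolding k by (simp add: algebra_simps)
    also have "\<dots> = (Q ^ k - Q ^ Suc n) * gbin Q (Suc n) k"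
      unfolding Suc[of j] k by (simp add: algebra_simps)
    finally show ?thesis .
  qed
qed

lemma q_binomial_theorem:
  fixes A B :: "'a::complex_algebra_1"
  assumes BA: "B * A = Q *\<^sub>C (A * B)"
  shows "(A + B) ^ n = (\<Sum>k\<le>n. gbin Q n k *\<^sub>C (A ^ (n - k) * B ^ k))"
proof (induction n)
  case 0
  then show ?case by (simp add: scaleC_one)
next
  case (Suc n)
  have pow: "B ^ k * A = Q ^ k *\<^sub>C (A * B ^ k)" for k
  proof (induction k)
    case (Suc k)
    have "B ^ Suc k * A = Q ^ k *\<^sub>C (B * A * B ^ k)" by (simp add: mult.assoc Suc mult_scaleC_right)
    then show ?case by (simp add: BA mult_scaleC_left scaleC_scaleC mult.assoc mult.commute)
  qed (simp add: scaleC_one)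
  have A: "(\<Sum>k\<le>n. gbin Q n k *\<^sub>C (A ^ (n - k) * B ^ k)) * A
    = (\<Sum>k\<le>n. (Q ^ k * gbin Q n k) *\<^sub>C (A ^ (Suc n - k) * B ^ k))"
    unfolding sum_distrib_right
  proof (intro sum.cong refl)
    fix k assume "k \<in> {..n}"
    then have "A ^ (n - k) * A = A ^ (Suc n - k)" by (simp add: Suc_diff_le power_Suc2 del: power_Suc)
    then show "gbin Q n k *\<^sub>C (A ^ (n - k) * B ^ k) * A = (Q ^ k * gbin Q n k) *\<^sub>C (A ^ (Suc n - k) * B ^ k)"
      by (simp add: mult_scaleC_left mult.assoc pow mult_scaleC_right scaleC_scaleC)
        (simp add: mult.assoc[symmetric] mult.commute)
  qed
  also have "\<dots> = A ^ Suc n + (\<Sum>k\<le>n. (Q ^ Suc k * gbin Q n (Suc k)) *\<^sub>C (A ^ (n - k) * B ^ Suc k))"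
  proof -
    have "(\<Sum>k\<le>n. (Q ^ k * gbin Q n k) *\<^sub>C (A ^ (Suc n - k) * B ^ k))
      = (\<Sum>k\<le>Suc n. (Q ^ k * gbin Q n k) *\<^sub>C (A ^ (Suc n - k) * B ^ k))"
      by (simp add: gbin_eq_0)
    then show ?thesis unfolding sum.atMost_Suc_shift by (simp add: scaleC_one)
  qed
  finally have A: "(\<Sum>k\<le>n. gbin Q n k *\<^sub>C (A ^ (n - k) * B ^ k)) * A
    = A ^ Suc n + (\<Sum>k\<le>n. (Q ^ Suc k * gbin Q n (Suc k)) *\<^sub>C (A ^ (n - k) * B ^ Suc k))" .
  have B: "(\<Sum>k\<le>n. gbin Q n k *\<^sub>C (A ^ (n - k) * B ^ k)) * B
    = (\<Sum>k\<le>n. gbin Q n k *\<^sub>C (A ^ (n - k) * B ^ Suc k))"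
    by (simp add: sum_distrib_right mult_scaleC_left mult.assoc power_Suc2 del: power_Suc)
  have "(A + B) ^ Suc n = (A + B) ^ n * A + (A + B) ^ n * B" by (simp only: power_Suc2 distrib_left)
  also have "\<dots> = A ^ Suc n + (\<Sum>k\<le>n. gbin Q (Suc n) (Suc k) *\<^sub>C (A ^ (n - k) * B ^ Suc k))"
    unfolding Suc A B by (simp add: sum.distrib[symmetric] scaleC_add_left add.assoc)
  also have "\<dots> = (\<Sum>k\<le>Suc n. gbin Q (Suc n) k *\<^sub>C (A ^ (Suc n - k) * B ^ k))"
    unfolding sum.atMost_Suc_shift by (simp add: scaleC_one)
  finally show ?case .
qed

context root_of_unity
begin

text \<open>For \<open>n = l - 1\<close> one has \<open>Q^n = Q^-1\<close>, so each coefficient is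
  \<open>- Q^-(k+1)\<close> times the preceding one.\<close>

lemma gbin_top: "k < l \<Longrightarrow> gbin (q\<^sup>2) (l - 1) k = (- 1) ^ k * qp (- (int k * (int k + 1)))"
proof (induction k)
  case (Suc k)
  define Q where "Q = q\<^sup>2"
  have Qk: "Q ^ n = qp (2 * int n)" for n by (simp add: Q_def power_int_mult)
  have nz: "1 - Q ^ Suc k \<noteq> 0"
  proof
    assume "1 - Q ^ Suc k = 0"
    then have "qp (2 * int (Suc k)) = 1" by (simp only: Qk) simp
    then have "int l dvd int (Suc k)" unfolding qp_eq_1_iff dvd_2_mult .
    then show False using Suc.prems by (auto dest!: zdvd_imp_le)
  qed
  have "Q ^ (l - 1) = qp (- 2)"
    unfolding Qk using l_ge by (intro qp_cong) (simp add: of_nat_diff)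
  then have "Q ^ k - Q ^ (l - 1) = - qp (- 2) * (1 - Q ^ Suc k)"
    unfolding Qk right_diff_distrib minus_mult_left[symmetric] qp_add[symmetric] by (simp add: algebra_simps)
  then have "(1 - Q ^ Suc k) * (Q ^ k * gbin Q (l - 1) (Suc k)) = (1 - Q ^ Suc k) * (- qp (- 2) * gbin Q (l - 1) k)"
    using gbin_absorb[of Q k "l - 1"] by (simp add: mult_ac)
  then have "Q ^ k * gbin Q (l - 1) (Suc k) = - qp (- 2) * gbin Q (l - 1) k"
    using nz by (simp only: mult_cancel_left) simp
  then have "gbin Q (l - 1) (Suc k) = inverse (Q ^ k) * (- qp (- 2) * gbin Q (l - 1) k)"
    by (simp add: Q_def field_simps)
  also have "inverse (Q ^ k) = qp (- (2 * int k))" by (simp only: Qk qp_minus)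
  also have "qp (- (2 * int k)) * (- qp (- 2) * gbin Q (l - 1) k)
    = (- 1) ^ Suc k * (qp (- (2 * int k)) * qp (- 2) * qp (- (int k * (int k + 1))))"
    using Suc by (simp add: Q_def)
  also have "qp (- (2 * int k)) * qp (- 2) * qp (- (int k * (int k + 1))) = qp (- (int (Suc k) * (int (Suc k) + 1)))"
    by (simp only: qp_add[symmetric]) (simp add: algebra_simps)
  finally show ?case by (simp add: Q_def)
qed simp

end

section \<open>Slices of tensors\<close>

lemma tens_zero [simp]: "0 \<^bold>\<otimes> b = 0" "a \<^bold>\<otimes> 0 = 0"
  using tens_scaleC_left[of 0 0 b] tens_scaleC_right[of a 0 0] by simp_all

lemma tens_sum_left: "(\<Sum>x\<in>X. f x) \<^bold>\<otimes> b = (\<Sum>x\<in>X. f x \<^bold>\<otimes> b)"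
  by (induction X rule: infinite_finite_induct) (simp_all add: tens_add_left)

lemma tens_sum_right: "a \<^bold>\<otimes> (\<Sum>x\<in>X. f x) = (\<Sum>x\<in>X. a \<^bold>\<otimes> f x)"
  by (induction X rule: infinite_finite_induct) (simp_all add: tens_add_right)

lemma tens_power: "(a \<^bold>\<otimes> b) ^ n = a ^ n \<^bold>\<otimes> b ^ n"
  by (induction n) (simp_all add: one_tensor_def tens_times_tens)

lemma tensor_slice_tens: "clinear \<beta> \<Longrightarrow> tensor_slice \<beta> (a \<^bold>\<otimes> b) = \<beta> a *\<^sub>C b"
  unfolding tensor_slice_def
  by (rule tensor_lift_tens) (simp add: cbilinear_iff clinear_iff scaleC_add_right scaleC_add_left scaleC_scaleC mult.commute)

lemma clinear_tensor_slice: "clinear (tensor_slice \<beta>)"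
  unfolding tensor_slice_def by (rule clinear_tensor_lift)

lemmas slice_simps = clinear_add[OF clinear_tensor_slice] clinear_scale[OF clinear_tensor_slice]
  clinear_zero[OF clinear_tensor_slice] clinear_sum[OF clinear_tensor_slice]

lemma tensor_slice_mult:
  fixes t :: "('a::complex_algebra_1, 'b::complex_algebra_1) tensor"
  assumes "clinear \<beta>"
  shows "tensor_slice \<beta> (t * (a \<^bold>\<otimes> y)) = tensor_slice (\<lambda>x. \<beta> (x * a)) t * y"
    and "tensor_slice \<beta> ((a \<^bold>\<otimes> y) * t) = y * tensor_slice (\<lambda>x. \<beta> (a * x)) t"
proof -
  have lin: "clinear (\<lambda>x. \<beta> (x * a))" "clinear (\<lambda>x. \<beta> (a * x))"
    using assms by (simp_all add: clinear_iff distrib_left distrib_right mult_scaleC_left mult_scaleC_right)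
  show "tensor_slice \<beta> (t * (a \<^bold>\<otimes> y)) = tensor_slice (\<lambda>x. \<beta> (x * a)) t * y"
    by (induction t rule: tensor_induct)
      (simp_all add: slice_simps distrib_right tens_times_tens tensor_slice_tens assms lin mult_scaleC_left)
  show "tensor_slice \<beta> ((a \<^bold>\<otimes> y) * t) = y * tensor_slice (\<lambda>x. \<beta> (a * x)) t"
    by (induction t rule: tensor_induct)
      (simp_all add: slice_simps distrib_left tens_times_tens tensor_slice_tens assms lin mult_scaleC_right)
qed

lemma tensor_swap_tens: "tensor_swap (a \<^bold>\<otimes> b) = b \<^bold>\<otimes> a"
  unfolding tensor_swap_def
  by (rule tensor_lift_tens)
    (simp add: cbilinear_iff tens_add_left tens_add_right tens_scaleC_left tens_scaleC_right)

lemma clinear_tensor_swap: "clinear tensor_swap"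
  unfolding tensor_swap_def by (rule clinear_tensor_lift)

lemma calg_homD:
  assumes "calg_hom f"
  shows "clinear f" "f 1 = 1" "f (x * y) = f x * f y" "f (x ^ n) = f x ^ n"
proof -
  show *: "clinear f" "f 1 = 1" "f (x * y) = f x * f y" for x y
    using assms by (simp_all add: calg_hom_def)
  show "f (x ^ n) = f x ^ n" by (induction n) (simp_all add: *)
qed

lemma mutually_inverse_unique: "mutually_inverse x y \<Longrightarrow> mutually_inverse x z \<Longrightarrow> y = z"
  unfolding mutually_inverse_def by (metis mult.assoc mult.left_neutral mult.right_neutral)

lemma unit_inv_eqI: "mutually_inverse x y \<Longrightarrow> unit_inv x = y"
  unfolding unit_inv_def by (rule the_equality) (auto dest: mutually_inverse_unique)

section \<open>The antipode\<close>

context hopf_algebra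
begin

lemmas comult_linear = calg_homD(1)[OF comult_hom]
lemmas counit_linear = calg_homD(1)[OF counit_hom]

lemma cbilinear_mult_antipode:
  "clinear f \<Longrightarrow> clinear g \<Longrightarrow> cbilinear (\<lambda>a b. (f a :: 'a) * g b)"
  by (simp add: cbilinear_iff clinear_iff distrib_left distrib_right mult_scaleC_left mult_scaleC_right)

lemma clinear_id: "clinear (\<lambda>x. x :: 'b::complex_vector)"
  by (simp add: clinear_iff)

lemma tensor_map_tens:
  assumes "clinear f" "clinear g"
  shows "tensor_map f g (a \<^bold>\<otimes> b) = f a \<^bold>\<otimes> g b"
  unfolding tensor_map_def
  by (rule tensor_lift_tens)
    (use assms in \<open>simp add: cbilinear_iff clinear_iff tens_add_left tens_add_right tens_scaleC_left tens_scaleC_right\<close>)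

lemma tensor_assoc_tens:
  fixes t :: "('x::complex_vector, 'y::complex_vector) tensor" and c :: "'z::complex_vector"
  shows "tensor_assoc (t \<^bold>\<otimes> c) = tensor_lift (\<lambda>a b. a \<^bold>\<otimes> (b \<^bold>\<otimes> c)) t"
proof -
  have bil: "cbilinear (\<lambda>(a :: 'x) (b :: 'y). a \<^bold>\<otimes> (b \<^bold>\<otimes> c))" for c :: 'z
    by (simp add: cbilinear_iff tens_add_left tens_add_right tens_scaleC_left tens_scaleC_right)
  have "cbilinear (\<lambda>(t :: ('x, 'y) tensor) (c :: 'z). tensor_lift (\<lambda>a b. a \<^bold>\<otimes> (b \<^bold>\<otimes> c)) t)"
    unfolding cbilinear_iff
  proof (intro conjI allI)
    fix t :: "('x, 'y) tensor" and c d :: 'z and k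
    show "tensor_lift (\<lambda>a b. a \<^bold>\<otimes> (b \<^bold>\<otimes> (c + d))) t
      = tensor_lift (\<lambda>a b. a \<^bold>\<otimes> (b \<^bold>\<otimes> c)) t + tensor_lift (\<lambda>a b. a \<^bold>\<otimes> (b \<^bold>\<otimes> d)) t"
    proof (induction t rule: tensor_induct)
      case (add a b t)
      then show ?case
        by (simp only: tensor_lift_add tensor_lift_tens[OF bil]) (simp add: tens_add_right algebra_simps)
    qed (simp add: tensor_lift_zero)
    show "tensor_lift (\<lambda>a b. a \<^bold>\<otimes> (b \<^bold>\<otimes> (k *\<^sub>C c))) t = k *\<^sub>C tensor_lift (\<lambda>a b. a \<^bold>\<otimes> (b \<^bold>\<otimes> c)) t"
    proof (induction t rule: tensor_induct)
      case (add a b t)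
      then show ?case
        by (simp only: tensor_lift_add tensor_lift_tens[OF bil]) (simp add: tens_scaleC_right scaleC_add_right)
    qed (simp add: tensor_lift_zero)
  qed (simp_all add: tensor_lift_add tensor_lift_scaleC)
  then show ?thesis unfolding tensor_assoc_def by (rule tensor_lift_tens)
qed

text \<open>Convolving the hypothesis with \<open>S\<close> on the right cancels the second factor.\<close>

lemma convolution_unique:
  fixes f :: "'a \<Rightarrow> 'a"
  assumes f: "clinear f" and conv: "\<And>x. tensor_lift (\<lambda>a b. f a * b) (\<Delta> x) = \<epsilon> x *\<^sub>C c"
  shows "f x = c * S x"
proof -
  \<comment> \<open>\<open>T\<close> sends a triple tensor to \<open>f a * b * S d\<close>. By
    coassociativity it can be evaluated on the twofold coproduct in two ways, giving
    \<open>f x\<close> and \<open>c * S x\<close>.\<close>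
  define T where "T = tensor_lift (\<lambda>a t. f a * tensor_lift (\<lambda>b d. b * S d) t)"
  have bil: "cbilinear (\<lambda>a t. f a * tensor_lift (\<lambda>b d. b * S d) t)"
    using f clinear_tensor_lift[of "\<lambda>b d. b * S d"]
    by (simp add: cbilinear_iff clinear_iff distrib_left distrib_right mult_scaleC_left mult_scaleC_right)
  have T: "T (a \<^bold>\<otimes> t) = f a * tensor_lift (\<lambda>b d. b * S d) t" for a t
    unfolding T_def by (rule tensor_lift_tens[OF bil])
  have T_lin: "T (s + t) = T s + T t" "T 0 = 0" for s t
    unfolding T_def by (rule tensor_lift_add, rule tensor_lift_zero)
  have bS: "tensor_lift (\<lambda>b d. b * S d) (b \<^bold>\<otimes> d) = b * S d" for b d
    by (rule tensor_lift_tens[OF cbilinear_mult_antipode[OF clinear_id antipode_linear]])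
  have fb: "tensor_lift (\<lambda>a b. f a * b) (a \<^bold>\<otimes> b) = f a * b" for a b
    by (rule tensor_lift_tens[OF cbilinear_mult_antipode[OF f clinear_id]])
  have bil2: "cbilinear (\<lambda>a b. \<epsilon> b *\<^sub>C a)" "cbilinear (\<lambda>a b. a \<^bold>\<otimes> (b \<^bold>\<otimes> d))" for d :: 'a
    using counit_linear
    by (simp_all add: cbilinear_iff clinear_iff scaleC_add_right scaleC_add_left scaleC_scaleC mult.commute
        tens_add_left tens_add_right tens_scaleC_left tens_scaleC_right)
  have map_lin: "tensor_map g h (s + t) = tensor_map g h s + tensor_map g h t" "tensor_map g h 0 = 0"
    for g :: "'a \<Rightarrow> 'c::complex_vector" and h :: "'a \<Rightarrow> 'd::complex_vector" and s t
    unfolding tensor_map_def by (rule tensor_lift_add, rule tensor_lift_zero)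
  have assoc_lin: "tensor_assoc (s + t) = tensor_assoc s + tensor_assoc t" "tensor_assoc 0 = 0"
    for s t :: "(('a, 'a) tensor, 'a) tensor"
    unfolding tensor_assoc_def by (rule tensor_lift_add, rule tensor_lift_zero)
  have id: "clinear (id :: 'a \<Rightarrow> 'a)" by (simp add: clinear_iff)
  have 1: "T (tensor_map id \<Delta> t) = f (tensor_lift (\<lambda>a b. \<epsilon> b *\<^sub>C a) t)" for t
    by (induction t rule: tensor_induct)
      (simp_all add: map_lin T_lin tensor_lift_zero tensor_lift_add clinear_zero[OF f] clinear_add[OF f]
        tensor_map_tens[OF id comult_linear] tensor_map_tens[OF clinear_id comult_linear] T antipode_right tensor_lift_tens[OF bil2(1)]
        clinear_scale[OF f] mult_scaleC_right)
  have 2: "T (tensor_assoc (u \<^bold>\<otimes> d)) = tensor_lift (\<lambda>a b. f a * b) u * S d" for u d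
    unfolding tensor_assoc_tens
    by (induction u rule: tensor_induct)
      (simp_all add: T_lin tensor_lift_zero tensor_lift_add tensor_lift_tens[OF bil2(2)] T bS fb distrib_right mult.assoc)
  have 3: "T (tensor_assoc (tensor_map \<Delta> id t)) = c * S (tensor_slice \<epsilon> t)" for t
    by (induction t rule: tensor_induct)
      (simp_all add: map_lin assoc_lin T_lin slice_simps clinear_zero[OF antipode_linear]
        clinear_add[OF antipode_linear] clinear_scale[OF antipode_linear] tensor_map_tens[OF comult_linear id] tensor_map_tens[OF comult_linear clinear_id]
        2 conv tensor_slice_tens[OF counit_linear] distrib_left mult_scaleC_left mult_scaleC_right)
  have "f x = T (tensor_map id \<Delta> (\<Delta> x))" by (simp add: 1 counit_right)
  also have "\<dots> = c * S x" by (simp add: coassoc[symmetric] 3 counit_left)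
  finally show ?thesis .
qed

lemma lift_mult_right:
  fixes f :: "'a \<Rightarrow> 'a"
  assumes "clinear f"
  shows "tensor_lift (\<lambda>a b. f a * b) (t * (y \<^bold>\<otimes> z)) = tensor_lift (\<lambda>a b. f (a * y) * b) t * z"
proof -
  have "clinear (\<lambda>a. f (a * y))"
    using assms by (simp add: clinear_iff distrib_right mult_scaleC_left)
  note bil = cbilinear_mult_antipode[OF assms clinear_id] cbilinear_mult_antipode[OF this clinear_id]
  show ?thesis
    by (induction t rule: tensor_induct)
      (simp_all add: tensor_lift_zero tensor_lift_add tensor_lift_tens[OF bil(1)] tensor_lift_tens[OF bil(2)]
        distrib_right tens_times_tens mult.assoc)
qed

end

lemma (in root_of_unity) q_binomial_top:
  fixes A B :: "'a::complex_algebra_1"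
  assumes "B * A = q\<^sup>2 *\<^sub>C (A * B)"
  shows "(A + B) ^ (l - 1) = (\<Sum>k<l. ((- 1) ^ k * qp (- (int k * (int k + 1)))) *\<^sub>C (A ^ (l - 1 - k) * B ^ k))"
proof -
  have L: "{..l - 1} = {..<l}" using l_ge by auto
  show ?thesis
    unfolding q_binomial_theorem[OF assms] L
  proof (intro sum.cong refl)
    fix k assume "k \<in> {..<l}"
    then have "k < l" by simp
    then show "gbin (q\<^sup>2) (l - 1) k *\<^sub>C (A ^ (l - 1 - k) * B ^ k)
      = ((- 1) ^ k * qp (- (int k * (int k + 1)))) *\<^sub>C (A ^ (l - 1 - k) * B ^ k)"
      by (simp only: gbin_top)
  qed
qed

locale small_quantum_sl2_root = small_quantum_sl2 \<Delta> \<epsilon> S l q E F K + root_of_unity l q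
  for \<Delta> :: "'a::complex_algebra_1 \<Rightarrow> ('a, 'a) tensor" and \<epsilon> S l q E F K
begin

abbreviation Ki :: 'a where "Ki \<equiv> unit_inv K"

lemma K_inverse: "mutually_inverse K Ki"
proof -
  have "mutually_inverse K (K ^ (l - 1))"
    using K_pow l_ge unfolding mutually_inverse_def
    by (metis One_nat_def Suc_pred l_pos of_nat_0_less_iff power_Suc power_Suc2)
  then show ?thesis using unit_inv_eqI by fastforce
qed

sublocale uq_algebra l q E F K Ki
  by unfold_locales
    (use K_inverse E_pow F_pow K_pow KE KF EF generated dimension in \<open>simp_all add: mutually_inverse_def\<close>)

section \<open>The square of the antipode\<close>

lemma antipode_1: "S 1 = 1"
proof -
  have "tensor_lift (\<lambda>a b. S a * b) (1 \<^bold>\<otimes> 1) = S 1 * 1"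
    by (rule tensor_lift_tens[OF cbilinear_mult_antipode[OF antipode_linear clinear_id]])
  then show ?thesis using antipode_left[of 1] calg_homD(2)[OF comult_hom] calg_homD(2)[OF counit_hom]
    by (simp add: one_tensor_def scaleC_one)
qed

lemma counit_mult: "\<epsilon> (x * y) = \<epsilon> x * \<epsilon> y"
  by (rule calg_homD(3)[OF counit_hom])

lemma comult_mult: "\<Delta> (x * y) = \<Delta> x * \<Delta> y"
  by (rule calg_homD(3)[OF comult_hom])

lemma clinear_antipode_mult: "clinear (\<lambda>x. S (x * y))"
  using antipode_linear by (simp add: clinear_iff distrib_right mult_scaleC_left)

text \<open>Antimultiplicativity is derived one generator at a time: the antipode axiom for
  \<open>x * K\<close> identifies the convolution of \<open>S (x * K)\<close> with the identity, and
  \<open>convolution_unique\<close> recovers the map.\<close>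

lemma antipode_mult_K: "S (x * K) = Ki * S x"
proof (rule convolution_unique[OF clinear_antipode_mult])
  fix x
  have "\<epsilon> x *\<^sub>C 1 = tensor_lift (\<lambda>a b. S (a * K) * b) (\<Delta> x) * K"
    using antipode_left[of "x * K"]
    by (simp add: comult_mult comult_K counit_mult counit_K lift_mult_right[OF antipode_linear])
  then have "\<epsilon> x *\<^sub>C 1 * Ki = tensor_lift (\<lambda>a b. S (a * K) * b) (\<Delta> x) * (K * Ki)" by (simp only: mult.assoc)
  then show "tensor_lift (\<lambda>a b. S (a * K) * b) (\<Delta> x) = \<epsilon> x *\<^sub>C Ki" by (simp add: K_Ki mult_scaleC_left)
qed

lemma antipode_mult_Ki: "S (x * Ki) = K * S x"
proof -
  have "Ki * S (x * Ki) = S x" using antipode_mult_K[of "x * Ki"] by (simp add: mult.assoc Ki_K)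
  then have "K * (Ki * S (x * Ki)) = K * S x" by simp
  then show ?thesis by (simp add: mult.assoc[symmetric] K_Ki)
qed

lemma antipode_mult_E: "S (x * E) = S E * S x"
proof (rule convolution_unique[OF clinear_antipode_mult])
  fix x
  let ?T = "tensor_lift (\<lambda>a b. S (a * E) * b) (\<Delta> x)"
  have "0 = \<epsilon> x *\<^sub>C E + ?T * K"
    using antipode_left[of "x * E"]
    by (simp add: comult_mult comult_E counit_mult counit_E lift_mult_right[OF antipode_linear]
        distrib_left tensor_lift_add antipode_left mult_scaleC_left)
  then have "0 = (\<epsilon> x *\<^sub>C E + ?T * K) * Ki" by simp
  then have "0 = \<epsilon> x *\<^sub>C (E * Ki) + ?T" by (simp add: distrib_right mult.assoc K_Ki mult_scaleC_left)
  then show "?T = \<epsilon> x *\<^sub>C S E" by (simp add: antipode_E eq_neg_iff_add_eq_0 add.commute)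
qed

lemma antipode_mult_F: "S (x * F) = S F * S x"
proof (rule convolution_unique[OF clinear_antipode_mult])
  fix x
  let ?T = "tensor_lift (\<lambda>a b. S (a * F) * b) (\<Delta> x)"
  \<comment> \<open>The term \<open>Ki \<otimes> F\<close> of the coproduct produces
    \<open>S (a * Ki) = K * S a\<close>, so the rule for \<open>Ki\<close> enters before the axiom
    can be applied.\<close>
  have lin: "clinear (\<lambda>a. K * S a)"
    using antipode_linear by (simp add: clinear_iff distrib_left mult_scaleC_right)
  have "tensor_lift (\<lambda>a b. K * S a * b) t = K * tensor_lift (\<lambda>a b. S a * b) t" for t
    by (induction t rule: tensor_induct)
      (simp_all add: tensor_lift_zero tensor_lift_add tensor_lift_tens[OF cbilinear_mult_antipode[OF lin clinear_id], unfolded mult.assoc]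
        tensor_lift_tens[OF cbilinear_mult_antipode[OF antipode_linear clinear_id]] distrib_left mult.assoc)
  then have "0 = \<epsilon> x *\<^sub>C (K * F) + ?T"
    using antipode_left[of "x * F"]
    by (simp add: comult_mult comult_F counit_mult counit_F lift_mult_right[OF antipode_linear]
        distrib_left tensor_lift_add antipode_left antipode_mult_Ki mult_scaleC_left mult_scaleC_right)
  then show "?T = \<epsilon> x *\<^sub>C S F" by (simp add: antipode_F eq_neg_iff_add_eq_0 add.commute)
qed

lemma antipode_mult: "S (x * y) = S y * S x"
proof -
  have "y \<in> subalgebra_generated {E, F, K}" by (simp add: generated)
  then show ?thesis
  proof (induction arbitrary: x rule: subalgebra_generated.induct)
    case (mult y z)
    have "S (x * (y * z)) = S z * S (x * y)" using mult(4)[of "x * y"] by (simp add: mult.assoc)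
    then show ?case by (simp add: mult mult.assoc)
  qed (auto simp: antipode_mult_E antipode_mult_F antipode_mult_K antipode_K antipode_1 distrib_left distrib_right
      mult_scaleC_left mult_scaleC_right clinear_add[OF antipode_linear] clinear_scale[OF antipode_linear])
qed

lemma antipode_Ki: "S Ki = K"
  using antipode_mult_Ki[of 1] by (simp add: antipode_1)

text \<open>Both sides are algebra homomorphisms that agree on generators. This turns the definition
  of \<open>qcharacters\<close> into a trace condition twisted by conjugation with
  \<open>K\<close>.\<close>

lemma antipode_squared: "S (S y) = K * y * Ki"
proof -
  have "y \<in> subalgebra_generated {E, F, K}" by (simp add: generated)
  then show ?thesis
  proof (induction rule: subalgebra_generated.induct)
    case (base x)
    then consider "x = E" | "x = F" | "x = K" by blast
    then show ?case
      by cases (simp_all add: antipode_E antipode_F antipode_K antipode_Ki clinear_minus[OF antipode_linear]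
        antipode_mult mult.assoc K_Ki)
  next
    case (mult x y)
    have "S (S (x * y)) = K * x * (Ki * K) * y * Ki" by (simp only: antipode_mult mult mult.assoc)
    then show ?case by (simp add: Ki_K mult.assoc)
  qed (simp_all add: antipode_1 K_Ki clinear_scale[OF antipode_linear] clinear_add[OF antipode_linear]
      distrib_left distrib_right mult_scaleC_left mult_scaleC_right)
qed

lemma qcharacters_iff:
  "\<beta> \<in> qcharacters S \<longleftrightarrow> clinear \<beta> \<and> (\<forall>x y. \<beta> (x * y) = \<beta> (K * y * Ki * x))"
  by (simp add: qcharacters_def antipode_squared)

section \<open>The coproduct of the integral\<close>

lemma comult_E_power:
  "\<Delta> E ^ (l - 1) = (\<Sum>k<l. ((- 1) ^ k * qp (- (int k * (int k + 1)))) *\<^sub>C (E ^ k \<^bold>\<otimes> (E ^ (l - 1 - k) * K ^ k)))"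
proof -
  have "(E \<^bold>\<otimes> K) * (1 \<^bold>\<otimes> E) = q\<^sup>2 *\<^sub>C ((1 \<^bold>\<otimes> E) * (E \<^bold>\<otimes> K))"
    by (simp add: tens_times_tens KE tens_scaleC_right)
  from q_binomial_top[OF this] show ?thesis
    unfolding comult_E by (simp add: tens_power tens_times_tens)
qed

text \<open>The q-binomial sum is reversed so that \<open>k\<close> counts the powers of
  \<open>F\<close> in the first leg. The coefficients are symmetric under this reversal because
  \<open>l - 1\<close> is even and the exponents agree modulo \<open>l\<close>.\<close>

lemma comult_F_power:
  "\<Delta> F ^ (l - 1) = (\<Sum>k<l. ((- 1) ^ k * qp (- (int k * (int k + 1)))) *\<^sub>C ((F ^ k * Ki ^ (l - 1 - k)) \<^bold>\<otimes> F ^ (l - 1 - k)))"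
proof -
  have "Ki * F = q\<^sup>2 *\<^sub>C (F * Ki)" using Kp_F[of "- 1"] by simp
  then have "(Ki \<^bold>\<otimes> F) * (F \<^bold>\<otimes> 1) = q\<^sup>2 *\<^sub>C ((F \<^bold>\<otimes> 1) * (Ki \<^bold>\<otimes> F))"
    by (simp add: tens_times_tens tens_scaleC_left)
  note binom = q_binomial_top[OF this]
  define f where "f k = ((- 1) ^ k * qp (- (int k * (int k + 1)))) *\<^sub>C ((F ^ (l - 1 - k) * Ki ^ k) \<^bold>\<otimes> F ^ k)" for k
  have "\<Delta> F ^ (l - 1) = (\<Sum>k<l. f k)"
    unfolding comult_F add.commute[of "Ki \<^bold>\<otimes> F"] binom
    by (simp add: f_def tens_power tens_times_tens)
  also have "\<dots> = (\<Sum>k<l. f (l - Suc k))" by (rule sum.nat_diff_reindex[symmetric])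
  also have "\<dots> = (\<Sum>k<l. ((- 1) ^ k * qp (- (int k * (int k + 1)))) *\<^sub>C ((F ^ k * Ki ^ (l - 1 - k)) \<^bold>\<otimes> F ^ (l - 1 - k)))"
  proof (intro sum.cong refl)
    fix k assume "k \<in> {..<l}"
    then have k: "k < l" "l - 1 - (l - Suc k) = k" by auto
    have "even (l - Suc k) \<longleftrightarrow> even k" using l_odd k(1) by presburger
    then have s: "(- 1 :: complex) ^ (l - Suc k) = (- 1) ^ k" by (simp add: uminus_power_if)
    have i: "int (l - Suc k) = int l - int k - 1" using k by (simp add: of_nat_diff)
    have "qp (- (int (l - Suc k) * (int (l - Suc k) + 1))) = qp (- (int k * (int k + 1)))"
    proof (rule qp_cong)
      have "- (int (l - Suc k) * (int (l - Suc k) + 1)) - - (int k * (int k + 1)) = int l * (2 * int k + 1 - int l)"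
        unfolding i by (simp add: algebra_simps)
      then show "int l dvd - (int (l - Suc k) * (int (l - Suc k) + 1)) - - (int k * (int k + 1))" by simp
    qed
    then show "f (l - Suc k) = ((- 1) ^ k * qp (- (int k * (int k + 1)))) *\<^sub>C ((F ^ k * Ki ^ (l - 1 - k)) \<^bold>\<otimes> F ^ (l - 1 - k))"
      unfolding f_def s k(2) by simp
  qed
  finally show ?thesis .
qed

text \<open>The normalization of the integral times \<open>l\<close>, the factor left by the sum
  over powers of \<open>K\<close>.\<close>

definition zeta_l :: complex
  where "zeta_l = complex_of_real (sqrt (real l)) / (qfact q (l - 1))\<^sup>2 * of_nat l"

abbreviation Lam :: 'a where "Lam \<equiv> integral_elem l q E F K"

text \<open>The first two terms come from the q-binomial coefficients of the powers of
  \<open>F\<close> and \<open>E\<close>; the other two from evaluating the powers of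
  \<open>Ki\<close> and \<open>K\<close> on weight spaces.\<close>

definition integral_exponent :: "int \<Rightarrow> int \<Rightarrow> int \<Rightarrow> int"
  where "integral_exponent i j w = - (i * (i + 1)) - j * (j + 1) + (i + 1) * (1 - 2 * w + 2 * j) + (2 * w - 1) * j"

lemma comult_integral:
  "\<Delta> Lam * (1 \<^bold>\<otimes> pr w) = (\<Sum>i<l. \<Sum>j<l.
    (zeta_l * (- 1) ^ (i + j) * qp (integral_exponent (int i) (int j) w)) *\<^sub>C
      ((F ^ i * E ^ j * pr (1 - w)) \<^bold>\<otimes> (F ^ (l - 1 - i) * E ^ (l - 1 - j) * pr w)))" (is "_ = ?rhs")
proof -
  define z where "z = complex_of_real (sqrt (real l)) / (qfact q (l - 1))\<^sup>2"
  define g where "g k = (- 1) ^ k * qp (- (int k * (int k + 1)))" for k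
  \<comment> \<open>Only opposite \<open>K\<close>-weights survive the sum: weight \<open>w\<close>
    in the second leg forces weight \<open>1 - w\<close> in the first.\<close>
  have Ksum: "(\<Sum>j<l. \<Delta> K ^ j) * (1 \<^bold>\<otimes> pr w) = of_nat l *\<^sub>C (pr (1 - w) \<^bold>\<otimes> pr w)"
  proof -
    have "(\<Sum>j<l. \<Delta> K ^ j) * (1 \<^bold>\<otimes> pr w) = (\<Sum>j<l. Kp (int j) \<^bold>\<otimes> (Kp (int j) * pr w))"
      by (simp add: comult_K sum_distrib_right tens_power tens_times_tens Kp_of_nat)
    also have "\<dots> = (\<Sum>j<l. qp ((2 * w - 1) * int j) *\<^sub>C Kp (int j)) \<^bold>\<otimes> pr w"
      by (simp add: Kp_pr tens_scaleC_right tens_scaleC_left tens_sum_left)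
    also have "(\<Sum>j<l. qp ((2 * w - 1) * int j) *\<^sub>C Kp (int j)) = of_nat l *\<^sub>C pr (1 - w)"
      by (simp add: pr_def scaleC_scaleC scaleC_one sum_residues_lessThan algebra_simps)
    finally show ?thesis by (simp add: tens_scaleC_left)
  qed
  have Epart: "\<Delta> E ^ (l - 1) * (pr (1 - w) \<^bold>\<otimes> pr w)
    = (\<Sum>j<l. (g j * qp ((2 * w - 1) * int j)) *\<^sub>C ((E ^ j * pr (1 - w)) \<^bold>\<otimes> (E ^ (l - 1 - j) * pr w)))"
    unfolding comult_E_power g_def
    by (simp add: sum_distrib_right mult_scaleC_left tens_times_tens mult.assoc Kp_of_nat[symmetric]
        Kp_pr mult_scaleC_right tens_scaleC_right scaleC_scaleC)
  \<comment> \<open>Since \<open>K^l = 1\<close>, the power of \<open>Ki\<close> is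
    \<open>K^(i + 1)\<close>; the off-by-one explains the factor \<open>i + 1\<close> in the
    exponent.\<close>
  have Kin: "Ki ^ (l - 1 - i) * (E ^ j * pr (1 - w)) = qp ((int i + 1) * (1 - 2 * w + 2 * int j)) *\<^sub>C (E ^ j * pr (1 - w))"
    if "i < l" for i j
  proof -
    have "Ki ^ (l - 1 - i) * (E ^ j * pr (1 - w)) = Kp (- int (l - 1 - i)) * pr (1 - w + int j) * E ^ j"
      by (simp only: Kp_minus_power E_pow_pr mult.assoc)
    also have "Kp (- int (l - 1 - i)) = Kp (int i + 1)"
      by (rule periodicD[OF periodic_Kp]) (use that in \<open>simp add: of_nat_diff\<close>)
    also have "Kp (int i + 1) * pr (1 - w + int j) * E ^ j
      = qp ((2 * (1 - w + int j) - 1) * (int i + 1)) *\<^sub>C (E ^ j * pr (1 - w))"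
      by (simp only: Kp_pr mult_scaleC_left E_pow_pr)
    also have "(2 * (1 - w + int j) - 1) * (int i + 1) = (int i + 1) * (1 - 2 * w + 2 * int j)"
      by (simp add: algebra_simps)
    finally show ?thesis .
  qed
  have Fpart: "\<Delta> F ^ (l - 1) * ((E ^ j * pr (1 - w)) \<^bold>\<otimes> y)
    = (\<Sum>i<l. (g i * qp ((int i + 1) * (1 - 2 * w + 2 * int j))) *\<^sub>C ((F ^ i * E ^ j * pr (1 - w)) \<^bold>\<otimes> (F ^ (l - 1 - i) * y)))"
    for j y
    unfolding comult_F_power sum_distrib_right
  proof (intro sum.cong refl)
    fix i assume "i \<in> {..<l}"
    then have "i < l" by simp
    then have "F ^ i * Ki ^ (l - 1 - i) * (E ^ j * pr (1 - w))
      = qp ((int i + 1) * (1 - 2 * w + 2 * int j)) *\<^sub>C (F ^ i * E ^ j * pr (1 - w))"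
      by (simp only: mult.assoc Kin mult_scaleC_right)
    then show "(((- 1) ^ i * qp (- (int i * (int i + 1)))) *\<^sub>C ((F ^ i * Ki ^ (l - 1 - i)) \<^bold>\<otimes> F ^ (l - 1 - i)))
        * ((E ^ j * pr (1 - w)) \<^bold>\<otimes> y)
      = (g i * qp ((int i + 1) * (1 - 2 * w + 2 * int j))) *\<^sub>C ((F ^ i * E ^ j * pr (1 - w)) \<^bold>\<otimes> (F ^ (l - 1 - i) * y))"
      by (simp only: mult_scaleC_left tens_times_tens tens_scaleC_left scaleC_scaleC g_def)
  qed
  have "\<Delta> Lam = z *\<^sub>C (\<Delta> F ^ (l - 1) * (\<Delta> E ^ (l - 1) * (\<Sum>j<l. \<Delta> K ^ j)))"
    unfolding integral_elem_def z_def
    by (simp add: clinear_scale[OF comult_linear] comult_mult calg_homD(4)[OF comult_hom]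
        clinear_sum[OF comult_linear] mult.assoc)
  then have "\<Delta> Lam * (1 \<^bold>\<otimes> pr w) = (z * of_nat l) *\<^sub>C (\<Delta> F ^ (l - 1) * (\<Delta> E ^ (l - 1) * (pr (1 - w) \<^bold>\<otimes> pr w)))"
    by (simp only: mult_scaleC_left mult.assoc Ksum mult_scaleC_right scaleC_scaleC)
  also have "\<dots> = (\<Sum>j<l. \<Sum>i<l. (z * of_nat l * (g j * qp ((2 * w - 1) * int j)) * (g i * qp ((int i + 1) * (1 - 2 * w + 2 * int j)))) *\<^sub>C
      ((F ^ i * E ^ j * pr (1 - w)) \<^bold>\<otimes> (F ^ (l - 1 - i) * E ^ (l - 1 - j) * pr w)))"
    by (simp only: Epart sum_distrib_left mult_scaleC_right Fpart cvs.scale_sum_right scaleC_scaleC mult.assoc)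
  also have "\<dots> = (\<Sum>i<l. \<Sum>j<l. (z * of_nat l * (g j * qp ((2 * w - 1) * int j)) * (g i * qp ((int i + 1) * (1 - 2 * w + 2 * int j)))) *\<^sub>C
      ((F ^ i * E ^ j * pr (1 - w)) \<^bold>\<otimes> (F ^ (l - 1 - i) * E ^ (l - 1 - j) * pr w)))"
    by (rule sum.swap)
  also have "\<dots> = ?rhs"
  proof (intro sum.cong refl arg_cong2[where f = scaleC])
    fix i j
    have "qp (integral_exponent (int i) (int j) w) = qp (- (int j * (int j + 1))) * qp ((2 * w - 1) * int j)
      * (qp (- (int i * (int i + 1))) * qp ((int i + 1) * (1 - 2 * w + 2 * int j)))"
      by (simp only: qp_add[symmetric]) (simp add: integral_exponent_def algebra_simps)
    then show "z * of_nat l * (g j * qp ((2 * w - 1) * int j)) * (g i * qp ((int i + 1) * (1 - 2 * w + 2 * int j)))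
      = zeta_l * (- 1) ^ (i + j) * qp (integral_exponent (int i) (int j) w)"
      by (simp only: g_def zeta_l_def z_def power_add mult_ac)
  qed
  finally show ?thesis .
qed

end

context small_quantum_sl2_root
begin

section \<open>The Radford map\<close>

lemma qint_nz: "0 < k \<Longrightarrow> k < int l \<Longrightarrow> qint q k \<noteq> 0"
proof
  assume k: "0 < k" "k < int l" "qint q k = 0"
  then have "qp k = qp (- k)" using dl_nz by (simp add: qint_def dl_def)
  then have "int l dvd 2 * k" by (simp add: qp_eq_iff)
  then show False using k zdvd_imp_le[of "int l" k] by (simp add: dvd_2_mult)
qed

lemma qfact_nz: "n < l \<Longrightarrow> qfact q n \<noteq> 0"
  unfolding qfact_def prod_zero_iff[OF finite_atLeastAtMost] using qint_nz by fastforce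

lemma zeta_l_nz: "zeta_l \<noteq> 0"
  using qfact_nz[of "l - 1"] l_ge by (simp add: zeta_l_def)

lemma eq_if_pr_eq: "(\<And>w. x * pr w = y * pr w) \<Longrightarrow> x = y"
proof -
  assume "\<And>w. x * pr w = y * pr w"
  then have "x * (\<Sum>w\<in>residues. pr w) = y * (\<Sum>w\<in>residues. pr w)" by (simp add: sum_distrib_left)
  then show ?thesis by (simp add: sum_pr)
qed

lemma slice_mult_pr:
  assumes "clinear \<beta>"
  shows "tensor_slice \<beta> t * pr w = tensor_slice \<beta> (t * (1 \<^bold>\<otimes> pr w))"
  by (simp add: tensor_slice_mult(1)[OF assms])

lemma radford_pr:
  assumes "clinear \<beta>"
  shows "radford_map \<Delta> Lam \<beta> * pr w = (\<Sum>i<l. \<Sum>j<l.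
    (zeta_l * (- 1) ^ (i + j) * qp (integral_exponent (int i) (int j) w) * \<beta> (F ^ i * E ^ j * pr (1 - w))) *\<^sub>C
      (F ^ (l - 1 - i) * E ^ (l - 1 - j) * pr w))"
  unfolding radford_map_def slice_mult_pr[OF assms] comult_integral
  by (simp add: slice_simps tensor_slice_tens[OF assms] scaleC_scaleC del: scaleC_complex)

lemma up_nodes_reflect: "up_nodes m (1 - w) = down_nodes m w"
  unfolding up_nodes_def down_nodes_def
proof (intro prod.cong refl)
  fix i
  have "1 - w + int i = - (w - 1 - int i)" by simp
  then show "nd (1 - w + int i) = nd (w - 1 - int i)" by (simp only: ch_neg)
qed

text \<open>The trace is zero off the diagonal \<open>k = i\<close>. On the diagonal all powers of
  \<open>q\<close> cancel, and the remaining sum over \<open>i\<close> is the divided difference of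
  \<open>Psi\<close> at \<open>ch j\<close>.\<close>

lemma radford_mu: "radford_map \<Delta> Lam (mu j) = (zeta_l / dl ^ (2 * (l - 1))) *\<^sub>C ec j"
proof (rule eq_if_pr_eq)
  fix w
  have "radford_map \<Delta> Lam (mu j) * pr w = (\<Sum>i<l. \<Sum>k<l. if k = i then
      (zeta_l / dl ^ (2 * (l - 1)) * poly (down_nodes i w) (ch j)) *\<^sub>C (ev (up_nodes (l - 1 - i) w) * pr w) else 0)"
    unfolding radford_pr[OF mu]
  proof (intro sum.cong refl)
    fix i k assume "i \<in> {..<l}" "k \<in> {..<l}"
    then have ik: "i < l" "k < l" by auto
    let ?c = "zeta_l * (- 1) ^ (i + k) * qp (integral_exponent (int i) (int k) w) * mu j (F ^ i * E ^ k * pr (1 - w))"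
    show "?c *\<^sub>C (F ^ (l - 1 - i) * E ^ (l - 1 - k) * pr w) = (if k = i then
      (zeta_l / dl ^ (2 * (l - 1)) * poly (down_nodes i w) (ch j)) *\<^sub>C (ev (up_nodes (l - 1 - i) w) * pr w) else 0)"
    proof (cases "k = i")
      case True
      have "integral_exponent (int i) (int i) w + (1 - 2 * (1 - w)) = 0"
        by (simp add: integral_exponent_def algebra_simps)
      then have "qp (integral_exponent (int i) (int i) w) * qp (1 - 2 * (1 - w)) = 1"
        unfolding qp_add[symmetric] by simp
      moreover have "(- 1 :: complex) ^ (i + i) = 1" by (simp flip: mult_2)
      moreover have "dl ^ (2 * (l - 1)) = dl ^ (2 * i) * dl ^ (2 * (l - 1 - i))"
        using ik by (simp flip: power_add distrib_left)
      ultimately have "?c * (1 / dl ^ (2 * (l - 1 - i))) = zeta_l / dl ^ (2 * (l - 1)) * poly (down_nodes i w) (ch j)"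
        unfolding True mu_pbw[OF ik(1) ik(1)] up_nodes_reflect by (simp add: field_simps)
      then show ?thesis unfolding True FE_pow_pr scaleC_scaleC by simp
    qed (use ik in \<open>simp add: mu_pbw\<close>)
  qed
  also have "\<dots> = (\<Sum>i<l. (zeta_l / dl ^ (2 * (l - 1)) * poly (down_nodes i w) (ch j)) *\<^sub>C (ev (up_nodes (l - 1 - i) w) * pr w))"
    by (intro sum.cong refl) simp
  also have "\<dots> = (zeta_l / dl ^ (2 * (l - 1))) *\<^sub>C
      (ev (\<Sum>i<l. smult (poly (down_nodes i w) (ch j)) (up_nodes (l - 1 - i) w)) * pr w)"
    by (simp only: alg_eval_sum alg_eval_smult sum_distrib_right mult_scaleC_left cvs.scale_sum_right scaleC_scaleC)
  finally show "radford_map \<Delta> Lam (mu j) * pr w = (zeta_l / dl ^ (2 * (l - 1))) *\<^sub>C ec j * pr w"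
    by (simp only: divided_difference_up ec_def mult_scaleC_left)
qed

text \<open>The coefficients of the image in the PBW basis are, up to order and nonzero factors, all
  the basis values of \<open>\<beta>\<close>.\<close>

lemma radford_zero:
  assumes \<beta>: "clinear \<beta>" and z: "radford_map \<Delta> Lam \<beta> = 0"
  shows "\<beta> x = 0"
proof (induction x rule: pbw_induct)
  case (pbw i j v)
  define w where "w = (1 - v) mod int l"
  define c where "c i j = zeta_l * (- 1) ^ (i + j) * qp (integral_exponent (int i) (int j) w) * \<beta> (F ^ i * E ^ j * pr (1 - w))" for i j
  have w: "w \<in> residues" using l_pos by (simp add: w_def)
  have "(\<Sum>m<l. \<Sum>n<l. \<Sum>u\<in>residues. (if u = w then c (l - Suc m) (l - Suc n) else 0) *\<^sub>C (F ^ m * E ^ n * pr u))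
    = (\<Sum>m<l. \<Sum>n<l. c (l - Suc m) (l - Suc n) *\<^sub>C (F ^ m * E ^ n * pr w))"
  proof (intro sum.cong refl)
    fix m n
    have "(\<Sum>u\<in>residues. (if u = w then c (l - Suc m) (l - Suc n) else 0) *\<^sub>C (F ^ m * E ^ n * pr u))
      = (\<Sum>u\<in>residues. if u = w then c (l - Suc m) (l - Suc n) *\<^sub>C (F ^ m * E ^ n * pr u) else 0)"
      by (intro sum.cong) auto
    then show "(\<Sum>u\<in>residues. (if u = w then c (l - Suc m) (l - Suc n) else 0) *\<^sub>C (F ^ m * E ^ n * pr u))
      = c (l - Suc m) (l - Suc n) *\<^sub>C (F ^ m * E ^ n * pr w)" using w by simp
  qed
  also have "\<dots> = (\<Sum>m<l. \<Sum>n<l. c (l - Suc m) (l - Suc n) *\<^sub>C (F ^ (l - 1 - (l - Suc m)) * E ^ (l - 1 - (l - Suc n)) * pr w))"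
    by (intro sum.cong refl) simp
  also have "\<dots> = (\<Sum>m<l. \<Sum>n<l. c m n *\<^sub>C (F ^ (l - 1 - m) * E ^ (l - 1 - n) * pr w))"
    by (subst sum.nat_diff_reindex, subst sum.nat_diff_reindex) simp
  also have "\<dots> = 0" using radford_pr[OF \<beta>, of w] z by (simp add: c_def)
  finally have "(if w = w then c (l - Suc (l - Suc i)) (l - Suc (l - Suc j)) else 0) = 0"
    by (rule pbw_zero[where a = "\<lambda>m n u. if u = w then c (l - Suc m) (l - Suc n) else 0"]) (use pbw w in auto)
  then have "c i j = 0" using pbw by (simp add: Suc_diff_Suc)
  then have "\<beta> (F ^ i * E ^ j * pr (1 - w)) = 0" by (simp add: c_def zeta_l_nz)
  moreover have "pr (1 - w) = pr v"
    by (rule periodicD[OF periodic_pr]) (simp add: w_def mod_eq_dvd_iff[symmetric] mod_simps)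
  ultimately show ?case by simp
qed (simp_all add: clinear_add[OF \<beta>] clinear_scale_complex[OF \<beta>] del: scaleC_complex)

section \<open>The Higman ideal\<close>

lemma antipode_power: "S (x ^ n) = S x ^ n"
  by (induction n) (simp_all add: antipode_1 antipode_mult power_commutes)

lemma antipode_pr: "S (pr w) = pr (1 - w)"
proof -
  have Kp: "S (Kp j) = Kp (- j)" for j
  proof -
    have "S (Kp j) = Kp (- (j mod int l))"
      unfolding Kp_def[of j] antipode_power antipode_K Kp_minus_power using l_pos by simp
    also have "\<dots> = Kp (- j)"
      by (rule periodicD[OF periodic_Kp]) (simp add: mod_eq_dvd_iff[symmetric] mod_minus_cong)
    finally show ?thesis .
  qed
  define g where "g j = qp (- ((2 * (1 - w) - 1) * j)) *\<^sub>C Kp j" for j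
  have per: "periodic (\<lambda>j. qp (- ((2 * (1 - w) - 1) * j)))"
    using periodic_qp[of "- (2 * (1 - w) - 1)" 0] by (simp only: add_0_right mult_minus_left)
  have g: "periodic g"
    unfolding g_def by (intro periodic_scaleC per periodic_Kp)
  have "S (pr w) = (1 / of_nat l) *\<^sub>C (\<Sum>j\<in>residues. g (0 - j))"
    unfolding pr_def clinear_scale[OF antipode_linear] clinear_sum[OF antipode_linear] Kp g_def
    by (simp add: algebra_simps)
  also have "\<dots> = pr (1 - w)" unfolding sum_residues_reflect[OF g] by (simp add: pr_def g_def)
  finally show ?thesis .
qed

lemma pr_antipode_E_power:
  "pr (1 - w) * S E ^ b = ((- 1) ^ b * qp (2 * w * int b + int b * int b)) *\<^sub>C (pr (1 - w) * E ^ b)"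
proof (induction b)
  case (Suc b)
  have E: "pr u * S E = (- qp (3 - 2 * u)) *\<^sub>C (pr u * E)" for u
  proof -
    have "pr u * E = E * pr (u - 1)" using E_pr[of "u - 1"] by simp
    then have "pr u * S E = - (E * (pr (u - 1) * Ki))" by (simp add: antipode_E mult.assoc[symmetric])
    also have "\<dots> = - (qp (1 - 2 * (u - 1)) *\<^sub>C (pr u * E))"
      by (simp only: pr_Ki mult_scaleC_right \<open>pr u * E = E * pr (u - 1)\<close>)
    finally show ?thesis by (simp add: algebra_simps)
  qed
  have Eb: "pr (1 - w) * E ^ b = E ^ b * pr (1 - w - int b)" using E_pow_pr[of b "1 - w - int b"] by simp
  have "pr (1 - w) * S E ^ Suc b = ((- 1) ^ b * qp (2 * w * int b + int b * int b)) *\<^sub>C (pr (1 - w) * E ^ b * S E)"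
    unfolding power_Suc2 mult.assoc[symmetric] Suc mult_scaleC_left ..
  also have "pr (1 - w) * E ^ b * S E = (- qp (3 - 2 * (1 - w - int b))) *\<^sub>C (E ^ b * (pr (1 - w - int b) * E))"
    by (simp only: Eb mult.assoc E mult_scaleC_right)
  also have "E ^ b * (pr (1 - w - int b) * E) = pr (1 - w) * E ^ Suc b"
    by (simp only: mult.assoc[symmetric] Eb[symmetric] power_Suc2)
  finally have "pr (1 - w) * S E ^ Suc b
    = ((- 1) ^ Suc b * (qp (2 * w * int b + int b * int b) * qp (3 - 2 * (1 - w - int b)))) *\<^sub>C (pr (1 - w) * E ^ Suc b)"
    by (simp add: scaleC_scaleC)
  also have "qp (2 * w * int b + int b * int b) * qp (3 - 2 * (1 - w - int b)) = qp (2 * w * int (Suc b) + int (Suc b) * int (Suc b))"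
    by (simp only: qp_add[symmetric]) (simp add: algebra_simps)
  finally show ?case .
qed (simp add: scaleC_one)

lemma pr_antipode_F_power:
  "pr u * S F ^ a = ((- 1) ^ a * qp ((2 * u - 1) * int a + int a * int a - int a)) *\<^sub>C (pr u * F ^ a)"
proof (induction a)
  case (Suc a)
  have F: "pr u * S F = (- qp (2 * u - 1)) *\<^sub>C (pr u * F)" for u
    by (simp add: antipode_F mult.assoc[symmetric] pr_K mult_scaleC_left)
  have Fa: "pr u * F ^ a = F ^ a * pr (u + int a)" using F_pow_pr[of a "u + int a"] by simp
  have "pr u * S F ^ Suc a = ((- 1) ^ a * qp ((2 * u - 1) * int a + int a * int a - int a)) *\<^sub>C (pr u * F ^ a * S F)"
    unfolding power_Suc2 mult.assoc[symmetric] Suc mult_scaleC_left ..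
  also have "pr u * F ^ a * S F = (- qp (2 * (u + int a) - 1)) *\<^sub>C (F ^ a * (pr (u + int a) * F))"
    by (simp only: Fa mult.assoc F mult_scaleC_right)
  also have "F ^ a * (pr (u + int a) * F) = pr u * F ^ Suc a"
    by (simp only: mult.assoc[symmetric] Fa[symmetric] power_Suc2)
  finally have "pr u * S F ^ Suc a
    = ((- 1) ^ Suc a * (qp ((2 * u - 1) * int a + int a * int a - int a) * qp (2 * (u + int a) - 1))) *\<^sub>C (pr u * F ^ Suc a)"
    by (simp add: scaleC_scaleC)
  also have "qp ((2 * u - 1) * int a + int a * int a - int a) * qp (2 * (u + int a) - 1)
    = qp ((2 * u - 1) * int (Suc a) + int (Suc a) * int (Suc a) - int (Suc a))"
    by (simp only: qp_add[symmetric]) (simp add: algebra_simps)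
  finally show ?case .
qed (simp add: scaleC_one)

lemma antipode_pbw:
  "S (F ^ a * E ^ b * pr w) = ((- 1) ^ (a + b) * qp (2 * w * (int b - int a) + (int b - int a) * (int b - int a))) *\<^sub>C
    (pr (1 - w) * E ^ b * F ^ a)"
proof -
  have Eb: "pr (1 - w) * E ^ b = E ^ b * pr (1 - w - int b)" using E_pow_pr[of b "1 - w - int b"] by simp
  have "S (F ^ a * E ^ b * pr w) = pr (1 - w) * S E ^ b * S F ^ a"
    by (simp add: antipode_mult antipode_power antipode_pr mult.assoc)
  also have "\<dots> = ((- 1) ^ b * qp (2 * w * int b + int b * int b)) *\<^sub>C (E ^ b * (pr (1 - w - int b) * S F ^ a))"
    by (simp only: pr_antipode_E_power mult_scaleC_left Eb mult.assoc)
  also have "\<dots> = ((- 1) ^ b * qp (2 * w * int b + int b * int b) *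
      ((- 1) ^ a * qp ((2 * (1 - w - int b) - 1) * int a + int a * int a - int a))) *\<^sub>C (pr (1 - w) * E ^ b * F ^ a)"
    by (simp only: pr_antipode_F_power mult_scaleC_right scaleC_scaleC mult.assoc[symmetric] Eb)
  also have "(- 1) ^ b * qp (2 * w * int b + int b * int b) * ((- 1) ^ a * qp ((2 * (1 - w - int b) - 1) * int a + int a * int a - int a))
    = (- 1) ^ (a + b) * (qp (2 * w * int b + int b * int b) * qp ((2 * (1 - w - int b) - 1) * int a + int a * int a - int a))"
    by (simp add: power_add)
  also have "qp (2 * w * int b + int b * int b) * qp ((2 * (1 - w - int b) - 1) * int a + int a * int a - int a)
    = qp (2 * w * (int b - int a) + (int b - int a) * (int b - int a))"
    by (simp only: qp_add[symmetric]) (simp add: algebra_simps)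
  finally show ?thesis .
qed

text \<open>The phases and signs of the coproduct, of the antipode and of the balancing element
  cancel completely, leaving one common factor \<open>zeta_l\<close>.\<close>

lemma higman_trace_eq:
  "higman_trace \<Delta> S Lam K x = zeta_l *\<^sub>C (\<Sum>w\<in>residues. \<Sum>i<l. \<Sum>j<l.
    pr (1 - w) * E ^ (l - 1 - j) * F ^ (l - 1 - i) * x * (F ^ i * E ^ j * pr (1 - w)))"
proof -
  define T where "T = tensor_lift (\<lambda>a b. S b * x * a * Ki)"
  have T: "clinear T" unfolding T_def by (rule clinear_tensor_lift)
  have bil: "cbilinear (\<lambda>a b. S b * x * a * Ki)"
    using antipode_linear
    by (simp add: cbilinear_iff clinear_iff distrib_left distrib_right mult_scaleC_left mult_scaleC_right)
  have Tt: "T (a \<^bold>\<otimes> b) = S b * x * a * Ki" for a b unfolding T_def by (rule tensor_lift_tens[OF bil])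
  have "\<Delta> Lam = \<Delta> Lam * (1 \<^bold>\<otimes> (\<Sum>w\<in>residues. pr w))" by (simp add: sum_pr flip: one_tensor_def)
  also have "\<dots> = (\<Sum>w\<in>residues. \<Delta> Lam * (1 \<^bold>\<otimes> pr w))" by (simp only: tens_sum_right sum_distrib_left)
  finally have "T (\<Delta> Lam) = T (\<Sum>w\<in>residues. \<Delta> Lam * (1 \<^bold>\<otimes> pr w))" by simp
  also have "\<dots> = (\<Sum>w\<in>residues. \<Sum>i<l. \<Sum>j<l. (zeta_l * (- 1) ^ (i + j) * qp (integral_exponent (int i) (int j) w)) *\<^sub>C
      (S (F ^ (l - 1 - i) * E ^ (l - 1 - j) * pr w) * x * (F ^ i * E ^ j * pr (1 - w)) * Ki))"
    by (simp only: comult_integral clinear_sum[OF T] clinear_scale[OF T] Tt)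
  also have "\<dots> = (\<Sum>w\<in>residues. \<Sum>i<l. \<Sum>j<l. zeta_l *\<^sub>C
      (pr (1 - w) * E ^ (l - 1 - j) * F ^ (l - 1 - i) * x * (F ^ i * E ^ j * pr (1 - w))))"
  proof (intro sum.cong refl)
    fix w i j assume "i \<in> {..<l}" "j \<in> {..<l}"
    then have ij: "i < l" "j < l" by auto
    let ?a = "l - 1 - i" and ?b = "l - 1 - j"
    have d: "int ?b - int ?a = int i - int j" using ij by (simp add: of_nat_diff)
    \<comment> \<open>The four exponents \<open>i\<close>, \<open>j\<close>, \<open>?a\<close>,
      \<open>?b\<close> add up to the even number \<open>2 * (l - 1)\<close>.\<close>
    have "(- 1 :: complex) ^ (i + j) * (- 1) ^ (?a + ?b) = (- 1) ^ (2 * (l - 1))"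
      unfolding power_add[symmetric] using ij by (intro arg_cong[where f = "(^) (- 1)"]) simp
    then have s: "(- 1 :: complex) ^ (i + j) * (- 1) ^ (?a + ?b) = 1" by simp
    have "integral_exponent (int i) (int j) w + (2 * w * (int i - int j) + (int i - int j) * (int i - int j)) + (1 - 2 * (1 - w)) = 0"
      by (simp add: integral_exponent_def algebra_simps)
    then have e: "qp (integral_exponent (int i) (int j) w) * qp (2 * w * (int i - int j) + (int i - int j) * (int i - int j)) * qp (1 - 2 * (1 - w)) = 1"
      unfolding qp_add[symmetric] by simp
    have Ki: "F ^ i * E ^ j * pr (1 - w) * Ki = qp (1 - 2 * (1 - w)) *\<^sub>C (F ^ i * E ^ j * pr (1 - w))"
      by (simp only: mult.assoc pr_Ki mult_scaleC_right)
    have "(zeta_l * (- 1) ^ (i + j) * qp (integral_exponent (int i) (int j) w)) *\<^sub>C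
        (S (F ^ ?a * E ^ ?b * pr w) * x * (F ^ i * E ^ j * pr (1 - w)) * Ki)
      = (zeta_l * (- 1) ^ (i + j) * qp (integral_exponent (int i) (int j) w) *
          ((- 1) ^ (?a + ?b) * qp (2 * w * (int i - int j) + (int i - int j) * (int i - int j))) * qp (1 - 2 * (1 - w))) *\<^sub>C
        (pr (1 - w) * E ^ ?b * F ^ ?a * x * (F ^ i * E ^ j * pr (1 - w)))"
      unfolding mult.assoc[of _ _ Ki] Ki[unfolded mult.assoc[of _ _ Ki]] antipode_pbw d
      by (simp only: mult_scaleC_left mult_scaleC_right scaleC_scaleC Ki[unfolded mult.assoc[of _ _ Ki]] mult.assoc mult.commute mult.left_commute)
    also have "zeta_l * (- 1) ^ (i + j) * qp (integral_exponent (int i) (int j) w) *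
          ((- 1) ^ (?a + ?b) * qp (2 * w * (int i - int j) + (int i - int j) * (int i - int j))) * qp (1 - 2 * (1 - w))
      = zeta_l * ((- 1) ^ (i + j) * (- 1) ^ (?a + ?b)) * (qp (integral_exponent (int i) (int j) w) * qp (2 * w * (int i - int j) + (int i - int j) * (int i - int j)) * qp (1 - 2 * (1 - w)))"
      by (simp only: mult_ac)
    finally show "(zeta_l * (- 1) ^ (i + j) * qp (integral_exponent (int i) (int j) w)) *\<^sub>C
        (S (F ^ ?a * E ^ ?b * pr w) * x * (F ^ i * E ^ j * pr (1 - w)) * Ki)
      = zeta_l *\<^sub>C (pr (1 - w) * E ^ ?b * F ^ ?a * x * (F ^ i * E ^ j * pr (1 - w)))"
      by (simp only: s e mult_1_right)
  qed
  finally show ?thesis by (simp only: higman_trace_def T_def cvs.scale_sum_right)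
qed

lemma higman_trace_linear:
  "higman_trace \<Delta> S Lam K (x + y) = higman_trace \<Delta> S Lam K x + higman_trace \<Delta> S Lam K y"
  "higman_trace \<Delta> S Lam K (c *\<^sub>C x) = c *\<^sub>C higman_trace \<Delta> S Lam K x"
  unfolding higman_trace_eq
  by (simp_all add: distrib_left distrib_right sum.distrib scaleC_add_right mult_scaleC_left mult_scaleC_right
      scaleC_scaleC mult.commute flip: cvs.scale_sum_right)

lemma pr_FE_pr: "pr v * (F ^ i * E ^ j * pr u) = (if int l dvd v - (u + int j - int i) then F ^ i * E ^ j * pr u else 0)"
  unfolding FEpr_weight by (simp add: mult.assoc[symmetric] pr_pr)

lemma higman_term:
  assumes "i < l" "j < l"
  shows "pr u * E ^ (l - 1 - j) * F ^ (l - 1 - i) * (ev p * pr v) * (F ^ i * E ^ j * pr u)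
    = (if int l dvd v - (u + int j - int i) then (1 / dl ^ (2 * (l - 1))) *\<^sub>C (ev p * ec (u + int j) * pr u) else 0)"
proof -
  let ?a = "l - 1 - i" and ?b = "l - 1 - j"
  have "pr u * E ^ ?b * F ^ ?a * (ev p * pr v) * (F ^ i * E ^ j * pr u)
    = ev p * (pr u * E ^ ?b * F ^ ?a * (pr v * (F ^ i * E ^ j * pr u)))"
    by (simp only: ev_left_commute mult.assoc)
  note f1 = this
  have f2: "pr u * E ^ ?b * F ^ ?a * (F ^ i * E ^ j * pr u) = (1 / dl ^ (2 * (l - 1))) *\<^sub>C (ec (u + int j) * pr u)"
  proof -
    \<comment> \<open>The total power \<open>F^(l - 1)\<close> can be split anew to match the powers
      of \<open>E\<close> on either side; then \<open>FE_pow_pr\<close> and \<open>EF_pow_pr\<close>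
      apply.\<close>
    have "?a + i = ?b + j" using assms by simp
    then have FF: "F ^ ?a * F ^ i = F ^ ?b * F ^ j" by (simp only: power_add[symmetric])
    have "pr u * E ^ ?b * F ^ ?a * (F ^ i * E ^ j * pr u) = pr u * E ^ ?b * (F ^ ?a * F ^ i) * E ^ j * pr u"
      by (simp only: mult.assoc)
    also have "\<dots> = pr u * (E ^ ?b * F ^ ?b) * (F ^ j * E ^ j * pr u)" unfolding FF by (simp only: mult.assoc)
    also have "\<dots> = (1 / dl ^ (2 * j)) *\<^sub>C (ev (up_nodes j u) * (pr u * (E ^ ?b * F ^ ?b * pr u)))"
      unfolding FE_pow_pr[of j] mult_scaleC_right by (simp only: ev_left_commute mult.assoc)
    also have "\<dots> = (1 / dl ^ (2 * j) * (1 / dl ^ (2 * ?b))) *\<^sub>C (ev (up_nodes j u * down_nodes ?b u) * pr u)"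
      unfolding EF_pow_pr[of ?b] mult_scaleC_right scaleC_scaleC alg_eval_mult
      by (simp only: ev_left_commute[of "pr u"] pr_idem mult.assoc)
    also have "up_nodes j u * down_nodes ?b u = Psi_at (u + int j)" by (rule missing_node[OF assms(2)])
    also have "1 / dl ^ (2 * j) * (1 / dl ^ (2 * ?b)) = 1 / dl ^ (2 * (l - 1))"
      using assms by (simp flip: power_add distrib_left)
    finally show ?thesis by (simp only: ec_def)
  qed
  show ?thesis
  proof (cases "int l dvd v - (u + int j - int i)")
    case True
    show ?thesis unfolding f1 pr_FE_pr if_P[OF True] f2 by (simp only: mult_scaleC_right mult.assoc)
  next
    case False
    show ?thesis unfolding f1 pr_FE_pr if_not_P[OF False] by simp
  qed
qed

definition higman_const :: complex where "higman_const = zeta_l / dl ^ (2 * (l - 1))"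

lemma higman_const_nz: "higman_const \<noteq> 0"
  by (simp add: higman_const_def zeta_l_nz)

lemma sum_unique_residue:
  fixes x :: "'b::comm_monoid_add"
  shows "(\<Sum>i<l. if int l dvd a + int i then x else 0) = x"
proof -
  have "(\<Sum>w\<in>residues. if int l dvd w - (- a) then x else 0) = x"
    by (rule sum_residues_delta) (rule periodic_const)
  then show ?thesis unfolding sum_residues_lessThan by (simp add: add.commute)
qed

text \<open>For each \<open>j\<close> exactly one \<open>i\<close> has the weight selected by
  \<open>v\<close>, and the term is then a multiple of \<open>ec (u + j)\<close>. Summing over
  \<open>j\<close> runs through all classes, so the result is independent of
  \<open>v\<close>.\<close>

lemma higman_trace_ev: "higman_trace \<Delta> S Lam K (ev p * pr v) = higman_const *\<^sub>C (ev p * (\<Sum>k\<in>residues. ec k))"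
proof -
  have inner: "(\<Sum>i<l. \<Sum>j<l. pr (1 - w) * E ^ (l - 1 - j) * F ^ (l - 1 - i) * (ev p * pr v) * (F ^ i * E ^ j * pr (1 - w)))
    = (1 / dl ^ (2 * (l - 1))) *\<^sub>C (ev p * (\<Sum>k\<in>residues. ec k) * pr (1 - w))" for w
  proof -
    define u where "u = 1 - w"
    have "(\<Sum>i<l. \<Sum>j<l. pr u * E ^ (l - 1 - j) * F ^ (l - 1 - i) * (ev p * pr v) * (F ^ i * E ^ j * pr u))
      = (\<Sum>j<l. \<Sum>i<l. if int l dvd (v - u - int j) + int i then (1 / dl ^ (2 * (l - 1))) *\<^sub>C (ev p * ec (u + int j) * pr u) else 0)"
    proof (subst sum.swap, intro sum.cong refl)
      fix i j assume "i \<in> {..<l}" "j \<in> {..<l}"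
      then have ij: "i < l" "j < l" by auto
      have "v - u - int j + int i = v - (u + int j - int i)" by simp
      then show "pr u * E ^ (l - 1 - j) * F ^ (l - 1 - i) * (ev p * pr v) * (F ^ i * E ^ j * pr u)
        = (if int l dvd (v - u - int j) + int i then (1 / dl ^ (2 * (l - 1))) *\<^sub>C (ev p * ec (u + int j) * pr u) else 0)"
        by (simp only: higman_term[OF ij])
    qed
    also have "\<dots> = (\<Sum>j<l. (1 / dl ^ (2 * (l - 1))) *\<^sub>C (ev p * ec (u + int j) * pr u))"
      by (simp only: sum_unique_residue)
    also have "\<dots> = (1 / dl ^ (2 * (l - 1))) *\<^sub>C (ev p * (\<Sum>j<l. ec (u + int j)) * pr u)"
      by (simp only: cvs.scale_sum_right sum_distrib_left sum_distrib_right)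
    also have "(\<Sum>j<l. ec (u + int j)) = (\<Sum>k\<in>residues. ec k)"
      using sum_residues_shift[OF periodic_ec, of u] by (simp add: sum_residues_lessThan[of "\<lambda>k. ec (k + u)"] add.commute)
    finally show ?thesis by (simp only: u_def)
  qed
  have "periodic pr" by (rule periodic_pr)
  then have "(\<Sum>w\<in>residues. pr (1 - w)) = 1" using sum_residues_reflect[of pr 1] by (simp add: sum_pr)
  then show ?thesis unfolding higman_trace_eq inner
    by (simp add: scaleC_scaleC higman_const_def flip: cvs.scale_sum_right sum_distrib_left)
qed

lemma higman_trace_exists: "\<exists>p. higman_trace \<Delta> S Lam K x = higman_const *\<^sub>C (ev p * (\<Sum>k\<in>residues. ec k))"
proof (induction x rule: pbw_induct)
  case (add x y)
  then obtain p p' where "higman_trace \<Delta> S Lam K x = higman_const *\<^sub>C (ev p * (\<Sum>k\<in>residues. ec k))"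
    "higman_trace \<Delta> S Lam K y = higman_const *\<^sub>C (ev p' * (\<Sum>k\<in>residues. ec k))" by blast
  then show ?case
    by (intro exI[of _ "p + p'"]) (simp add: higman_trace_linear alg_eval_add distrib_right scaleC_add_right)
next
  case (scale c x)
  then obtain p where "higman_trace \<Delta> S Lam K x = higman_const *\<^sub>C (ev p * (\<Sum>k\<in>residues. ec k))" by blast
  then show ?case
    by (intro exI[of _ "smult c p"])
      (simp add: higman_trace_linear alg_eval_smult mult_scaleC_left scaleC_scaleC mult.commute)
next
  case (pbw m n v)
  show ?case
  proof (cases "m = n")
    case True
    have "F ^ m * E ^ n * pr v = ev (smult (1 / dl ^ (2 * m)) (up_nodes m v)) * pr v"
      by (simp add: True FE_pow_pr alg_eval_smult mult_scaleC_left)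
    then show ?thesis using higman_trace_ev by metis
  next
    case False
    \<comment> \<open>The remaining factors together have weight zero, so a basis element of nonzero
      weight is killed by one of the two outer idempotents.\<close>
    have "pr u * E ^ b * F ^ a * (F ^ m * E ^ n * pr v) * (F ^ i * E ^ j * pr u) = 0"
      if "a = l - 1 - i" "b = l - 1 - j" "i < l" "j < l" for u a b i j
    proof (cases "int l dvd v - (u + int j - int i)")
      case True
      have "pr u * E ^ b * F ^ a * (F ^ m * E ^ n * pr v) = pr u * (pr (v + int n - int m - int a + int b) * E ^ b * F ^ a) * (F ^ m * E ^ n)"
      proof -
        have "F ^ m * E ^ n * pr v = pr (v + int n - int m) * (F ^ m * E ^ n)"
          using FEpr_weight[of m n v] by (simp only: mult.assoc)
        then have "pr u * E ^ b * F ^ a * (F ^ m * E ^ n * pr v)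
          = pr u * (E ^ b * F ^ a * pr (v + int n - int m)) * (F ^ m * E ^ n)" by (simp only: mult.assoc)
        then show ?thesis by (simp only: EFpr_weight)
      qed
      moreover have "\<not> int l dvd u - (v + int n - int m - int a + int b)"
      proof
        assume "int l dvd u - (v + int n - int m - int a + int b)"
        then have "int l dvd (u - (v + int n - int m - int a + int b)) + (v - (u + int j - int i))" using True by (rule dvd_add)
        moreover have "(u - (v + int n - int m - int a + int b)) + (v - (u + int j - int i)) = int m - int n"
          using that by (simp add: of_nat_diff)
        ultimately have "int l dvd int m - int n" by simp
        then show False using False pbw
          by (metis mod_eq_dvd_iff mod_pos_pos_trivial of_nat_0_le_iff of_nat_eq_iff of_nat_less_iff)
      qed
      ultimately show ?thesis by (simp add: mult.assoc[symmetric] pr_pr)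
    next
      case False
      have "pr u * E ^ b * F ^ a * (F ^ m * E ^ n * pr v) * (F ^ i * E ^ j * pr u)
        = pr u * E ^ b * F ^ a * (F ^ m * E ^ n) * (pr v * (F ^ i * E ^ j * pr u))" by (simp only: mult.assoc)
      then show ?thesis using False by (simp add: pr_FE_pr)
    qed
    then have "higman_trace \<Delta> S Lam K (F ^ m * E ^ n * pr v) = 0"
      unfolding higman_trace_eq by simp
    then show ?thesis by (intro exI[of _ 0]) simp
  qed
qed

text \<open>By \<open>higman_trace_exists\<close> and \<open>higman_trace_ev\<close> the traces are
  the products of the sum of all \<open>ec k\<close> with polynomials in \<open>C\<close>. Such a
  polynomial multiplies \<open>ec k\<close> by its value at \<open>ch k\<close>, which may be any
  even function.\<close>

lemma higman_ideal_eq: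
  "higman_ideal \<Delta> S Lam K = (\<lambda>f. \<Sum>k\<in>residues. f k *\<^sub>C ec k) ` {f. even_periodic f}"
proof (intro equalityI subsetI)
  fix x assume "x \<in> higman_ideal \<Delta> S Lam K"
  then obtain p where x: "x = higman_const *\<^sub>C (ev p * (\<Sum>k\<in>residues. ec k))"
    unfolding higman_ideal_def using higman_trace_exists by auto
  have "x = (\<Sum>k\<in>residues. (higman_const * poly p (ch k)) *\<^sub>C ec k)"
    by (simp only: x sum_distrib_left ev_ec cvs.scale_sum_right scaleC_scaleC)
  moreover have "even_periodic (\<lambda>k. higman_const * poly p (ch k))"
    unfolding even_periodic_def by (auto intro!: periodicI simp: ch_neg periodicD[OF periodic_ch])
  ultimately show "x \<in> (\<lambda>f. \<Sum>k\<in>residues. f k *\<^sub>C ec k) ` {f. even_periodic f}"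
    by (intro image_eqI[of _ _ "\<lambda>k. higman_const * poly p (ch k)"]) auto
next
  fix x assume "x \<in> (\<lambda>f. \<Sum>k\<in>residues. f k *\<^sub>C ec k) ` {f. even_periodic f}"
  then obtain f where f: "even_periodic f" "x = (\<Sum>k\<in>residues. f k *\<^sub>C ec k)" by auto
  obtain p where p: "\<And>k. poly p (ch k) = f k" using even_function_of_ch[OF f(1)] by blast
  have "x = (\<Sum>k\<in>residues. ev p * ec k)" by (simp only: f(2) ev_ec p)
  also have "\<dots> = ev p * (\<Sum>k\<in>residues. ec k)" by (simp only: sum_distrib_left)
  also have "\<dots> = higman_trace \<Delta> S Lam K (ev (smult (1 / higman_const) p) * pr 0)"
    unfolding higman_trace_ev by (simp add: alg_eval_smult mult_scaleC_left scaleC_scaleC higman_const_nz scaleC_one)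
  finally show "x \<in> higman_ideal \<Delta> S Lam K" by (simp add: higman_ideal_def)
qed

end

context small_quantum_sl2_root
begin

section \<open>The monodromy matrix\<close>

abbreviation Rm :: "('a, 'a) tensor" where "Rm \<equiv> R_matrix l q E F K"

definition Rc :: "nat \<Rightarrow> complex" where "Rc m = dl ^ m / qfact q m"

lemma Rc_nz: "m < l \<Longrightarrow> Rc m \<noteq> 0"
  by (simp add: Rc_def qfact_nz)

definition tri :: "nat \<Rightarrow> int" where "tri m = int m * (int m - 1) div 2"

lemma tri_double: "2 * tri m = int m * (int m - 1)"
  by (simp add: tri_def)

text \<open>On weight spaces the double sum over powers of \<open>K\<close> collapses: the sum over
  \<open>i\<close> is zero unless \<open>j\<close> is \<open>u + r + m\<close> modulo
  \<open>l\<close>. Here \<open>u + r\<close> is half of the weight exponent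
  \<open>2 * u - 1\<close>.\<close>

lemma R_pr: "Rm * (pr u \<^bold>\<otimes> pr w) = (\<Sum>m<l. (Rc m * qp (tri m + 2 * (u + r + int m) * (w + r - int m))) *\<^sub>C
    ((E ^ m * pr u) \<^bold>\<otimes> (F ^ m * pr w)))" (is "_ = ?rhs")
proof -
  have "Rm * (pr u \<^bold>\<otimes> pr w) = (\<Sum>m<l. ((1 / of_nat l) * (\<Sum>i<l. \<Sum>j<l.
      Rc m * qp (tri m + 2 * int m * (int i - int j) - 2 * int i * int j) * qp ((2 * u - 1) * int i) * qp ((2 * w - 1) * int j))) *\<^sub>C
    ((E ^ m * pr u) \<^bold>\<otimes> (F ^ m * pr w)))"
    unfolding R_matrix_def Rc_def dl_def tri_def
    by (simp add: mult_scaleC_left sum_distrib_right tens_times_tens mult.assoc Kp_of_nat[symmetric] Kp_pr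
        mult_scaleC_right tens_scaleC_left tens_scaleC_right scaleC_scaleC cvs.scale_sum_right cvs.scale_sum_left sum_distrib_left
        mult.commute mult.left_commute)
  also have "\<dots> = ?rhs"
  proof (intro sum.cong refl arg_cong2[where f = scaleC])
    fix m
    define a where "a = u + r + int m"
    have "(\<Sum>i<l. \<Sum>j<l. Rc m * qp (tri m + 2 * int m * (int i - int j) - 2 * int i * int j) * qp ((2 * u - 1) * int i) * qp ((2 * w - 1) * int j))
      = (\<Sum>j<l. \<Sum>i<l. Rc m * (qp (tri m + int j * (2 * w - 1 - 2 * int m)) * qp ((2 * (a - int j) - int l) * int i)))"
      unfolding mult.assoc qp_add[symmetric]
      by (subst sum.swap) (simp add: a_def l_eq algebra_simps)
    also have "\<dots> = (\<Sum>j\<in>residues. \<Sum>i\<in>residues. Rc m * (qp (tri m + j * (2 * w - 1 - 2 * int m)) * qp ((2 * (a - j) - int l) * i)))"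
      by (simp only: sum_residues_lessThan)
    also have "\<dots> = (\<Sum>j\<in>residues. if int l dvd j - a then of_nat l * Rc m * qp ((2 * w - 1 - 2 * int m) * j + tri m) else 0)"
    proof (intro sum.cong refl)
      fix j
      have "int l dvd 2 * (a - j) - int l \<longleftrightarrow> int l dvd j - a"
        using dvd_add_left_iff[of "int l" "int l" "2 * (a - j) - int l"] dvd_2_mult[of "a - j"]
        by (simp add: dvd_diff_commute)
      then have "(\<Sum>i\<in>residues. qp ((2 * (a - j) - int l) * i)) = (if int l dvd j - a then of_nat l else 0)"
        by (simp only: sum_qp)
      then show "(\<Sum>i\<in>residues. Rc m * (qp (tri m + j * (2 * w - 1 - 2 * int m)) * qp ((2 * (a - j) - int l) * i)))
        = (if int l dvd j - a then of_nat l * Rc m * qp ((2 * w - 1 - 2 * int m) * j + tri m) else 0)"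
        by (simp only: sum_distrib_left[symmetric]) (simp add: add.commute mult.commute)
    qed
    also have "\<dots> = of_nat l * Rc m * qp ((2 * w - 1 - 2 * int m) * a + tri m)"
      by (rule sum_residues_delta) (intro periodic_cmult periodic_qp)
    also have "qp ((2 * w - 1 - 2 * int m) * a + tri m) = qp (tri m + 2 * a * (w + r - int m))"
    proof (rule qp_cong)
      have "(2 * w - 1 - 2 * int m) * a + tri m - (tri m + 2 * a * (w + r - int m)) = int l * - a"
        by (simp add: l_eq algebra_simps)
      then show "int l dvd (2 * w - 1 - 2 * int m) * a + tri m - (tri m + 2 * a * (w + r - int m))" by simp
    qed
    finally show "(1 / of_nat l) * (\<Sum>i<l. \<Sum>j<l. Rc m * qp (tri m + 2 * int m * (int i - int j) - 2 * int i * int j) * qp ((2 * u - 1) * int i) * qp ((2 * w - 1) * int j))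
      = Rc m * qp (tri m + 2 * (u + r + int m) * (w + r - int m))"
      by (simp add: a_def)
  qed
  finally show ?thesis .
qed

lemma tensor_swap_mult: "tensor_swap (t * (a \<^bold>\<otimes> b)) = tensor_swap t * ((b :: 'a) \<^bold>\<otimes> (a :: 'a))"
  by (induction t rule: tensor_induct)
    (simp_all add: clinear_zero[OF clinear_tensor_swap] clinear_add[OF clinear_tensor_swap] distrib_right
      tens_times_tens tensor_swap_tens)

text \<open>The exponent of \<open>R\<close> at weights \<open>u\<close>, \<open>w\<close>, followed
  by that of the swapped \<open>R\<close> at the weights \<open>u + m\<close>, \<open>w - m\<close>
  reached meanwhile.\<close>

definition mexp :: "nat \<Rightarrow> nat \<Rightarrow> int \<Rightarrow> int \<Rightarrow> int"
  where "mexp m n u w = tri m + tri n + 2 * (u + r + int m) * (w + r - int m)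
    + 2 * (w - int m + r + int n) * (u + int m + r - int n)"

lemma monodromy_pr: "monodromy Rm * (pr u \<^bold>\<otimes> pr w) = (\<Sum>m<l. \<Sum>n<l. (Rc m * Rc n * qp (mexp m n u w)) *\<^sub>C
    ((F ^ n * E ^ m * pr u) \<^bold>\<otimes> (E ^ n * F ^ m * pr w)))" (is "_ = ?rhs")
proof -
  have swap: "tensor_swap Rm * (pr u \<^bold>\<otimes> pr w) = (\<Sum>n<l. (Rc n * qp (tri n + 2 * (w + r + int n) * (u + r - int n))) *\<^sub>C
    ((F ^ n * pr u) \<^bold>\<otimes> (E ^ n * pr w)))" for u w
    unfolding tensor_swap_mult[symmetric] R_pr
    by (simp add: clinear_sum[OF clinear_tensor_swap] clinear_scale[OF clinear_tensor_swap] tensor_swap_tens)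
  have "monodromy Rm * (pr u \<^bold>\<otimes> pr w) = (\<Sum>m<l. (Rc m * qp (tri m + 2 * (u + r + int m) * (w + r - int m))) *\<^sub>C
    (tensor_swap Rm * (pr (u + int m) \<^bold>\<otimes> pr (w - int m)) * (E ^ m \<^bold>\<otimes> F ^ m)))"
    unfolding monodromy_def mult.assoc R_pr
    by (simp add: sum_distrib_left mult_scaleC_right tens_times_tens E_pow_pr F_pow_pr)
  also have "\<dots> = ?rhs"
    unfolding swap
  proof (intro sum.cong refl)
    fix m
    show "(Rc m * qp (tri m + 2 * (u + r + int m) * (w + r - int m))) *\<^sub>C
      ((\<Sum>n<l. (Rc n * qp (tri n + 2 * (w - int m + r + int n) * (u + int m + r - int n))) *\<^sub>C
        ((F ^ n * pr (u + int m)) \<^bold>\<otimes> (E ^ n * pr (w - int m)))) * (E ^ m \<^bold>\<otimes> F ^ m))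
      = (\<Sum>n<l. (Rc m * Rc n * qp (mexp m n u w)) *\<^sub>C ((F ^ n * E ^ m * pr u) \<^bold>\<otimes> (E ^ n * F ^ m * pr w)))"
      unfolding sum_distrib_right cvs.scale_sum_right
    proof (intro sum.cong refl)
      fix n
      have "qp (mexp m n u w) = qp (tri m + 2 * (u + r + int m) * (w + r - int m)) * qp (tri n + 2 * (w - int m + r + int n) * (u + int m + r - int n))"
        by (simp only: qp_add[symmetric]) (simp add: mexp_def add_ac)
      then have c: "Rc m * qp (tri m + 2 * (u + r + int m) * (w + r - int m)) * (Rc n * qp (tri n + 2 * (w - int m + r + int n) * (u + int m + r - int n)))
        = Rc m * Rc n * qp (mexp m n u w)" by (simp only: mult_ac)
      show "(Rc m * qp (tri m + 2 * (u + r + int m) * (w + r - int m))) *\<^sub>C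
        ((Rc n * qp (tri n + 2 * (w - int m + r + int n) * (u + int m + r - int n))) *\<^sub>C
        ((F ^ n * pr (u + int m)) \<^bold>\<otimes> (E ^ n * pr (w - int m))) * (E ^ m \<^bold>\<otimes> F ^ m))
        = (Rc m * Rc n * qp (mexp m n u w)) *\<^sub>C ((F ^ n * E ^ m * pr u) \<^bold>\<otimes> (E ^ n * F ^ m * pr w))"
        unfolding mult_scaleC_left scaleC_scaleC c tens_times_tens
        by (simp only: mult.assoc E_pow_pr[of m u] F_pow_pr[of m w])
    qed
  qed
  finally show ?thesis .
qed

lemma drinfeld_pr:
  assumes \<beta>: "clinear \<beta>"
  shows "drinfeld_map Rm \<beta> * pr w = (\<Sum>n<l. \<Sum>m<l.
    (\<Sum>u\<in>residues. Rc m * Rc n * qp (mexp m n u w) * \<beta> (F ^ n * E ^ m * pr u)) *\<^sub>C (E ^ n * F ^ m * pr w))"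
proof -
  have "monodromy Rm * (1 \<^bold>\<otimes> pr w) = (\<Sum>u\<in>residues. monodromy Rm * (pr u \<^bold>\<otimes> pr w))"
    by (simp only: sum_distrib_left[symmetric] tens_sum_left[symmetric] sum_pr)
  then have "drinfeld_map Rm \<beta> * pr w = (\<Sum>u\<in>residues. \<Sum>m<l. \<Sum>n<l.
      (Rc m * Rc n * qp (mexp m n u w) * \<beta> (F ^ n * E ^ m * pr u)) *\<^sub>C (E ^ n * F ^ m * pr w))"
    unfolding drinfeld_map_def slice_mult_pr[OF \<beta>]
    by (simp add: monodromy_pr slice_simps tensor_slice_tens[OF \<beta>] scaleC_scaleC del: scaleC_complex)
  also have "\<dots> = (\<Sum>n<l. \<Sum>m<l. \<Sum>u\<in>residues.
      (Rc m * Rc n * qp (mexp m n u w) * \<beta> (F ^ n * E ^ m * pr u)) *\<^sub>C (E ^ n * F ^ m * pr w))"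
    by (subst sum.swap, subst (2) sum.swap, subst sum.swap) simp
  finally show ?thesis by (simp only: cvs.scale_sum_left)
qed

definition mlin_u :: "nat \<Rightarrow> nat \<Rightarrow> int" where "mlin_u m n = 4 * r - 4 * int m + 2 * int n"
definition mlin_w :: "nat \<Rightarrow> nat \<Rightarrow> int" where "mlin_w m n = 4 * r + 4 * int m - 2 * int n"

text \<open>In the two weights the exponent is bilinear, with leading part \<open>4 * u * w\<close>,
  plus terms in one weight alone. Inverting the Drinfeld map is therefore Fourier inversion in the
  weights.\<close>

lemma mexp_eq: "mexp m n u w = 4 * u * w + mlin_u m n * u + mlin_w m n * w + mexp m n 0 0"
  by (simp add: mexp_def mlin_u_def mlin_w_def algebra_simps)

lemma periodic_mexp: "periodic (\<lambda>w. qp (mexp m n u w))"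
proof -
  have "mexp m n u w = (4 * u + mlin_w m n) * w + (mlin_u m n * u + mexp m n 0 0)" for w
    by (subst mexp_eq) (simp add: algebra_simps)
  then show ?thesis by (simp only: periodic_qp)
qed

lemma drinfeld_sum:
  assumes \<beta>: "clinear \<beta>"
  shows "drinfeld_map Rm \<beta> = (\<Sum>n<l. \<Sum>m<l. \<Sum>w\<in>residues.
    (\<Sum>u\<in>residues. Rc m * Rc n * qp (mexp m n u w) * \<beta> (F ^ n * E ^ m * pr u)) *\<^sub>C (E ^ n * F ^ m * pr w))" (is "_ = ?rhs")
proof -
  have "drinfeld_map Rm \<beta> = (\<Sum>w\<in>residues. drinfeld_map Rm \<beta> * pr w)"
    by (simp only: sum_distrib_left[symmetric] sum_pr mult_1_right)
  also have "\<dots> = ?rhs"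
    unfolding drinfeld_pr[OF \<beta>] by (subst sum.swap, subst (2) sum.swap) simp
  finally show ?thesis .
qed

text \<open>Independence of the basis with \<open>E\<close> in front makes each coefficient vanish.
  As a function of \<open>w\<close> it is a nonzero phase times a Fourier transform of values of
  \<open>\<beta>\<close>, which can be inverted.\<close>

lemma drinfeld_zero:
  assumes \<beta>: "clinear \<beta>" and z: "drinfeld_map Rm \<beta> = 0"
  shows "\<beta> x = 0"
proof (induction x rule: pbw_induct)
  case (pbw n m v)
  define g where "g u = qp (mlin_u m n * u + mexp m n 0 0) * \<beta> (F ^ n * E ^ m * pr u)" for u
  have g: "periodic g"
    unfolding g_def
    by (intro periodic_mult periodic_qp periodicI arg_cong[where f = \<beta>] periodicD[OF periodic_mult_pr])
  have "(\<Sum>u\<in>residues. Rc m * Rc n * qp (mexp m n u w) * \<beta> (F ^ n * E ^ m * pr u)) = 0" for w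
    by (rule swapped_pbw_zero[where a = "\<lambda>n m w. \<Sum>u\<in>residues. Rc m * Rc n * qp (mexp m n u w) * \<beta> (F ^ n * E ^ m * pr u)"])
      (use z drinfeld_sum[OF \<beta>] pbw in \<open>auto intro!: periodic_sum periodic_mult periodic_mexp periodic_const\<close>)
  moreover have "(\<Sum>u\<in>residues. Rc m * Rc n * qp (mexp m n u w) * \<beta> (F ^ n * E ^ m * pr u))
    = Rc m * Rc n * qp (mlin_w m n * w) * fourier g (- w)" for w
  proof -
    have "qp (mexp m n u w) = qp (mlin_w m n * w) * (qp (- (4 * u * (- w))) * qp (mlin_u m n * u + mexp m n 0 0))" for u
      by (subst mexp_eq, simp only: qp_add[symmetric]) (simp add: algebra_simps)
    then show ?thesis unfolding fourier_def g_def sum_distrib_left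
      by (intro sum.cong refl) (simp only: mult_ac)
  qed
  ultimately have "fourier g (- w) = 0" for w using Rc_nz pbw by simp
  then have "fourier g = (\<lambda>_. 0)" by (metis ext minus_minus)
  then have "of_nat l * g v = 0" using fourier_fourier[OF g, of "- v"] by (simp add: fourier_def)
  then show ?case by (simp add: g_def)
qed (simp_all add: clinear_add[OF \<beta>] clinear_scale_complex[OF \<beta>] del: scaleC_complex)

lemma drinfeld_surj: "\<exists>\<beta>. clinear \<beta> \<and> drinfeld_map Rm \<beta> = z"
proof -
  obtain a where a: "\<And>n m. periodic (a n m)"
    "z = (\<Sum>n<l. \<Sum>m<l. \<Sum>w\<in>residues. a n m w *\<^sub>C (E ^ n * F ^ m * pr w))"
    using swapped_pbw_exists[of z] by blast
  \<comment> \<open>The wanted coefficient, divided by \<open>Rc m * Rc n\<close> and by the part of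
    the phase that is independent of \<open>u\<close>. The part depending on \<open>u\<close> alone
    is removed in the values of \<open>\<beta>\<close>, leaving a plain Fourier inversion.\<close>
  define h where "h n m w = qp (- mlin_w m n * w + - mexp m n 0 0) * a n m w / (Rc m * Rc n)" for n m w
  have h: "periodic (h n m)" for n m
  proof -
    have "periodic (\<lambda>w. (1 / (Rc m * Rc n)) * (qp (- mlin_w m n * w + - mexp m n 0 0) * a n m w))"
      by (intro periodic_cmult periodic_mult periodic_qp a)
    then show ?thesis by (simp add: h_def[abs_def])
  qed
  obtain \<beta> :: "'a \<Rightarrow> complex" where \<beta>: "clinear \<beta>" and
    \<beta>pbw: "\<And>n m u. n < l \<Longrightarrow> m < l \<Longrightarrow> u \<in> residues \<Longrightarrow> \<beta> (F ^ n * E ^ m * pr u) = qp (- mlin_u m n * u) * fourier (h n m) u / of_nat l"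
    using functional_exists[of "\<lambda>n m u. qp (- mlin_u m n * u) * fourier (h n m) u / of_nat l"] by blast
  have "(\<Sum>u\<in>residues. Rc m * Rc n * qp (mexp m n u w) * \<beta> (F ^ n * E ^ m * pr u)) = a n m w"
    if "n < l" "m < l" for n m w
  proof -
    have "(\<Sum>u\<in>residues. Rc m * Rc n * qp (mexp m n u w) * \<beta> (F ^ n * E ^ m * pr u))
      = (\<Sum>u\<in>residues. (Rc m * Rc n * qp (mlin_w m n * w + mexp m n 0 0) / of_nat l) * (qp (- (4 * u * (- w))) * fourier (h n m) u))"
    proof (intro sum.cong refl)
      fix u assume u: "u \<in> residues"
      have "qp (mexp m n u w) * qp (- mlin_u m n * u) = qp (mlin_w m n * w + mexp m n 0 0) * qp (- (4 * u * (- w)))"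
        by (subst mexp_eq, simp only: qp_add[symmetric]) (simp add: algebra_simps)
      then have "Rc m * Rc n * (qp (mexp m n u w) * qp (- mlin_u m n * u)) * fourier (h n m) u / of_nat l
        = Rc m * Rc n * (qp (mlin_w m n * w + mexp m n 0 0) * qp (- (4 * u * (- w)))) * fourier (h n m) u / of_nat l"
        by (simp only:)
      then show "Rc m * Rc n * qp (mexp m n u w) * \<beta> (F ^ n * E ^ m * pr u)
        = (Rc m * Rc n * qp (mlin_w m n * w + mexp m n 0 0) / of_nat l) * (qp (- (4 * u * (- w))) * fourier (h n m) u)"
        unfolding \<beta>pbw[OF that u] by (simp only: mult_ac times_divide_eq_left times_divide_eq_right)
    qed
    also have "\<dots> = (Rc m * Rc n * qp (mlin_w m n * w + mexp m n 0 0) / of_nat l) * fourier (fourier (h n m)) (- w)"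
      by (simp only: sum_distrib_left[symmetric] fourier_def[of "fourier (h n m)"])
    also have "\<dots> = Rc m * Rc n * (qp (mlin_w m n * w + mexp m n 0 0) * qp (- mlin_w m n * w + - mexp m n 0 0)) * a n m w / (Rc m * Rc n)"
      unfolding fourier_fourier[OF h] h_def by simp
    also have "qp (mlin_w m n * w + mexp m n 0 0) * qp (- mlin_w m n * w + - mexp m n 0 0) = 1"
      by (simp only: qp_add[symmetric]) simp
    finally show ?thesis using Rc_nz that by simp
  qed
  then have "drinfeld_map Rm \<beta> = z"
    unfolding drinfeld_sum[OF \<beta>] a(2) by (intro sum.cong refl) simp
  then show ?thesis using \<beta> by blast
qed

end

context small_quantum_sl2_root
begin

section \<open>The Drinfeld map on quantum traces\<close>

lemma sum_smult: "(\<Sum>x\<in>X. smult a (f x)) = smult a (\<Sum>x\<in>X. f x)"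
  by (induction X rule: infinite_finite_induct) (simp_all add: smult_add_right)

text \<open>\<open>verma_exp m w u\<close> collects the powers of \<open>q\<close> in the coefficient of the monodromy matrix and in
  \<open>mu\<close>; \<open>drinfeld_coeff\<close> is the resulting Newton coefficient of \<open>drinfeld_map Rm (mu j)\<close>.\<close>

definition verma_exp :: "int \<Rightarrow> int \<Rightarrow> int \<Rightarrow> int"
  where "verma_exp m w u = m * (m - 1) + 2 * (u + r + m) * (w + r - m) + 2 * (w + r) * (u + r) + 1 - 2 * u"

definition kap :: "nat \<Rightarrow> complex" where "kap m = 1 / (dl ^ (2 * m) * (qfact q m)\<^sup>2)"

definition drinfeld_coeff :: "nat \<Rightarrow> int \<Rightarrow> int \<Rightarrow> complex"
  where "drinfeld_coeff m w j = kap m * (\<Sum>u\<in>residues. qp (verma_exp (int m) w u) * poly (up_nodes m u) (ch j))"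

lemma verma_exp_linear: "verma_exp m w u = (4 * w + 4 * r - 2 * m - 2) * u + verma_exp m w 0"
  by (simp add: verma_exp_def algebra_simps)

lemma periodic_verma_exp: "periodic (\<lambda>u. qp (verma_exp m w u))"
  by (subst verma_exp_linear) (rule periodic_qp)

lemma periodic_poly_up_nodes: "periodic (\<lambda>u. poly (up_nodes m u) x)"
  by (intro periodicI arg_cong[where f = "\<lambda>p. poly p x"] periodicD[OF periodic_up_nodes])

lemma drinfeld_mu_pr:
  "drinfeld_map Rm (mu j) * pr w = ev (\<Sum>m<l. smult (drinfeld_coeff m w j) (down_nodes m w)) * pr w"
proof -
  have "drinfeld_map Rm (mu j) * pr w = (\<Sum>n<l. \<Sum>m<l. if m = n then
      drinfeld_coeff n w j *\<^sub>C (ev (down_nodes n w) * pr w) else 0)"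
    unfolding drinfeld_pr[OF mu]
  proof (intro sum.cong refl)
    fix n m assume "n \<in> {..<l}" "m \<in> {..<l}"
    then have nm: "n < l" "m < l" by auto
    show "(\<Sum>u\<in>residues. Rc m * Rc n * qp (mexp m n u w) * mu j (F ^ n * E ^ m * pr u)) *\<^sub>C (E ^ n * F ^ m * pr w)
      = (if m = n then drinfeld_coeff n w j *\<^sub>C (ev (down_nodes n w) * pr w) else 0)"
    proof (cases "m = n")
      case True
      have "Rc n * Rc n * qp (mexp n n u w) * mu j (F ^ n * E ^ n * pr u) * (1 / dl ^ (2 * n))
        = kap n * (qp (verma_exp (int n) w u) * poly (up_nodes n u) (ch j))" for u
      proof -
        have "mexp n n u w + (1 - 2 * u) = verma_exp (int n) w u"
          using tri_double[of n] by (simp add: mexp_def verma_exp_def algebra_simps)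
        then have e: "qp (verma_exp (int n) w u) = qp (mexp n n u w) * qp (1 - 2 * u)"
          by (metis qp_add)
        have "Rc n * Rc n = dl ^ (2 * n) * dl ^ (2 * n) * kap n"
          using qfact_nz[OF nm(1)] by (simp add: Rc_def kap_def power2_eq_square mult_2 power_add)
        then show ?thesis unfolding mu_pbw[OF nm(1) nm(1)] e by simp
      qed
      then have "(\<Sum>u\<in>residues. Rc n * Rc n * qp (mexp n n u w) * mu j (F ^ n * E ^ n * pr u)) * (1 / dl ^ (2 * n)) = drinfeld_coeff n w j"
        unfolding drinfeld_coeff_def sum_distrib_left sum_distrib_right by (intro sum.cong refl)
      then show ?thesis unfolding True EF_pow_pr scaleC_scaleC by simp
    qed (use nm in \<open>simp add: mu_pbw\<close>)
  qed
  also have "\<dots> = (\<Sum>n<l. drinfeld_coeff n w j *\<^sub>C (ev (down_nodes n w) * pr w))"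
    by (intro sum.cong refl) simp
  finally show ?thesis by (simp only: alg_eval_sum alg_eval_smult sum_distrib_right mult_scaleC_left)
qed

section \<open>The recursion for the Newton coefficients of the Drinfeld image\<close>

definition qsin :: "int \<Rightarrow> complex" where "qsin x = qp x - qp (- x)"

lemma periodic_qsin: "periodic qsin"
proof (rule periodicI)
  fix a b assume d: "int l dvd a - b"
  then have "int l dvd - a - - b" by (metis dvd_diff_commute minus_diff_minus dvd_minus_iff)
  then show "qsin a = qsin b" using d by (simp only: qsin_def qp_cong[OF d] qp_cong)
qed

lemma ch_diff: "ch j - ch v = qsin (j + v) * qsin (j - v)"
  unfolding qsin_def left_diff_distrib right_diff_distrib qp_add[symmetric] ch_def by (simp add: algebra_simps)

lemma poly_up_nodes: "poly (up_nodes m u) (ch j) = (\<Prod>i<m. qsin (j + u + int i)) * (\<Prod>i<m. qsin (j - u - int i))"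
  unfolding up_nodes_def poly_prod prod.distrib[symmetric]
  by (intro prod.cong refl) (use ch_diff in \<open>simp add: algebra_simps\<close>)

definition half :: int where "half = r + 1"

text \<open>All products share the factor \<open>poly (up_nodes m (u + 1)) (ch j)\<close>; \<open>half\<close> inverts \<open>2\<close> modulo \<open>l\<close>.\<close>

lemma poly_up_nodes_shifts:
  fixes m :: nat and u j :: int
  defines "P \<equiv> poly (up_nodes m (u + 1)) (ch j)" and "M \<equiv> int (Suc m)"
  shows "poly (up_nodes (Suc m) u) (ch j) = P * (qsin (j + u) * qsin (j - u))"
    and "poly (up_nodes (Suc m) (u + 1)) (ch j) = P * (qsin (j + u + M) * qsin (j - u - M))"
    and "poly (up_nodes (Suc m) (u + half)) (ch (j + half)) = P * (qsin (j + u + M) * qsin (j - u))"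
    and "poly (up_nodes (Suc m) (u + half)) (ch (j - half)) = P * (qsin (j + u) * qsin (j - u - M))"
proof -
  have A0: "(\<Prod>i<Suc m. qsin (j + u + int i)) = qsin (j + u) * (\<Prod>i<m. qsin (j + (u + 1) + int i))"
    unfolding prod.lessThan_Suc_shift by (simp add: algebra_simps)
  have A1: "(\<Prod>i<Suc m. qsin (j + (u + 1) + int i)) = qsin (j + u + M) * (\<Prod>i<m. qsin (j + (u + 1) + int i))"
    unfolding prod.lessThan_Suc by (simp add: M_def algebra_simps)
  have B0: "(\<Prod>i<Suc m. qsin (j - u - int i)) = qsin (j - u) * (\<Prod>i<m. qsin (j - (u + 1) - int i))"
    unfolding prod.lessThan_Suc_shift by (simp add: algebra_simps)
  have B1: "(\<Prod>i<Suc m. qsin (j - (u + 1) - int i)) = qsin (j - u - M) * (\<Prod>i<m. qsin (j - (u + 1) - int i))"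
    unfolding prod.lessThan_Suc by (simp add: M_def algebra_simps)
  have half: "2 * half = int l + 1" by (simp add: half_def l_eq)
  show "poly (up_nodes (Suc m) u) (ch j) = P * (qsin (j + u) * qsin (j - u))"
    unfolding poly_up_nodes P_def A0 B0 by (simp only: mult_ac)
  show "poly (up_nodes (Suc m) (u + 1)) (ch j) = P * (qsin (j + u + M) * qsin (j - u - M))"
    unfolding poly_up_nodes P_def A1 B1 by (simp only: mult_ac)
  have 1: "qsin (j + half + (u + half) + int i) = qsin (j + (u + 1) + int i)" for i
    by (rule periodicD[OF periodic_qsin]) (use half in simp)
  have 2: "j + half - (u + half) - int i = j - u - int i" for i by simp
  show "poly (up_nodes (Suc m) (u + half)) (ch (j + half)) = P * (qsin (j + u + M) * qsin (j - u))"
    unfolding poly_up_nodes[of "Suc m"] 1 2 unfolding poly_up_nodes P_def A1 B0 by (simp only: mult_ac)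
  have 3: "j - half + (u + half) + int i = j + u + int i" for i by simp
  have 4: "qsin (j - half - (u + half) - int i) = qsin (j - (u + 1) - int i)" for i
  proof (rule periodicD[OF periodic_qsin])
    have "j - half - (u + half) - int i - (j - (u + 1) - int i) = - int l" using half by simp
    then show "int l dvd j - half - (u + half) - int i - (j - (u + 1) - int i)" by simp
  qed
  show "poly (up_nodes (Suc m) (u + half)) (ch (j - half)) = P * (qsin (j + u) * qsin (j - u - M))"
    unfolding poly_up_nodes[of "Suc m"] 3 4 unfolding poly_up_nodes P_def A0 B1 by (simp only: mult_ac)
qed

text \<open>The left side is minus a product of two differences,
  \<open>qp (- M) * qsin (j + u) - qsin (j + u + M)\<close> and its analogue for
  \<open>j - u\<close>. Each difference is a phase times \<open>qsin M\<close>.\<close>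

lemma qsin_identity:
  "qp (- M) * (qsin (j + u + M) * qsin (j - u) + qsin (j + u) * qsin (j - u - M))
    - qp (- (2 * M)) * (qsin (j + u) * qsin (j - u)) - qsin (j + u + M) * qsin (j - u - M)
  = qp (2 * u) * (qsin M)\<^sup>2"
proof -
  have "qp (- M) * qsin (j + u) - qsin (j + u + M) = - qp (j + u) * qsin M"
    unfolding qsin_def by (simp add: algebra_simps flip: qp_add)
  moreover have "qp (- M) * qsin (j - u) - qsin (j - u - M) = qp (- (j - u)) * qsin M"
    unfolding qsin_def by (simp add: algebra_simps flip: qp_add)
  ultimately have "(qp (- M) * qsin (j + u) - qsin (j + u + M)) * (qp (- M) * qsin (j - u) - qsin (j - u - M))
    = - (qp (j + u) * qp (- (j - u))) * (qsin M)\<^sup>2" by (simp add: power2_eq_square)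
  also have "qp (j + u) * qp (- (j - u)) = qp (2 * u)" unfolding qp_add[symmetric] by simp
  finally have "- ((qp (- M) * qsin (j + u) - qsin (j + u + M)) * (qp (- M) * qsin (j - u) - qsin (j - u - M)))
    = qp (2 * u) * (qsin M)\<^sup>2" by simp
  moreover have "qp (- (2 * M)) = qp (- M) * qp (- M)" unfolding qp_add[symmetric] by simp
  ultimately show ?thesis by (simp add: algebra_simps)
qed

lemma kap_Suc:
  assumes "Suc m < l"
  shows "kap m = kap (Suc m) * (qsin (int (Suc m)))\<^sup>2"
proof -
  have f: "qfact q (Suc m) = qfact q m * (qsin (int (Suc m)) / dl)"
  proof -
    have "qfact q (Suc m) = qfact q m * qint q (int (Suc m))" by (simp add: qfact_def)
    then show ?thesis by (simp only: qint_def qsin_def dl_def)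
  qed
  have "qsin (int (Suc m)) \<noteq> 0"
    using qint_nz[of "int (Suc m)"] assms by (auto simp: qint_def qsin_def)
  then show ?thesis
    using qfact_nz[of m] assms unfolding kap_def f by (simp add: field_simps power2_eq_square)
qed

text \<open>Moving the summation variable by \<open>half\<close> or 1 gives the sums the common
  factors \<open>al u\<close> and \<open>P u\<close>, after which \<open>qsin_identity\<close> holds
  term by term. On the Fourier side, steps of \<open>half\<close> in \<open>j\<close> multiply by
  \<open>qp (2 * k)\<close> and \<open>qp (- 2 * k)\<close>, so the right side corresponds to the
  factor \<open>ch k - ch (w - 1 - (m + 1))\<close>.\<close>

lemma drinfeld_coeff_Suc:
  assumes "Suc m < l"
  shows "drinfeld_coeff m w j = drinfeld_coeff (Suc m) w (j + half) + drinfeld_coeff (Suc m) w (j - half)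
    - ch (w - 1 - int (Suc m)) * drinfeld_coeff (Suc m) w j"
proof -
  define M where "M = int (Suc m)"
  define al where "al u = qp (verma_exp M w u)" for u
  define f where "f n u j = poly (up_nodes n u) (ch j)" for n u j
  define P where "P u = f m (u + 1) j" for u
  have half: "2 * half = int l + 1" by (simp add: half_def l_eq)
  have per: "periodic (\<lambda>u. qp (verma_exp n w u) * f m' u j')" for n m' j'
    unfolding f_def by (intro periodic_mult periodic_verma_exp periodic_poly_up_nodes)
  have al_half: "al (u + half) = qp (2 * w - M - 2) * al u" for u
    unfolding al_def qp_add[symmetric]
  proof (rule qp_cong)
    have "verma_exp M w (u + half) - (2 * w - M - 2 + verma_exp M w u)
      = (2 * half) * (2 * w + 2 * r - M - 1) - (2 * w - M - 2)"
      by (simp add: verma_exp_def algebra_simps)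
    also have "\<dots> = int l * (2 * w + 2 * r - M)" unfolding half l_eq by (simp add: algebra_simps)
    finally show "int l dvd verma_exp M w (u + half) - (2 * w - M - 2 + verma_exp M w u)" by simp
  qed
  have al_1: "al (u + 1) = qp (4 * w - 2 * M - 4) * al u" for u
    unfolding al_def qp_add[symmetric]
  proof (rule qp_cong)
    have "verma_exp M w (u + 1) - (4 * w - 2 * M - 4 + verma_exp M w u) = int l * 2"
      by (simp add: verma_exp_def l_eq algebra_simps)
    then show "int l dvd verma_exp M w (u + 1) - (4 * w - 2 * M - 4 + verma_exp M w u)" by simp
  qed
  have al_m: "qp (verma_exp (int m) w (u + 1)) = qp (2 * w - 2 + 2 * u) * al u" for u
    unfolding al_def qp_add[symmetric]
  proof (rule qp_cong)
    have "verma_exp (int m) w (u + 1) - (2 * w - 2 + 2 * u + verma_exp M w u) = int l * 2"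
      by (simp add: verma_exp_def l_eq M_def algebra_simps)
    then show "int l dvd verma_exp (int m) w (u + 1) - (2 * w - 2 + 2 * u + verma_exp M w u)" by simp
  qed
  note shifts = poly_up_nodes_shifts[of m _ j, folded f_def M_def, folded P_def]
  have plus: "drinfeld_coeff (Suc m) w (j + half) = kap (Suc m) * (\<Sum>u\<in>residues. qp (2 * w - M - 2) * al u * (P u * (qsin (j + u + M) * qsin (j - u))))"
    using sum_residues_shift[OF per[of M "Suc m" "j + half"], of half]
    by (simp only: drinfeld_coeff_def f_def[symmetric] M_def[symmetric] al_def[symmetric] al_half shifts(3))
  have minus: "drinfeld_coeff (Suc m) w (j - half) = kap (Suc m) * (\<Sum>u\<in>residues. qp (2 * w - M - 2) * al u * (P u * (qsin (j + u) * qsin (j - u - M))))"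
    using sum_residues_shift[OF per[of M "Suc m" "j - half"], of half]
    by (simp only: drinfeld_coeff_def f_def[symmetric] M_def[symmetric] al_def[symmetric] al_half shifts(4))
  have zero: "drinfeld_coeff (Suc m) w j = kap (Suc m) * (\<Sum>u\<in>residues. al u * (P u * (qsin (j + u) * qsin (j - u))))"
    by (simp only: drinfeld_coeff_def f_def[symmetric] M_def[symmetric] al_def[symmetric] shifts(1))
  have one: "drinfeld_coeff (Suc m) w j = kap (Suc m) * (\<Sum>u\<in>residues. qp (4 * w - 2 * M - 4) * al u * (P u * (qsin (j + u + M) * qsin (j - u - M))))"
    using sum_residues_shift[OF per[of M "Suc m" j], of 1]
    by (simp only: drinfeld_coeff_def f_def[symmetric] M_def[symmetric] al_def[symmetric] al_1 shifts(2))
  have lhs: "drinfeld_coeff m w j = kap (Suc m) * (\<Sum>u\<in>residues. (qsin M)\<^sup>2 * (qp (2 * w - 2 + 2 * u) * al u * P u))"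
    using sum_residues_shift[OF per[of "int m" m j], of 1]
    by (simp only: drinfeld_coeff_def f_def[symmetric] al_m P_def[symmetric] kap_Suc[OF assms] M_def[symmetric]
        sum_distrib_left[symmetric] mult.assoc)
  \<comment> \<open>The two exponentials in \<open>ch\<close> are applied to different forms of the
    same coefficient: the first to \<open>zero\<close>, the second to the shifted
    \<open>one\<close>. This matches the two negative terms of \<open>qsin_identity\<close>.\<close>
  have "ch (w - 1 - M) * drinfeld_coeff (Suc m) w j = qp (2 * (w - 1 - M)) * drinfeld_coeff (Suc m) w j + qp (- (2 * (w - 1 - M))) * drinfeld_coeff (Suc m) w j"
    by (simp add: ch_def distrib_right)
  also have "qp (2 * (w - 1 - M)) * drinfeld_coeff (Suc m) w j = kap (Suc m) * (\<Sum>u\<in>residues. qp (2 * (w - 1 - M)) * al u * (P u * (qsin (j + u) * qsin (j - u))))"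
    unfolding zero by (simp only: sum_distrib_left mult_ac)
  also have "qp (- (2 * (w - 1 - M))) * drinfeld_coeff (Suc m) w j = kap (Suc m) * (\<Sum>u\<in>residues. qp (2 * w - 2) * al u * (P u * (qsin (j + u + M) * qsin (j - u - M))))"
  proof -
    have "qp (2 * w - 2) = qp (- (2 * (w - 1 - M))) * qp (4 * w - 2 * M - 4)"
      unfolding qp_add[symmetric] by (simp add: algebra_simps)
    then show ?thesis unfolding one by (simp only: sum_distrib_left mult_ac)
  qed
  finally have chz: "ch (w - 1 - M) * drinfeld_coeff (Suc m) w j
    = kap (Suc m) * (\<Sum>u\<in>residues. qp (2 * (w - 1 - M)) * al u * (P u * (qsin (j + u) * qsin (j - u))))
    + kap (Suc m) * (\<Sum>u\<in>residues. qp (2 * w - 2) * al u * (P u * (qsin (j + u + M) * qsin (j - u - M))))" .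
  have summand: "(qsin M)\<^sup>2 * (qp (2 * w - 2 + 2 * u) * al u * P u)
    = qp (2 * w - M - 2) * al u * (P u * (qsin (j + u + M) * qsin (j - u)))
    + qp (2 * w - M - 2) * al u * (P u * (qsin (j + u) * qsin (j - u - M)))
    - (qp (2 * (w - 1 - M)) * al u * (P u * (qsin (j + u) * qsin (j - u)))
    + qp (2 * w - 2) * al u * (P u * (qsin (j + u + M) * qsin (j - u - M))))" for u
  proof -
    have e: "qp (2 * w - M - 2) = qp (2 * w - 2) * qp (- M)" "qp (2 * (w - 1 - M)) = qp (2 * w - 2) * qp (- (2 * M))"
      "qp (2 * w - 2 + 2 * u) = qp (2 * w - 2) * qp (2 * u)"
      unfolding qp_add[symmetric] by (simp_all add: algebra_simps)
    have "(qsin M)\<^sup>2 * (qp (2 * w - 2 + 2 * u) * al u * P u) = qp (2 * w - 2) * al u * P u * (qp (2 * u) * (qsin M)\<^sup>2)"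
      unfolding e by (simp only: mult_ac)
    then show ?thesis unfolding qsin_identity[of M j u, symmetric] e by (simp add: algebra_simps)
  qed
  show ?thesis
    unfolding lhs plus minus M_def[symmetric] chz distrib_left[symmetric] right_diff_distrib[symmetric]
      sum.distrib[symmetric] sum_subtractf[symmetric] summand ..
qed

text \<open>As a root of \<open>Psi\<close> the value \<open>ch j\<close> comes from both
  \<open>j\<close> and \<open>- j\<close>, so removing the factor of \<open>k\<close> leaves a root
  unless both are 0 modulo \<open>l\<close>.\<close>

lemma poly_Psi_at_eq_0:
  assumes "\<not> (int l dvd j \<and> int l dvd k)"
  shows "poly (Psi_at k) (ch j) = 0"
proof -
  have main: "poly (Psi_at k) (ch j) = 0" if "\<not> int l dvd j - k" for j
  proof -
    define i where "i = nat ((j - k - 1) mod int l)"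
    have i: "int i = (j - k - 1) mod int l" "i < l" using l_pos by (simp_all add: i_def nat_less_iff)
    have "i \<noteq> l - 1"
    proof
      assume "i = l - 1"
      then have "(j - k - 1) mod int l = int l - 1" using i(1) l_ge by (simp add: of_nat_diff)
      then have "(j - k - 1 + 1) mod int l = 0" by (metis diff_add_cancel mod_add_left_eq mod_self)
      then show False using that by (simp add: dvd_eq_mod_eq_0)
    qed
    then have "i < l - 1" using i(2) by simp
    moreover have "ch (k + 1 + int i) = ch j"
      by (rule periodicD[OF periodic_ch]) (simp add: i(1) mod_eq_dvd_iff[symmetric] mod_simps)
    ultimately show ?thesis
      unfolding Psi_at_def up_nodes_def poly_prod by (intro prod_zero) (auto intro!: bexI[of _ i])
  qed
  show ?thesis
  proof (cases "int l dvd j - k")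
    case False
    then show ?thesis by (rule main)
  next
    case True
    then have "\<not> int l dvd - j - k"
    proof -
      have "int l dvd j" "int l dvd k" if d: "int l dvd - j - k"
      proof -
        have "int l dvd (j - k) - (- j - k)" "int l dvd (j - k) + (- j - k)" using True d by (rule dvd_diff, rule dvd_add)
        then have "int l dvd 2 * j" "int l dvd 2 * - k" by simp_all
        then show "int l dvd j" "int l dvd k" unfolding dvd_2_mult by simp_all
      qed
      then show ?thesis using assms by blast
    qed
    then show ?thesis using main[of "- j"] by (simp add: ch_neg)
  qed
qed

text \<open>\<open>ch 0\<close> is the Casimir eigenvalue of the Steinberg module and the only
  simple root of \<open>Psi\<close>; this constant is the derivative of \<open>Psi\<close>
  there.\<close>

definition steinberg_const :: complex where "steinberg_const = poly (Psi_at 0) (ch 0)"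

lemma steinberg_const_nz: "steinberg_const \<noteq> 0"
proof -
  have "ch (1 + int i) \<noteq> ch 0" if "i < l - 1" for i
  proof
    assume "ch (1 + int i) = ch 0"
    then have "int l dvd 1 + int i" by (auto simp: ch_eq_iff)
    then show False using that zdvd_imp_le[of "int l" "1 + int i"] by auto
  qed
  then have "ch 0 \<noteq> ch (1 + int i)" if "i < l - 1" for i using that by metis
  then show ?thesis unfolding steinberg_const_def Psi_at_def up_nodes_def poly_prod by (auto simp: prod_zero_iff)
qed

definition fourier_const :: complex where "fourier_const = kap (l - 1) * steinberg_const / of_nat l"

lemma fourier_const_nz: "fourier_const \<noteq> 0"
  using qfact_nz[of "l - 1"] l_ge by (simp add: fourier_const_def kap_def steinberg_const_nz)

text \<open>At \<open>m = l - 1\<close> the node product is \<open>Psi_at (u - 1)\<close>, whose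
  value at \<open>ch j\<close> survives only for \<open>u = 1\<close> and \<open>j = 0\<close>
  modulo \<open>l\<close>. The resulting delta function is written as a character sum, whence the
  division by \<open>l\<close> in \<open>fourier_const\<close>.\<close>

lemma drinfeld_coeff_top:
  "drinfeld_coeff (l - 1) w j = fourier_const * (if int l dvd j then of_nat l else 0)"
proof -
  have up: "up_nodes (l - 1) u = Psi_at (u - 1)" for u by (simp add: Psi_at_def)
  have top: "qp (verma_exp (int (l - 1)) w u) * poly (Psi_at (u - 1)) (ch j)
    = (if int l dvd u - 1 then (if int l dvd j then steinberg_const else 0) else 0)" for u
  proof (cases "int l dvd j \<and> int l dvd u - 1")
    case True
    have "Psi_at (u - 1) = Psi_at 0" "ch j = ch 0"
      using True by (auto intro!: periodicD[OF periodic_Psi_at] periodicD[OF periodic_ch])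
    moreover have "qp (verma_exp (int (l - 1)) w u) = 1"
    proof -
      have "qp (verma_exp (int (l - 1)) w u) = qp (verma_exp (int (l - 1)) w 1)"
        using periodicD[OF periodic_verma_exp] True by blast
      moreover have "int (l - 1) = 2 * r" using l_eq l_ge by (simp add: of_nat_diff)
      then have "verma_exp (int (l - 1)) w 1 = int l * (4 * w - 1)"
        by (simp add: verma_exp_def l_eq algebra_simps)
      ultimately show ?thesis by (simp only: qp_mult_int)
    qed
    ultimately show ?thesis using True by (simp add: steinberg_const_def)
  next
    case False
    then show ?thesis using poly_Psi_at_eq_0[of j "u - 1"] by auto
  qed
  have "drinfeld_coeff (l - 1) w j = kap (l - 1) * (if int l dvd j then steinberg_const else 0)"
    unfolding drinfeld_coeff_def up top by (simp add: sum_residues_delta[OF periodic_const])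
  then show ?thesis by (simp add: fourier_const_def)
qed

text \<open>Both sides satisfy the recursion of \<open>drinfeld_coeff_Suc\<close>; the induction
  descends from the top coefficient.\<close>

lemma drinfeld_coeff_eq:
  assumes "m < l"
  shows "drinfeld_coeff m w j = fourier_const * (\<Sum>k\<in>residues. qp (4 * j * k) * poly (up_nodes (l - 1 - m) w) (ch k))"
proof -
  have "m \<le> l - 1" using assms by simp
  then show ?thesis
  proof (induction m arbitrary: j rule: inc_induct)
    case base
    show ?case
      by (simp only: drinfeld_coeff_top diff_self_eq_0 nodes_0 poly_1 mult_1_right sum_qp dvd_4_mult)
  next
    case (step m)
    let ?p = "\<lambda>k. poly (up_nodes (l - 1 - Suc m) w) (ch k)"
    have m: "Suc m < l" using step by simp
    have half: "2 * half = int l + 1" by (simp add: half_def l_eq)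
    have shift: "qp (4 * (j + half) * k) = qp (4 * j * k) * qp (2 * k)" "qp (4 * (j - half) * k) = qp (4 * j * k) * qp (- 2 * k)" for k
    proof -
      have "4 * (j + half) * k - (4 * j * k + 2 * k) = 2 * (2 * half) * k - 2 * k" by (simp add: algebra_simps)
      also have "\<dots> = int l * (2 * k)" unfolding half by (simp add: algebra_simps)
      finally show "qp (4 * (j + half) * k) = qp (4 * j * k) * qp (2 * k)"
        unfolding qp_add[symmetric] by (intro qp_cong) simp
      have "4 * (j - half) * k - (4 * j * k + - 2 * k) = 2 * k - 2 * (2 * half) * k" by (simp add: algebra_simps)
      also have "\<dots> = int l * (- 2 * k)" unfolding half by (simp add: algebra_simps)
      finally show "qp (4 * (j - half) * k) = qp (4 * j * k) * qp (- 2 * k)"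
        unfolding qp_add[symmetric] by (intro qp_cong) simp
    qed
    have up: "poly (up_nodes (l - 1 - m) w) (ch k) = (ch k - ch (w - 1 - int (Suc m))) * ?p k" for k
    proof -
      have "l - 1 - m = Suc (l - 1 - Suc m)" using m by simp
      moreover have "nd (w + int (l - 1 - Suc m)) = nd (w - 1 - int (Suc m))"
        using m by (intro periodicD[OF periodic_nd]) (simp add: of_nat_diff)
      ultimately have "up_nodes (l - 1 - m) w = nd (w - 1 - int (Suc m)) * up_nodes (l - 1 - Suc m) w"
        by (simp only: up_nodes_Suc)
      then show ?thesis by (simp only: poly_mult) (simp add: algebra_simps)
    qed
    have "drinfeld_coeff m w j = fourier_const * ((\<Sum>k\<in>residues. qp (4 * j * k) * qp (2 * k) * ?p k)
      + (\<Sum>k\<in>residues. qp (4 * j * k) * qp (- 2 * k) * ?p k)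
      - (\<Sum>k\<in>residues. ch (w - 1 - int (Suc m)) * (qp (4 * j * k) * ?p k)))"
      unfolding drinfeld_coeff_Suc[OF m] step.IH shift sum_distrib_left[symmetric] by (simp add: algebra_simps)
    also have "\<dots> = fourier_const * (\<Sum>k\<in>residues. qp (4 * j * k) * poly (up_nodes (l - 1 - m) w) (ch k))"
      unfolding sum.distrib[symmetric] sum_subtractf[symmetric] up
      by (intro arg_cong[where f = "(*) fourier_const"] sum.cong refl) (simp add: ch_def algebra_simps)
    finally show ?case .
  qed
qed

text \<open>With the coefficients in Fourier form, the sum over \<open>m\<close> for fixed
  \<open>k\<close> is the divided difference of \<open>Psi\<close> at \<open>ch k\<close>, hence
  \<open>Psi_at k\<close>.\<close>

lemma drinfeld_mu: "drinfeld_map Rm (mu j) = fourier_const *\<^sub>C (\<Sum>k\<in>residues. qp (4 * j * k) *\<^sub>C ec k)"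
proof (rule eq_if_pr_eq)
  fix w
  have "(\<Sum>m<l. smult (drinfeld_coeff m w j) (down_nodes m w))
    = (\<Sum>m<l. \<Sum>k\<in>residues. smult (fourier_const * qp (4 * j * k)) (smult (poly (up_nodes (l - 1 - m) w) (ch k)) (down_nodes m w)))"
  proof (intro sum.cong refl)
    fix m assume "m \<in> {..<l}"
    then have "m < l" by simp
    then show "smult (drinfeld_coeff m w j) (down_nodes m w)
      = (\<Sum>k\<in>residues. smult (fourier_const * qp (4 * j * k)) (smult (poly (up_nodes (l - 1 - m) w) (ch k)) (down_nodes m w)))"
      unfolding drinfeld_coeff_eq[OF \<open>m < l\<close>] smult_smult
      by (simp only: sum_distrib_left smult_sum[symmetric] mult.assoc)
  qed
  also have "\<dots> = (\<Sum>k\<in>residues. smult (fourier_const * qp (4 * j * k)) (Psi_at k))"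
    by (subst sum.swap) (simp only: sum_smult divided_difference_down)
  finally show "drinfeld_map Rm (mu j) * pr w = fourier_const *\<^sub>C (\<Sum>k\<in>residues. qp (4 * j * k) *\<^sub>C ec k) * pr w"
    unfolding drinfeld_mu_pr
    by (simp only: alg_eval_sum alg_eval_smult ec_def cvs.scale_sum_right scaleC_scaleC)
qed

end

lemma tens_nz:
  fixes x :: "'a::complex_vector" and y :: "'b::complex_vector"
  assumes "x \<noteq> 0" "y \<noteq> 0"
  shows "x \<^bold>\<otimes> y \<noteq> 0"
proof
  assume z: "x \<^bold>\<otimes> y = 0"
  obtain g :: "'a \<Rightarrow> complex" where g: "clinear g" "g x \<noteq> 0" by (rule clinear_separates[OF assms(1)])
  obtain h :: "'b \<Rightarrow> complex" where h: "clinear h" "h y \<noteq> 0" by (rule clinear_separates[OF assms(2)])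
  have "cbilinear (\<lambda>a b. g a * h b)"
    using g(1) h(1) by (simp add: cbilinear_iff clinear_iff algebra_simps)
  then have "tensor_lift (\<lambda>a b. g a * h b) (x \<^bold>\<otimes> y) = g x * h y" by (rule tensor_lift_tens)
  then show False using g(2) h(2) by (simp add: z tensor_lift_zero)
qed

lemma clinear_lincomb:
  assumes "\<And>j. j \<in> X \<Longrightarrow> clinear (b j)"
  shows "clinear (\<lambda>x. \<Sum>j\<in>X. c j * (b j x :: complex))"
  using assms by (auto simp: clinear_iff sum.distrib distrib_left sum_distrib_left mult.left_commute intro!: sum.cong)

lemma tensor_slice_lincomb:
  assumes "\<And>j. j \<in> X \<Longrightarrow> clinear (b j)"
  shows "tensor_slice (\<lambda>x. \<Sum>j\<in>X. c j * b j x) t = (\<Sum>j\<in>X. c j *\<^sub>C tensor_slice (b j) t)"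
proof (induction t rule: tensor_induct)
  case zero
  then show ?case by (simp add: slice_simps)
next
  case (add u v t)
  have lin: "clinear (\<lambda>x. \<Sum>j\<in>X. c j * b j x)" by (rule clinear_lincomb[OF assms])
  have "tensor_slice (\<lambda>x. \<Sum>j\<in>X. c j * b j x) (u \<^bold>\<otimes> v) = (\<Sum>j\<in>X. c j *\<^sub>C tensor_slice (b j) (u \<^bold>\<otimes> v))"
    unfolding tensor_slice_tens[OF lin] cvs.scale_sum_left
    by (intro sum.cong refl) (simp add: assms tensor_slice_tens scaleC_scaleC)
  then show ?case using add by (simp add: slice_simps scaleC_add_right sum.distrib)
qed

lemma tensor_slice_diff:
  assumes "clinear \<beta>" "clinear \<gamma>"
  shows "tensor_slice (\<lambda>x. \<beta> x - \<gamma> x) t = tensor_slice \<beta> t - tensor_slice \<gamma> t"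
proof (induction t rule: tensor_induct)
  case (add u v t)
  have "clinear (\<lambda>x. \<beta> x - \<gamma> x)" using assms by (simp add: clinear_iff algebra_simps)
  then show ?case using add assms by (simp add: slice_simps tensor_slice_tens cvs.scale_left_diff_distrib)
qed (simp add: slice_simps)

context small_quantum_sl2_root
begin

section \<open>The ribbon element\<close>

text \<open>Highest weight vectors inside the algebra, acted on by left multiplication.\<close>

definition vac :: "int \<Rightarrow> 'a" where "vac j = pr j * E ^ (l - 1)"

lemma vac_nz: "vac j \<noteq> 0"
proof -
  have "vac j = F ^ 0 * E ^ (l - 1) * pr (j - int (l - 1))" by (simp add: vac_def E_pow_pr)
  then show ?thesis using pbw_nz[of 0 "l - 1"] l_ge by simp
qed

lemma E_vac: "0 < m \<Longrightarrow> E ^ m * vac j = 0"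
proof -
  assume "0 < m"
  then have "E ^ (m + (l - 1)) = 0" by (intro E_pow_ge) simp
  then have "E ^ m * E ^ (l - 1) = 0" by (simp only: power_add)
  moreover have "E ^ m * vac j = pr (j + int m) * (E ^ m * E ^ (l - 1))"
    by (simp only: vac_def mult.assoc[symmetric] E_pow_pr)
  ultimately show ?thesis by simp
qed

lemma pr_vac: "pr w * vac j = (if int l dvd w - j then vac j else 0)"
  by (simp add: vac_def mult.assoc[symmetric] pr_pr)

text \<open>The Harish-Chandra projection: a basis element of weight zero either ends in
  \<open>E\<close>, up to idempotents, or contains neither \<open>E\<close> nor \<open>F\<close>,
  since exponents stay below \<open>l\<close>.\<close>

lemma weight_zero_decomp:
  "\<exists>h t. (\<Sum>u\<in>residues. pr u * x * pr u) = (\<Sum>w\<in>residues. h w *\<^sub>C pr w) + t * E"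
proof (induction x rule: pbw_induct)
  case (add x y)
  then obtain h t h' t' where "(\<Sum>u\<in>residues. pr u * x * pr u) = (\<Sum>w\<in>residues. h w *\<^sub>C pr w) + t * E"
    "(\<Sum>u\<in>residues. pr u * y * pr u) = (\<Sum>w\<in>residues. h' w *\<^sub>C pr w) + t' * E" by blast
  then show ?case
    by (intro exI[of _ "\<lambda>w. h w + h' w"] exI[of _ "t + t'"])
      (simp add: distrib_left distrib_right sum.distrib scaleC_add_left)
next
  case (scale c x)
  then obtain h t where "(\<Sum>u\<in>residues. pr u * x * pr u) = (\<Sum>w\<in>residues. h w *\<^sub>C pr w) + t * E" by blast
  then have "c *\<^sub>C (\<Sum>u\<in>residues. pr u * x * pr u) = (\<Sum>w\<in>residues. (c * h w) *\<^sub>C pr w) + (c *\<^sub>C t) * E"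
    by (simp add: scaleC_add_right cvs.scale_sum_right scaleC_scaleC mult_scaleC_left)
  then show ?case
    by (intro exI[of _ "\<lambda>w. c * h w"] exI[of _ "c *\<^sub>C t"])
      (simp add: mult_scaleC_left mult_scaleC_right cvs.scale_sum_right)
next
  case (pbw m n w)
  show ?case
  proof (cases n)
    case (Suc k)
    have "F ^ m * E ^ n * pr w = F ^ m * E ^ k * pr (w + 1) * E"
    proof -
      have "F ^ m * E ^ n * pr w = F ^ m * E ^ k * (E * pr w)" by (simp only: Suc power_Suc2 mult.assoc)
      then show ?thesis by (simp only: E_pr mult.assoc)
    qed
    then have "pr u * (F ^ m * E ^ n * pr w) * pr u = pr u * (F ^ m * E ^ k * pr (w + 1)) * pr (u + 1) * E" for u
      by (simp only: mult.assoc E_pr)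
    then have "(\<Sum>u\<in>residues. pr u * (F ^ m * E ^ n * pr w) * pr u)
      = (\<Sum>w\<in>residues. 0 *\<^sub>C pr w) + (\<Sum>u\<in>residues. pr u * (F ^ m * E ^ k * pr (w + 1)) * pr (u + 1)) * E"
      by (simp add: sum_distrib_right)
    then show ?thesis
      by (intro exI[of _ "\<lambda>_. 0"] exI[of _ "\<Sum>u\<in>residues. pr u * (F ^ m * E ^ k * pr (w + 1)) * pr (u + 1)"])
  next
    case n: 0
    show ?thesis
    proof (cases m)
      case 0
      have "pr u * pr w * pr u = pr w * pr u" for u
      proof -
        have "pr u * pr w = pr w * pr u"
          using periodicD[OF periodic_pr, of u w] by (auto simp: pr_pr dvd_diff_commute)
        then show ?thesis by (simp add: mult.assoc pr_idem)
      qed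
      then have "(\<Sum>u\<in>residues. pr u * pr w * pr u) = pr w"
        by (simp add: sum_distrib_left[symmetric] sum_pr)
      also have "pr w = (\<Sum>v\<in>residues. (if int l dvd v - w then 1 else 0) *\<^sub>C pr v)"
      proof -
        have "(\<Sum>v\<in>residues. (if int l dvd v - w then 1 else 0) *\<^sub>C pr v) = (\<Sum>v\<in>residues. if int l dvd v - w then pr v else 0)"
          by (intro sum.cong) (auto simp: scaleC_one)
        then show ?thesis by (simp add: sum_residues_delta[OF periodic_pr])
      qed
      finally show ?thesis using n 0
        by (intro exI[of _ "\<lambda>v. if int l dvd v - w then 1 else 0"] exI[of _ 0]) simp
    next
      case (Suc k)
      have "pr u * (F ^ m * E ^ n * pr w) * pr u = 0" for u
      proof -
        have "pr u * (F ^ m * E ^ n * pr w) * pr u = F ^ m * (pr (u + int m) * (pr w * pr u))"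
          using F_pow_pr[of m "u + int m"] by (simp add: n mult.assoc[symmetric])
        also have "\<dots> = (if int l dvd w - u then if int l dvd u + int m - u then F ^ m * pr u else 0 else 0)"
          by (simp add: pr_pr)
        also have "\<not> int l dvd u + int m - u" using pbw Suc by (auto dest: zdvd_imp_le)
        then have "(if int l dvd w - u then if int l dvd u + int m - u then F ^ m * pr u else 0 else 0) = 0" by simp
        finally show ?thesis .
      qed
      then show ?thesis by (intro exI[of _ "\<lambda>_. 0"] exI[of _ 0]) simp
    qed
  qed
qed

lemma Kp_comult: "\<Delta> (Kp a) = Kp a \<^bold>\<otimes> Kp a"
  by (simp add: Kp_def calg_homD(4)[OF comult_hom] comult_K tens_power)

text \<open>Weight exponents add: \<open>(2 * i - 1) + (2 * j - 1)\<close> equals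
  \<open>2 * (i + j + r) - 1\<close> modulo \<open>l\<close>.\<close>

lemma comult_pr_vac:
  "\<Delta> (pr w) * (vac i \<^bold>\<otimes> vac j) = (if int l dvd w - (i + j + r) then vac i \<^bold>\<otimes> vac j else 0)"
proof -
  have Kv: "Kp a * vac j = qp ((2 * j - 1) * a) *\<^sub>C vac j" for a j
    by (simp add: vac_def mult.assoc[symmetric] Kp_pr mult_scaleC_left)
  have "\<Delta> (pr w) * (vac i \<^bold>\<otimes> vac j) = (1 / of_nat l) *\<^sub>C (\<Sum>a\<in>residues.
      (qp (- ((2 * w - 1) * a)) * (qp ((2 * i - 1) * a) * qp ((2 * j - 1) * a))) *\<^sub>C (vac i \<^bold>\<otimes> vac j))"
    unfolding pr_def
    by (simp add: clinear_scale[OF comult_linear] clinear_sum[OF comult_linear] Kp_comult sum_distrib_right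
        mult_scaleC_left tens_times_tens Kv tens_scaleC_left tens_scaleC_right scaleC_scaleC mult_ac)
  also have "\<dots> = ((1 / of_nat l) * (\<Sum>a\<in>residues. qp ((2 * (i + j + r - w) - int l) * a))) *\<^sub>C (vac i \<^bold>\<otimes> vac j)"
    unfolding cvs.scale_sum_left[symmetric] scaleC_scaleC qp_add[symmetric]
    by (simp add: l_eq algebra_simps)
  also have "int l dvd 2 * (i + j + r - w) - int l \<longleftrightarrow> int l dvd w - (i + j + r)"
    using dvd_add_left_iff[of "int l" "int l" "2 * (i + j + r - w) - int l"] dvd_2_mult[of "i + j + r - w"]
    by (simp add: dvd_diff_commute)
  then have "(1 / of_nat l) * (\<Sum>a\<in>residues. qp ((2 * (i + j + r - w) - int l) * a)) = (if int l dvd w - (i + j + r) then 1 else 0)"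
    by (simp only: sum_qp) simp
  finally show ?thesis by (simp add: scaleC_one)
qed

text \<open>Modulo the left ideal of \<open>E\<close> a central element is a function of
  \<open>K\<close>, and this is all that a highest weight vector sees, both in the algebra and in
  its tensor square. The same function \<open>h\<close> thus occurs in all conclusions.\<close>

lemma central_eigenvalue:
  assumes z: "\<And>x. z * x = x * z"
  obtains h where "periodic h" "\<And>j. z * vac j = h j *\<^sub>C vac j"
    "\<And>i j. \<Delta> z * (vac i \<^bold>\<otimes> vac j) = h (i + j + r) *\<^sub>C (vac i \<^bold>\<otimes> vac j)"
    "\<And>j. z * ec j = h j *\<^sub>C ec j"
proof -
  obtain g t where gt: "(\<Sum>u\<in>residues. pr u * z * pr u) = (\<Sum>w\<in>residues. g w *\<^sub>C pr w) + t * E"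
    using weight_zero_decomp by blast
  have "(\<Sum>u\<in>residues. pr u * z * pr u) = (\<Sum>u\<in>residues. z * pr u)"
    by (intro sum.cong refl) (simp add: z[symmetric] mult.assoc pr_idem)
  then have zsum: "z = (\<Sum>w\<in>residues. g w *\<^sub>C pr w) + t * E"
    using gt by (simp add: sum_distrib_left[symmetric] sum_pr)
  define h where "h j = g (j mod int l)" for j
  have h: "periodic h" by (rule periodicI) (simp add: h_def mod_eq_dvd_iff[symmetric])
  have hg: "g w = h w" if "w \<in> residues" for w using that by (simp add: h_def)
  have delta: "(\<Sum>w\<in>residues. g w *\<^sub>C (if int l dvd w - a then x else 0)) = h a *\<^sub>C x"
    for a and x :: "'b::complex_vector"
  proof -
    have "(\<Sum>w\<in>residues. g w *\<^sub>C (if int l dvd w - a then x else 0)) = (\<Sum>w\<in>residues. if int l dvd w - a then h w *\<^sub>C x else 0)"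
      by (intro sum.cong) (auto simp: hg)
    then show ?thesis by (simp add: sum_residues_delta[OF periodic_scaleC[OF h periodic_const]])
  qed
  have 1: "z * vac j = h j *\<^sub>C vac j" for j
  proof -
    have "z * vac j = (\<Sum>w\<in>residues. g w *\<^sub>C (pr w * vac j)) + t * (E ^ 1 * vac j)"
      by (subst zsum) (simp add: distrib_right sum_distrib_right mult_scaleC_left mult.assoc)
    then show ?thesis by (simp only: E_vac[OF zero_less_one] pr_vac delta) simp
  qed
  have 2: "\<Delta> z * (vac i \<^bold>\<otimes> vac j) = h (i + j + r) *\<^sub>C (vac i \<^bold>\<otimes> vac j)" for i j
  proof -
    have "\<Delta> E * (vac i \<^bold>\<otimes> vac j) = 0"
      using E_vac[of 1 i] E_vac[of 1 j] by (simp add: comult_E distrib_right tens_times_tens)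
    moreover have "\<Delta> z * (vac i \<^bold>\<otimes> vac j) = (\<Sum>w\<in>residues. g w *\<^sub>C (\<Delta> (pr w) * (vac i \<^bold>\<otimes> vac j))) + \<Delta> t * (\<Delta> E * (vac i \<^bold>\<otimes> vac j))"
      by (subst zsum) (simp add: clinear_add[OF comult_linear] clinear_sum[OF comult_linear]
          clinear_scale[OF comult_linear] comult_mult distrib_right sum_distrib_right mult_scaleC_left mult.assoc)
    ultimately show ?thesis by (simp only: comult_pr_vac delta) simp
  qed
  have 3: "z * ec j = h j *\<^sub>C ec j" for j
  proof (rule eq_if_pr_eq)
    fix w
    \<comment> \<open>Choosing \<open>a\<close> with \<open>w + a = j\<close> modulo
      \<open>l\<close>, the element \<open>F^a * vac j * F^?b\<close> is a nonzero multiple of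
      \<open>ec j * pr w\<close>, so the eigenvalue on \<open>vac j\<close> carries over.\<close>
    define a where "a = nat ((j - w) mod int l)"
    have a: "int a = (j - w) mod int l" "a < l" using l_pos by (simp_all add: a_def nat_less_iff)
    let ?b = "l - 1 - a"
    have wa: "int l dvd w + int a - j" by (simp add: a mod_eq_dvd_iff[symmetric] mod_simps)
    have "F ^ a * vac (w + int a) * F ^ ?b = F ^ a * (E ^ (l - 1) * pr (w - int ?b)) * F ^ ?b"
    proof -
      have "E ^ (l - 1) * pr (w - int ?b) = vac (w + int a)"
        using a(2) by (simp add: E_pow_pr vac_def of_nat_diff)
      then show ?thesis by simp
    qed
    also have "\<dots> = F ^ a * E ^ (l - 1) * (F ^ ?b * pr w)" by (simp only: F_pow_pr mult.assoc)
    also have "E ^ (l - 1) = E ^ a * E ^ ?b" using a(2) by (simp flip: power_add)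
    also have "F ^ a * (E ^ a * E ^ ?b) * (F ^ ?b * pr w) = F ^ a * E ^ a * (E ^ ?b * F ^ ?b * pr w)"
      by (simp only: mult.assoc)
    also have "\<dots> = (1 / dl ^ (2 * ?b) * (1 / dl ^ (2 * a))) *\<^sub>C (ev (up_nodes a w * down_nodes ?b w) * pr w)"
    proof -
      have "F ^ a * E ^ a * (E ^ ?b * F ^ ?b * pr w) = (1 / dl ^ (2 * ?b)) *\<^sub>C (ev (down_nodes ?b w) * (F ^ a * E ^ a * pr w))"
        unfolding EF_pow_pr mult_scaleC_right ev_left_commute ..
      also have "\<dots> = (1 / dl ^ (2 * ?b) * (1 / dl ^ (2 * a))) *\<^sub>C (ev (down_nodes ?b w * up_nodes a w) * pr w)"
        unfolding FE_pow_pr[of a] by (simp only: mult_scaleC_right scaleC_scaleC alg_eval_mult mult.assoc)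
      finally show ?thesis by (simp only: mult.commute)
    qed
    also have "ev (up_nodes a w * down_nodes ?b w) = ec j"
      unfolding missing_node[OF a(2)] ec_def periodicD[OF periodic_Psi_at wa] ..
    finally have ec: "F ^ a * vac j * F ^ ?b = (1 / dl ^ (2 * ?b) * (1 / dl ^ (2 * a))) *\<^sub>C (ec j * pr w)"
      using periodicD[OF periodic_pr wa] by (simp add: vac_def)
    define c where "c = 1 / dl ^ (2 * ?b) * (1 / dl ^ (2 * a))"
    have c: "c \<noteq> 0" by (simp add: c_def)
    have "c *\<^sub>C (z * ec j * pr w) = z * (F ^ a * vac j * F ^ ?b)"
      unfolding ec by (simp add: c_def mult_scaleC_right mult.assoc)
    also have "\<dots> = F ^ a * (z * vac j) * F ^ ?b" by (metis z mult.assoc)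
    also have "\<dots> = h j *\<^sub>C (F ^ a * vac j * F ^ ?b)" by (simp only: 1 mult_scaleC_left mult_scaleC_right)
    also have "\<dots> = c *\<^sub>C (h j *\<^sub>C ec j * pr w)"
      unfolding ec by (simp add: c_def mult_scaleC_left scaleC_scaleC mult.commute)
    finally show "z * ec j * pr w = h j *\<^sub>C ec j * pr w" using c by simp
  qed
  show thesis using that[OF h 1 2 3] .
qed

text \<open>Terms with \<open>m > 0\<close> are killed by \<open>E\<close> in the first leg, and
  those with \<open>m = 0\<close> and \<open>n > 0\<close> by \<open>E\<close> in the
  second.\<close>

lemma monodromy_vac: "monodromy Rm * (vac i \<^bold>\<otimes> vac j) = qp (4 * (i + r) * (j + r)) *\<^sub>C (vac i \<^bold>\<otimes> vac j)"
proof -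
  have "vac i \<^bold>\<otimes> vac j = (pr i \<^bold>\<otimes> pr j) * (E ^ (l - 1) \<^bold>\<otimes> E ^ (l - 1))" by (simp add: vac_def tens_times_tens)
  then have "monodromy Rm * (vac i \<^bold>\<otimes> vac j) = (monodromy Rm * (pr i \<^bold>\<otimes> pr j)) * (E ^ (l - 1) \<^bold>\<otimes> E ^ (l - 1))"
    by (simp only: mult.assoc)
  also have "\<dots> = (\<Sum>m<l. \<Sum>n<l. (Rc m * Rc n * qp (mexp m n i j)) *\<^sub>C
    ((F ^ n * (E ^ m * vac i)) \<^bold>\<otimes> (E ^ n * (F ^ m * vac j))))"
    unfolding monodromy_pr by (simp add: sum_distrib_right mult_scaleC_left tens_times_tens vac_def mult.assoc)
  also have "\<dots> = (\<Sum>m<l. \<Sum>n<l. if m = 0 then if n = 0 then qp (mexp 0 0 i j) *\<^sub>C (vac i \<^bold>\<otimes> vac j) else 0 else 0)"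
    by (intro sum.cong refl) (auto simp: E_vac Rc_def qfact_def)
  also have "\<dots> = (\<Sum>m<l. if m = 0 then \<Sum>n<l. if n = 0 then qp (mexp 0 0 i j) *\<^sub>C (vac i \<^bold>\<otimes> vac j) else 0 else 0)"
    by (intro sum.cong refl) simp
  also have "\<dots> = qp (mexp 0 0 i j) *\<^sub>C (vac i \<^bold>\<otimes> vac j)" using l_ge by simp
  also have "mexp 0 0 i j = 4 * (i + r) * (j + r)" by (simp add: mexp_def tri_def algebra_simps)
  finally show ?thesis .
qed

text \<open>The second claim follows from the first axiom: \<open>\<Delta> \<theta>\<close> commutes
  with every \<open>\<Delta> x\<close> because \<open>\<theta>\<close> is central, and
  \<open>\<theta> \<otimes> \<theta>\<close> is central and invertible, so their quotient commutes
  as well.\<close>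

lemma ribbon_monodromy:
  assumes "ribbon_element \<Delta> \<epsilon> S Rm \<theta>"
  shows "monodromy Rm * \<Delta> \<theta> = \<theta> \<^bold>\<otimes> \<theta>" and "monodromy Rm * \<Delta> x = \<Delta> x * monodromy Rm"
proof -
  let ?M = "monodromy Rm"
  obtain X y where \<theta>: "\<And>x. \<theta> * x = x * \<theta>" and y: "mutually_inverse \<theta> y"
    and X: "mutually_inverse ?M X" "\<Delta> \<theta> = X * (\<theta> \<^bold>\<otimes> \<theta>)"
    using assms by (auto simp: ribbon_element_def hopf_center_def)
  have MX: "?M * X = 1" "X * ?M = 1" using X(1) by (simp_all add: mutually_inverse_def)
  show "?M * \<Delta> \<theta> = \<theta> \<^bold>\<otimes> \<theta>" by (simp add: X(2) mult.assoc[symmetric] MX)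
  have \<theta>\<theta>: "(\<theta> \<^bold>\<otimes> \<theta>) * t = t * (\<theta> \<^bold>\<otimes> \<theta>)" for t
    by (induction t rule: tensor_induct) (simp_all add: distrib_left distrib_right tens_times_tens \<theta>)
  have yy: "(\<theta> \<^bold>\<otimes> \<theta>) * (y \<^bold>\<otimes> y) = 1"
    using y by (simp add: tens_times_tens mutually_inverse_def one_tensor_def)
  have "X * \<Delta> x * (\<theta> \<^bold>\<otimes> \<theta>) = \<Delta> \<theta> * \<Delta> x" by (simp add: X(2) mult.assoc \<theta>\<theta>)
  also have "\<dots> = \<Delta> x * \<Delta> \<theta>" by (simp add: comult_mult[symmetric] \<theta>)
  also have "\<dots> = \<Delta> x * X * (\<theta> \<^bold>\<otimes> \<theta>)" by (simp add: X(2) mult.assoc)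
  finally have "X * \<Delta> x * ((\<theta> \<^bold>\<otimes> \<theta>) * (y \<^bold>\<otimes> y)) = \<Delta> x * X * ((\<theta> \<^bold>\<otimes> \<theta>) * (y \<^bold>\<otimes> y))"
    by (simp only: mult.assoc[symmetric])
  then have "X * \<Delta> x = \<Delta> x * X" by (simp only: yy mult_1_right)
  then have "?M * (X * \<Delta> x) * ?M = ?M * (\<Delta> x * X) * ?M" by simp
  then have "(?M * X) * \<Delta> x * ?M = ?M * \<Delta> x * (X * ?M)" by (simp only: mult.assoc)
  then show "?M * \<Delta> x = \<Delta> x * ?M" by (simp only: MX mult_1_left mult_1_right)
qed

lemma ribbon_eigenvalues:
  assumes ribbon: "ribbon_element \<Delta> \<epsilon> S Rm \<theta>"
  obtains d where "d \<noteq> 0" "\<And>k. unit_inv \<theta> * ec k = (d * qp (2 * k\<^sup>2)) *\<^sub>C ec k"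
proof -
  obtain y where \<theta>: "\<And>x. \<theta> * x = x * \<theta>" and y: "mutually_inverse \<theta> y"
    using ribbon by (auto simp: ribbon_element_def hopf_center_def)
  have inv: "unit_inv \<theta> = y" by (rule unit_inv_eqI[OF y])
  obtain h where h: "periodic h" "\<And>j. \<theta> * vac j = h j *\<^sub>C vac j"
    "\<And>i j. \<Delta> \<theta> * (vac i \<^bold>\<otimes> vac j) = h (i + j + r) *\<^sub>C (vac i \<^bold>\<otimes> vac j)"
    "\<And>j. \<theta> * ec j = h j *\<^sub>C ec j"
    using central_eigenvalue[OF \<theta>] by blast
  have rel: "h (i + j + r) * qp (4 * (i + r) * (j + r)) = h i * h j" for i j
  proof -
    have "monodromy Rm * \<Delta> \<theta> * (vac i \<^bold>\<otimes> vac j) = (h (i + j + r) * qp (4 * (i + r) * (j + r))) *\<^sub>C (vac i \<^bold>\<otimes> vac j)"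
      by (simp add: mult.assoc h(3) mult_scaleC_right monodromy_vac scaleC_scaleC)
    moreover have "monodromy Rm * \<Delta> \<theta> * (vac i \<^bold>\<otimes> vac j) = (h i * h j) *\<^sub>C (vac i \<^bold>\<otimes> vac j)"
      by (simp add: ribbon_monodromy(1)[OF ribbon] tens_times_tens h(2) tens_scaleC_left tens_scaleC_right
          scaleC_scaleC mult.commute)
    ultimately show ?thesis using tens_nz[OF vac_nz vac_nz, of i j] by (metis cvs.scale_right_imp_eq)
  qed
  \<comment> \<open>The elements \<open>ec j\<close> and \<open>ec (- j)\<close> coincide, so their
    eigenvalues do.\<close>
  have even: "h (- j) = h j" for j
    using h(4)[of j] h(4)[of "- j"] ec_nz[of j] by (simp add: ec_neg)
  \<comment> \<open>In \<open>rel\<close> the pairs \<open>(j - r, j)\<close> and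
    \<open>(j - r, - j)\<close> have the same right side by evenness, while the arguments on the
    left are \<open>2 * j\<close> and 0.\<close>
  have dbl: "h (2 * j) = h 0 * qp (- (8 * j * j))" for j
  proof -
    have "h (2 * j) * qp (4 * j * (j + r)) = h 0 * qp (4 * j * (r - j))"
      using rel[of "j - r" j] rel[of "j - r" "- j"] by (simp add: even)
    moreover have "qp (4 * j * (r - j)) = qp (- (8 * j * j)) * qp (4 * j * (j + r))"
      unfolding qp_add[symmetric] by (simp add: algebra_simps)
    ultimately show ?thesis by simp
  qed
  \<comment> \<open>Every residue is a double, namely of \<open>k * half\<close>.\<close>
  have val: "h k = h 0 * qp (- (2 * k\<^sup>2))" for k
  proof -
    have half: "2 * half = int l + 1" by (simp add: half_def l_eq)
    have "2 * (k * half) - k = int l * k"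
    proof -
      have "2 * (k * half) = k * (2 * half)" by simp
      then show ?thesis unfolding half by (simp add: algebra_simps)
    qed
    then have d: "int l dvd 2 * (k * half) - k" by simp
    have "h k = h (2 * (k * half))" using periodicD[OF h(1) d] by simp
    also have "\<dots> = h 0 * qp (- (8 * (k * half) * (k * half)))" by (rule dbl)
    also have "qp (- (8 * (k * half) * (k * half))) = qp (- 2 * (2 * (k * half))\<^sup>2)"
      by (simp add: power2_eq_square algebra_simps)
    also have "\<dots> = qp (- 2 * k\<^sup>2)" using periodicD[OF periodic_gauss[of "- 2"] d] .
    finally show ?thesis by simp
  qed
  have h0: "h 0 \<noteq> 0"
  proof
    assume "h 0 = 0"
    then have "y * (\<theta> * ec 0) = 0" by (simp add: h(4))
    then show False using ec_nz[of 0] y by (simp add: mult.assoc[symmetric] mutually_inverse_def)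
  qed
  have "y * ec k = (inverse (h 0) * qp (2 * k\<^sup>2)) *\<^sub>C ec k" for k
  proof -
    have "ec k = y * (\<theta> * ec k)" using y by (simp add: mult.assoc[symmetric] mutually_inverse_def)
    also have "\<dots> = (h 0 * qp (- (2 * k\<^sup>2))) *\<^sub>C (y * ec k)"
      unfolding h(4) val[of k] mult_scaleC_right ..
    finally have "(inverse (h 0) * qp (2 * k\<^sup>2)) *\<^sub>C ec k
      = (inverse (h 0) * qp (2 * k\<^sup>2) * (h 0 * qp (- (2 * k\<^sup>2)))) *\<^sub>C (y * ec k)"
      by (metis scaleC_scaleC)
    also have "inverse (h 0) * qp (2 * k\<^sup>2) * (h 0 * qp (- (2 * k\<^sup>2))) = 1"
      using h0 by (simp add: qp_minus field_simps)
    finally show ?thesis by (simp add: scaleC_one)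
  qed
  then show thesis using that[of "inverse (h 0)"] h0 inv by simp
qed

section \<open>The Drinfeld map and the center\<close>

lemma drinfeld_inj: "clinear \<beta> \<Longrightarrow> clinear \<gamma> \<Longrightarrow> drinfeld_map Rm \<beta> = drinfeld_map Rm \<gamma> \<Longrightarrow> \<beta> x = \<gamma> x"
  using drinfeld_zero[of "\<lambda>x. \<beta> x - \<gamma> x" x]
  by (simp add: drinfeld_map_def tensor_slice_diff clinear_iff algebra_simps)

lemma radford_inj: "clinear \<beta> \<Longrightarrow> clinear \<gamma> \<Longrightarrow> radford_map \<Delta> Lam \<beta> = radford_map \<Delta> Lam \<gamma> \<Longrightarrow> \<beta> x = \<gamma> x"
  using radford_zero[of "\<lambda>x. \<beta> x - \<gamma> x" x]
  by (simp add: radford_map_def tensor_slice_diff clinear_iff algebra_simps)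

text \<open>Slicing the commutation of the monodromy with the coproduct of each generator gives an
  identity between Drinfeld images, and injectivity turns it into a twisted trace relation. Every
  central element is thereby the image of a q-character.\<close>

lemma qcharacter_of_central:
  assumes comm: "\<And>x. monodromy Rm * \<Delta> x = \<Delta> x * monodromy Rm"
    and \<beta>: "clinear \<beta>" and z: "\<And>x. drinfeld_map Rm \<beta> * x = x * drinfeld_map Rm \<beta>"
  shows "\<beta> \<in> qcharacters S"
proof -
  let ?M = "monodromy Rm" and ?chi = "drinfeld_map Rm"
  have lin: "clinear (\<lambda>x. \<beta> (a * x * b))" for a b
    using \<beta> by (simp add: clinear_iff distrib_left distrib_right mult_scaleC_left mult_scaleC_right)
  have lin1: "clinear (\<lambda>x. \<beta> (a * x))" "clinear (\<lambda>x. \<beta> (x * a))" for a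
    using lin[of a 1] lin[of 1 a] by simp_all
  have conj: "K * ?chi \<gamma> = ?chi (\<lambda>x. \<gamma> (Ki * (x * K))) * K" if "clinear \<gamma>" for \<gamma>
  proof -
    have l: "clinear (\<lambda>x. \<gamma> (Ki * x))" using that by (simp add: clinear_iff distrib_left mult_scaleC_right)
    have "tensor_slice (\<lambda>x. \<gamma> (Ki * x)) (?M * (K \<^bold>\<otimes> K)) = tensor_slice (\<lambda>x. \<gamma> (Ki * x)) ((K \<^bold>\<otimes> K) * ?M)"
      using comm[of K] by (simp add: comult_K)
    then show ?thesis
      by (simp add: tensor_slice_mult[OF l] drinfeld_map_def mult.assoc[symmetric] Ki_K)
  qed
  have K: "\<beta> (x * K) = \<beta> (K * x)" for x
  proof -
    have "?chi \<beta> * K = ?chi (\<lambda>x. \<beta> (Ki * (x * K))) * K" using conj[OF \<beta>] z by simp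
    then have "?chi \<beta> * (K * Ki) = ?chi (\<lambda>x. \<beta> (Ki * (x * K))) * (K * Ki)" by (simp only: mult.assoc[symmetric])
    then have "?chi \<beta> = ?chi (\<lambda>x. \<beta> (Ki * (x * K)))" by (simp add: K_Ki)
    from drinfeld_inj[OF \<beta> _ this, of "K * x"] have "\<beta> (K * x) = \<beta> (Ki * (K * x * K))"
      using lin[of Ki K] by (simp add: mult.assoc)
    then show ?thesis by (simp add: mult.assoc[symmetric] Ki_K)
  qed
  have E: "\<beta> (x * E) = q\<^sup>2 * \<beta> (E * x)" for x
  proof -
    have "tensor_slice \<beta> (?M * (1 \<^bold>\<otimes> E)) + tensor_slice \<beta> (?M * (E \<^bold>\<otimes> K))
      = tensor_slice \<beta> ((1 \<^bold>\<otimes> E) * ?M) + tensor_slice \<beta> ((E \<^bold>\<otimes> K) * ?M)"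
      using comm[of E] by (simp add: comult_E distrib_left distrib_right slice_simps(1)[symmetric])
    then have "?chi (\<lambda>x. \<beta> (x * E)) * K = K * ?chi (\<lambda>x. \<beta> (E * x))"
      using z[of E] by (simp add: tensor_slice_mult[OF \<beta>] drinfeld_map_def)
    \<comment> \<open>Moving \<open>K\<close> across the slice makes both sides end in
      \<open>K\<close>, which can then be cancelled.\<close>
    also have "\<dots> = ?chi (\<lambda>x. \<beta> (E * (Ki * (x * K)))) * K" by (rule conj[OF lin1(1)])
    also have "(\<lambda>x. \<beta> (E * (Ki * (x * K)))) = (\<lambda>x. q\<^sup>2 * \<beta> (E * x))"
    proof
      fix x
      have "\<beta> (E * (Ki * (x * K))) = \<beta> (K * E * Ki * x)" using K[of "E * Ki * x"] by (simp add: mult.assoc)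
      then show "\<beta> (E * (Ki * (x * K))) = q\<^sup>2 * \<beta> (E * x)"
        by (simp add: K_conj mult_scaleC_left clinear_scale_complex[OF \<beta>] del: scaleC_complex)
    qed
    finally have "?chi (\<lambda>x. \<beta> (x * E)) * (K * Ki) = ?chi (\<lambda>x. q\<^sup>2 * \<beta> (E * x)) * (K * Ki)"
      by (simp only: mult.assoc[symmetric])
    then have "?chi (\<lambda>x. \<beta> (x * E)) = ?chi (\<lambda>x. q\<^sup>2 * \<beta> (E * x))" by (simp add: K_Ki)
    moreover have "clinear (\<lambda>x. q\<^sup>2 * \<beta> (E * x))" using lin1(1)[of E] by (simp add: clinear_iff algebra_simps)
    ultimately show ?thesis using drinfeld_inj[OF lin1(2)] by blast
  qed
  have F: "\<beta> (x * F) = qp (- 2) * \<beta> (F * x)" for x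
  proof -
    \<comment> \<open>The functional is twisted by \<open>K\<close> so that the factor
      \<open>Ki\<close> in the coproduct of \<open>F\<close> is absorbed and the terms without
      \<open>F\<close> in the first leg cancel by centrality.\<close>
    note slice = tensor_slice_mult[OF lin1(2)[of K]]
    have "tensor_slice (\<lambda>x. \<beta> (x * K)) (?M * (Ki \<^bold>\<otimes> F)) + tensor_slice (\<lambda>x. \<beta> (x * K)) (?M * (F \<^bold>\<otimes> 1))
      = tensor_slice (\<lambda>x. \<beta> (x * K)) ((Ki \<^bold>\<otimes> F) * ?M) + tensor_slice (\<lambda>x. \<beta> (x * K)) ((F \<^bold>\<otimes> 1) * ?M)"
      using comm[of F] by (simp add: comult_F distrib_left distrib_right slice_simps(1)[symmetric])
    moreover have "\<beta> (Ki * x * K) = \<beta> x" for x using K[of "Ki * x"] by (simp add: mult.assoc[symmetric] K_Ki)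
    ultimately have "?chi (\<lambda>x. \<beta> (x * F * K)) = ?chi (\<lambda>x. \<beta> (F * x * K))"
      using z[of F] by (simp add: slice drinfeld_map_def) (simp add: mult.assoc Ki_K)
    moreover have "clinear (\<lambda>x. \<beta> (x * F * K))" using lin[of 1 "F * K"] by (simp add: mult.assoc)
    ultimately have FK: "\<beta> (x * F * K) = \<beta> (F * x * K)" for x using drinfeld_inj[OF _ lin[of F K]] by blast
    have "\<beta> (x * F) = \<beta> (x * Ki * (K * F * Ki) * K)" by (simp add: mult.assoc Ki_K) (simp add: mult.assoc[symmetric] Ki_K)
    also have "\<dots> = qp (- 2) * \<beta> (x * Ki * F * K)"
      by (simp add: K_conj mult_scaleC_left mult_scaleC_right clinear_scale_complex[OF \<beta>] del: scaleC_complex)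
    also have "\<beta> (x * Ki * F * K) = \<beta> (F * (x * Ki) * K)" by (rule FK)
    finally show ?thesis by (simp add: mult.assoc Ki_K)
  qed
  show ?thesis unfolding qcharacters_iff using \<beta> twisted_trace_generators[OF \<beta> K E F] by blast
qed

section \<open>The modular action on the Higman ideal\<close>

text \<open>The coordinates on the Higman ideal: coefficients with respect to Drinfeld images of
  Verma traces. In them the inverse Drinfeld map contained in \<open>S_LM\<close> is
  explicit.\<close>

definition verma_map :: "(int \<Rightarrow> complex) \<Rightarrow> 'a"
  where "verma_map f = (\<Sum>j\<in>residues. f j *\<^sub>C drinfeld_map Rm (mu j))"

definition verma_char :: "(int \<Rightarrow> complex) \<Rightarrow> 'a \<Rightarrow> complex"
  where "verma_char f x = (\<Sum>j\<in>residues. f j * mu j x)"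

lemma verma_char_qcharacter: "verma_char f \<in> qcharacters S"
proof -
  have "clinear (verma_char f)" unfolding verma_char_def[abs_def] by (rule clinear_lincomb) (rule mu)
  moreover have "verma_char f (x * y) = verma_char f (K * y * Ki * x)" for x y
    unfolding verma_char_def by (intro sum.cong refl arg_cong2[where f = "(*)"] mu_twisted_trace)
  ultimately show ?thesis by (simp add: qcharacters_iff)
qed

lemma drinfeld_verma_char: "drinfeld_map Rm (verma_char f) = verma_map f"
  unfolding drinfeld_map_def verma_char_def[abs_def] verma_map_def by (rule tensor_slice_lincomb) (rule mu)

lemma radford_verma_char: "radford_map \<Delta> Lam (verma_char f) = higman_const *\<^sub>C (\<Sum>k\<in>residues. f k *\<^sub>C ec k)"
proof -
  have "radford_map \<Delta> Lam (verma_char f) = (\<Sum>k\<in>residues. f k *\<^sub>C radford_map \<Delta> Lam (mu k))"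
    unfolding radford_map_def verma_char_def[abs_def] by (rule tensor_slice_lincomb) (rule mu)
  then show ?thesis
    by (simp only: radford_mu[folded higman_const_def] cvs.scale_sum_right scaleC_scaleC mult.commute)
qed

text \<open>The Drinfeld images carry exponents \<open>4 * j * k\<close> of the opposite sign to
  \<open>fourier\<close>; evenness of \<open>f\<close> removes the difference.\<close>

lemma verma_map_eq:
  assumes "even_periodic f"
  shows "verma_map f = fourier_const *\<^sub>C (\<Sum>k\<in>residues. fourier f k *\<^sub>C ec k)"
proof -
  have "verma_map f = fourier_const *\<^sub>C (\<Sum>k\<in>residues. (\<Sum>j\<in>residues. qp (4 * j * k) * f j) *\<^sub>C ec k)"
    unfolding verma_map_def drinfeld_mu cvs.scale_sum_right cvs.scale_sum_left scaleC_scaleC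
    by (subst sum.swap) (simp add: mult_ac)
  moreover have "(\<Sum>j\<in>residues. qp (4 * j * k) * f j) = fourier f k" for k
  proof -
    have "(\<Sum>j\<in>residues. qp (4 * j * k) * f j) = fourier f (- k)" by (simp add: fourier_def)
    then show ?thesis using even_fourier[OF assms] by (simp add: even_periodic_def)
  qed
  ultimately show ?thesis by simp
qed

lemma inj_drinfeld: "inj_on (drinfeld_map Rm) (qcharacters S)"
  by (rule inj_onI) (auto simp: qcharacters_iff fun_eq_iff intro: drinfeld_inj)

lemma S_LM_drinfeld: "\<beta> \<in> qcharacters S \<Longrightarrow> S_LM \<Delta> S Rm Lam (drinfeld_map Rm \<beta>) = radford_map \<Delta> Lam \<beta>"
  by (simp add: S_LM_def inv_into_f_f[OF inj_drinfeld])

lemma S_LM_verma_map: "S_LM \<Delta> S Rm Lam (verma_map f) = higman_const *\<^sub>C (\<Sum>k\<in>residues. f k *\<^sub>C ec k)"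
  unfolding drinfeld_verma_char[symmetric] S_LM_drinfeld[OF verma_char_qcharacter] radford_verma_char ..

lemma verma_map_central: "verma_map f \<in> hopf_center"
  unfolding hopf_center_def verma_map_def drinfeld_mu
  by (auto simp: sum_distrib_left sum_distrib_right mult_scaleC_left mult_scaleC_right ec_central cvs.scale_sum_right)

text \<open>\<open>T_LM\<close> uses \<open>inv_into\<close> on the whole center, so injectivity on
  the Higman ideal alone would not identify its value.\<close>

lemma inj_S_LM:
  assumes "ribbon_element \<Delta> \<epsilon> S Rm \<theta>"
  shows "inj_on (S_LM \<Delta> S Rm Lam) hopf_center"
proof (rule inj_onI)
  have ex: "\<exists>\<beta>\<in>qcharacters S. drinfeld_map Rm \<beta> = a" if "a \<in> hopf_center" for a
  proof -
    obtain \<beta> where \<beta>: "clinear \<beta>" "drinfeld_map Rm \<beta> = a" using drinfeld_surj by blast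
    then have "\<beta> \<in> qcharacters S"
      using that by (intro qcharacter_of_central ribbon_monodromy(2)[OF assms]) (auto simp: hopf_center_def)
    then show ?thesis using \<beta>(2) by blast
  qed
  fix a b assume ab: "a \<in> hopf_center" "b \<in> hopf_center" "S_LM \<Delta> S Rm Lam a = S_LM \<Delta> S Rm Lam b"
  obtain \<beta> \<gamma> where \<beta>: "\<beta> \<in> qcharacters S" "drinfeld_map Rm \<beta> = a"
    and \<gamma>: "\<gamma> \<in> qcharacters S" "drinfeld_map Rm \<gamma> = b"
    using ex[OF ab(1)] ex[OF ab(2)] by blast
  have "radford_map \<Delta> Lam \<beta> = radford_map \<Delta> Lam \<gamma>"
    using ab(3) S_LM_drinfeld[OF \<beta>(1)] S_LM_drinfeld[OF \<gamma>(1)] \<beta>(2) \<gamma>(2) by simp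
  then have "\<beta> x = \<gamma> x" for x using radford_inj \<beta>(1) \<gamma>(1) by (auto simp: qcharacters_iff)
  then have "\<beta> = \<gamma>" by blast
  then show "a = b" using \<beta>(2) \<gamma>(2) by simp
qed

lemma bij_verma_map: "bij_betw verma_map {f. even_periodic f} (higman_ideal \<Delta> S Lam K)"
proof -
  have "inj_on verma_map {f. even_periodic f}"
  proof (rule inj_onI, clarsimp)
    fix f g assume fg: "even_periodic f" "even_periodic g" "verma_map f = verma_map g"
    define d where "d k = fourier f k + (- 1) * fourier g k" for k
    have d: "even_periodic d"
      unfolding d_def by (intro even_periodic_add even_periodic_cmult even_fourier fg)
    have "(\<Sum>k\<in>residues. fourier f k *\<^sub>C ec k) = (\<Sum>k\<in>residues. fourier g k *\<^sub>C ec k)"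
      using fg(3) unfolding verma_map_eq[OF fg(1)] verma_map_eq[OF fg(2)]
      by (simp add: fourier_const_nz)
    then have "(\<Sum>k\<in>residues. d k *\<^sub>C ec k) = 0"
      by (simp add: d_def cvs.scale_left_diff_distrib sum_subtractf)
    then have "d k = 0" for k using sum_ec_zero[OF d] by blast
    then have "fourier f = fourier g" by (simp add: d_def fun_eq_iff)
    then have "of_nat l * f (- k) = of_nat l * g (- k)" for k
      using fourier_fourier[OF even_periodicD[OF fg(1)]] fourier_fourier[OF even_periodicD[OF fg(2)]] by metis
    then show "f = g" using fg(1,2) by (simp add: even_periodic_def fun_eq_iff)
  qed
  moreover have "verma_map ` {f. even_periodic f} = higman_ideal \<Delta> S Lam K"
    unfolding higman_ideal_eq
  proof (intro equalityI subsetI)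
    fix x assume "x \<in> verma_map ` {f. even_periodic f}"
    then obtain f where f: "even_periodic f" "x = verma_map f" by auto
    have "x = (\<Sum>k\<in>residues. (fourier_const * fourier f k) *\<^sub>C ec k)"
      by (simp only: f(2) verma_map_eq[OF f(1)] cvs.scale_sum_right scaleC_scaleC)
    then show "x \<in> (\<lambda>f. \<Sum>k\<in>residues. f k *\<^sub>C ec k) ` {f. even_periodic f}"
      using even_periodic_cmult[OF even_fourier[OF f(1)]]
      by (intro image_eqI[of _ _ "\<lambda>k. fourier_const * fourier f k"]) auto
  next
    fix x assume "x \<in> (\<lambda>f. \<Sum>k\<in>residues. f k *\<^sub>C ec k) ` {f. even_periodic f}"
    then obtain f where f: "even_periodic f" "x = (\<Sum>k\<in>residues. f k *\<^sub>C ec k)" by auto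
    \<comment> \<open>The double Fourier transform of an even function is \<open>l\<close> times
      that function, so this multiple of \<open>fourier f\<close> is the preimage.\<close>
    define c where "c = 1 / (fourier_const * of_nat l)"
    have ev: "even_periodic (\<lambda>k. c * fourier f k)" by (intro even_periodic_cmult even_fourier f)
    have "fourier (\<lambda>k. c * fourier f k) k = c * (of_nat l * f k)" for k
    proof -
      have "fourier (\<lambda>k. c * fourier f k) k = c * fourier (fourier f) k"
        unfolding fourier_def[of "\<lambda>k. c * fourier f k"] fourier_def[of "fourier f"] by (simp add: sum_distrib_left mult.left_commute)
      then show ?thesis using fourier_fourier[OF even_periodicD[OF f(1)]] f(1) by (simp add: even_periodic_def)
    qed
    then have "verma_map (\<lambda>k. c * fourier f k) = x"
      unfolding verma_map_eq[OF ev] f(2) cvs.scale_sum_right scaleC_scaleC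
      by (simp add: c_def fourier_const_nz)
    then show "x \<in> verma_map ` {f. even_periodic f}" using ev by blast
  qed
  ultimately show ?thesis by (simp add: bij_betw_def)
qed

lemma S_LM_fourier:
  assumes f: "even_periodic f"
  shows "S_LM \<Delta> S Rm Lam (verma_map f) = verma_map (\<lambda>k. (higman_const / (fourier_const * of_nat l)) * fourier f k)"
proof -
  define c where "c = higman_const / (fourier_const * of_nat l)"
  have ev: "even_periodic (\<lambda>k. c * fourier f k)" by (intro even_periodic_cmult even_fourier f)
  have "fourier (\<lambda>k. c * fourier f k) k = c * (of_nat l * f k)" for k
  proof -
    have "fourier (\<lambda>k. c * fourier f k) k = c * fourier (fourier f) k"
      unfolding fourier_def[of "\<lambda>k. c * fourier f k"] fourier_def[of "fourier f"] by (simp add: sum_distrib_left mult.left_commute)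
    then show ?thesis using fourier_fourier[OF even_periodicD[OF f(1)]] f(1) by (simp add: even_periodic_def)
  qed
  then have "verma_map (\<lambda>k. c * fourier f k) = higman_const *\<^sub>C (\<Sum>k\<in>residues. f k *\<^sub>C ec k)"
    unfolding verma_map_eq[OF ev] cvs.scale_sum_right scaleC_scaleC
    by (simp add: c_def fourier_const_nz)
  then show ?thesis by (simp add: S_LM_verma_map c_def)
qed

text \<open>\<open>S_LM\<close> sends coordinates \<open>f\<close> to coefficients along the
  \<open>ec k\<close>, where the inverse ribbon element is diagonal with Gaussian eigenvalues.
  Undoing \<open>S_LM\<close> leaves the Gaussian on \<open>f\<close>.\<close>

lemma T_LM_gauss:
  assumes ribbon: "ribbon_element \<Delta> \<epsilon> S Rm \<theta>"
  obtains d where "d \<noteq> 0"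
    "\<And>f. T_LM \<Delta> S Rm Lam \<theta> \<kappa> (verma_map f) = \<kappa> *\<^sub>C verma_map (\<lambda>x. d * gauss_mult f x)"
proof -
  obtain d where d: "d \<noteq> 0" "\<And>k. unit_inv \<theta> * ec k = (d * qp (2 * k\<^sup>2)) *\<^sub>C ec k"
    using ribbon_eigenvalues[OF ribbon] by blast
  have "T_LM \<Delta> S Rm Lam \<theta> \<kappa> (verma_map f) = \<kappa> *\<^sub>C verma_map (\<lambda>x. d * gauss_mult f x)" for f
  proof -
    have "unit_inv \<theta> * S_LM \<Delta> S Rm Lam (verma_map f) = S_LM \<Delta> S Rm Lam (verma_map (\<lambda>x. d * gauss_mult f x))"
      unfolding S_LM_verma_map
      by (simp add: mult_scaleC_right sum_distrib_left d(2) scaleC_scaleC gauss_mult_def mult_ac)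
    then show ?thesis
      unfolding T_LM_def by (simp add: inv_into_f_f[OF inj_S_LM[OF ribbon] verma_map_central])
  qed
  then show thesis using that d(1) by blast
qed

end

theorem theorem5p3p2:
  fixes l :: nat and q \<kappa> :: complex
    and \<Delta> :: "'a::complex_algebra_1 \<Rightarrow> ('a, 'a) tensor" and \<epsilon> :: "'a \<Rightarrow> complex" and S :: "'a \<Rightarrow> 'a"
    and E F K \<theta> \<Lambda> :: 'a and R :: "('a, 'a) tensor" and Hig :: "'a set"
    and S_op T_op :: "'a \<Rightarrow> 'a"
  defines "R \<equiv> R_matrix l q E F K"
    and "\<Lambda> \<equiv> integral_elem l q E F K"
    and "Hig \<equiv> higman_ideal \<Delta> S \<Lambda> K"
    and "S_op \<equiv> S_LM \<Delta> S R \<Lambda>"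
    and "T_op \<equiv> T_LM \<Delta> S R \<Lambda> \<theta> \<kappa>"
  assumes "l \<ge> 3" and "odd l" and "primitive_root_of_unity l q"
    and "small_quantum_sl2 \<Delta> \<epsilon> S l q E F K"
    and "ribbon_element \<Delta> \<epsilon> S R \<theta>"
    and "\<kappa> \<noteq> 0"
  shows "(\<exists>\<rho>. modular_representation Hig S_op T_op \<rho>) \<and>
         (\<forall>\<rho>. modular_representation Hig S_op T_op \<rho> \<longrightarrow>
            congruence_subgroup (projective_kernel SL2Z Hig \<rho>))"
proof -
  interpret small_quantum_sl2_root \<Delta> \<epsilon> S l q E F K
    using assms(6-9) by (simp add: small_quantum_sl2_root_def root_of_unity_def)
  have ribbon: "ribbon_element \<Delta> \<epsilon> S (R_matrix l q E F K) \<theta>" using assms(10) by (simp add: R_def)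
  obtain d where d: "d \<noteq> 0" "\<And>f. T_LM \<Delta> S (R_matrix l q E F K) (integral_elem l q E F K) \<theta> \<kappa> (verma_map f)
      = \<kappa> *\<^sub>C verma_map (\<lambda>x. d * gauss_mult f x)"
    using T_LM_gauss[OF ribbon] by blast
  show ?thesis
    unfolding Hig_def S_op_def T_op_def R_def \<Lambda>_def
  proof (rule weil_congruence[OF bij_verma_map _ _ S_LM_fourier])
    fix f h c
    show "verma_map (\<lambda>x. f x + h x) = verma_map f + verma_map h"
      by (simp add: verma_map_def scaleC_add_left sum.distrib)
    show scale: "verma_map (\<lambda>x. c * f x) = c *\<^sub>C verma_map f" for c
      by (simp add: verma_map_def cvs.scale_sum_right scaleC_scaleC)
    show "T_LM \<Delta> S (R_matrix l q E F K) (integral_elem l q E F K) \<theta> \<kappa> (verma_map f)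
      = verma_map (\<lambda>x. (\<kappa> * d) * gauss_mult f x)"
      using d(2)[of f] by (simp add: verma_map_def cvs.scale_sum_right scaleC_scaleC mult.assoc)
  qed (simp_all add: higman_const_nz fourier_const_nz d(1) assms(11))
qed

end
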